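(* Let $F$ be a finite graph with at least one vertex, and let $\alpha(F)$ denote its independence number. Then \[\rho(\omega\cdot F)\geq f\left(\frac{|V(F)|}{\alpha(F)}-1\right).\]
   Context: Let $K_\mathbb{N}$ be the complete graph on the natural numbers. For $S\subseteq\mathbb{N}$, its upper density is $\bar d(S)=\limsup_{t\to\infty}\frac{|S\cap[t]|}{t}$, where $[t]=\{1,\dots,t\}$; for a subgraph $G\subseteq K_\mathbb{N}$, $\bar d(G)=\bar d(V(G))$. For a countably infinite graph $H$, the Ramsey (upper) density $\rho(H)$ is the supremum of all $\lambda$ such that in every red-blue coloring of the edges of $K_\mathbb{N}$ there is a monochromatic subgraph $H'\subseteq K_\mathbb{N}$ isomorphic to $H$ with $\bar d(H')\geq\lambda$. For a finite graph $F$, $\omega\cdot F$ denotes the graph consisting of infinitely many pairwise vertex-disjoint copies of $F$. The function $f$: for a continuous $g:[0,\infty)\to\mathbb{R}$ and $\gamma,t\in\mathbb{R}$ let $\Gamma^+_\gamma(g,t)=\min\{x\ge 0:\gamma x+g(x)\geq t\}$ and $\Gamma^-_\gamma(g,t)=\min\{x\ge 0:\gamma x-g(x)\geq t\}$ (minimum of the empty set is $+\infty$). Let $h(\gamma)$ be the infimum, over all 1-Lipschitz functions $g$ with $g(0)=0$, of $\limsup_{t\to\infty}\frac{\Gamma^+_\gamma(g,t)+\Gamma^-_\gamma(g,t)}{t}$. For $\lambda\in(0,\infty)$ define \[f(\lambda)=1-\frac{1}{\frac{2\lambda}{(1+\lambda)^2}h\left(\frac{\lambda-1}{\lambda+1}\right)+\frac{2\lambda}{1+\lambda}},\]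 extended by continuity with $f(0)=1$ and $f(+\infty)=1/2$. *)

theory Defs
  imports "HOL-Analysis.Analysis" "HOL-Library.Ramsey"
begin

record 'a ugraph =
  verts :: "'a set"
  edges :: "'a set set"

definition simple_graph :: "'a ugraph \<Rightarrow> bool" where
  "simple_graph G \<longleftrightarrow> edges G \<subseteq> [verts G]\<^bsup>2\<^esup>"

definition subgraph :: "'a ugraph \<Rightarrow> 'a ugraph \<Rightarrow> bool" where
  "subgraph H G \<longleftrightarrow> simple_graph H \<and> verts H \<subseteq> verts G \<and> edges H \<subseteq> edges G"

definition graph_iso :: "'a ugraph \<Rightarrow> 'b ugraph \<Rightarrow> bool" where
  "graph_iso G H \<longleftrightarrow> (\<exists>\<phi>. bij_betw \<phi> (verts G) (verts H) \<and>
     (\<forall>u\<in>verts G. \<forall>v\<in>verts G. {u, v} \<in> edges G \<longleftrightarrow> {\<phi> u, \<phi> v} \<in> edges H))"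

definition independence_number :: "'a ugraph \<Rightarrow> nat" where
  "independence_number G = Max {card S |S. S \<subseteq> verts G \<and> indep S (edges G)}"

text \<open>The graph \<open>\<omega> \<cdot> F\<close>: the vertex \<open>(v, i)\<close> is the vertex \<open>v\<close> of the \<open>i\<close>-th copy of \<open>F\<close>.\<close>

definition omega_copies :: "'a ugraph \<Rightarrow> ('a \<times> nat) ugraph" where
  "omega_copies F =
     \<lparr>verts = verts F \<times> UNIV, edges = {e \<times> {i} |e i. e \<in> edges F}\<rparr>"

text \<open>The natural numbers start at 1 here, in accordance with \<open>[t] = {1, \<dots>, t}\<close>.\<close>

definition K_nat :: "nat ugraph" where
  "K_nat = \<lparr>verts = {1..}, edges = [{1..}]\<^bsup>2\<^esup>\<rparr>"

definition upper_density :: "nat set \<Rightarrow> ereal" where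
  "upper_density S = limsup (\<lambda>t. ereal (real (card (S \<inter> {1..t})) / real t))"

datatype colour = Red | Blue

definition monochromatic_graph :: "(nat set \<Rightarrow> colour) \<Rightarrow> nat ugraph \<Rightarrow> bool" where
  "monochromatic_graph c G \<longleftrightarrow> (\<exists>k. \<forall>e\<in>edges G. c e = k)"

text \<open>Values of the colouring \<open>c\<close> outside the edges of \<open>K_nat\<close> are irrelevant.\<close>

definition ramsey_density :: "'a ugraph \<Rightarrow> ereal" where
  "ramsey_density H = Sup {ereal l |l. \<forall>c :: nat set \<Rightarrow> colour. \<exists>H'.
     subgraph H' K_nat \<and> monochromatic_graph c H' \<and> graph_iso H H' \<and>
     upper_density (verts H') \<ge> ereal l}"

text \<open>The minimum of a set of reals, with value \<open>\<infinity>\<close> on the empty set. It is only applied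
  to closed subsets of \<open>{0..}\<close>, for which the least element exists.\<close>

definition min_or_infinity :: "real set \<Rightarrow> ereal" where
  "min_or_infinity X = (if X = {} then \<infinity> else ereal (LEAST x. x \<in> X))"

definition Gamma_plus :: "real \<Rightarrow> (real \<Rightarrow> real) \<Rightarrow> real \<Rightarrow> ereal" where
  "Gamma_plus \<gamma> g t = min_or_infinity {x. x \<ge> 0 \<and> \<gamma> * x + g x \<ge> t}"

definition Gamma_minus :: "real \<Rightarrow> (real \<Rightarrow> real) \<Rightarrow> real \<Rightarrow> ereal" where
  "Gamma_minus \<gamma> g t = min_or_infinity {x. x \<ge> 0 \<and> \<gamma> * x - g x \<ge> t}"

definition h_fun :: "real \<Rightarrow> ereal" where
  "h_fun \<gamma> = (INF g \<in> {g. 1-lipschitz_on {0..} g \<and> g 0 = 0}.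
     Limsup at_top (\<lambda>t::real. (Gamma_plus \<gamma> g t + Gamma_minus \<gamma> g t) / ereal t))"

text \<open>The function \<open>f\<close> on \<open>[0, \<infinity>]\<close>, with the values at the end points that extend it continuously.\<close>

definition f_fun :: "ereal \<Rightarrow> ereal" where
  "f_fun x = (if x = 0 then 1 else if x = \<infinity> then 1 / 2 else
     (let l = real_of_ereal x in
        1 - 1 / (ereal (2 * l / (1 + l)\<^sup>2) * h_fun ((l - 1) / (l + 1)) + ereal (2 * l / (1 + l)))))"

end

theory Submission
  imports Defs
begin

text \<open>
  Let \<open>q = \<alpha>(F)\<close>, \<open>p = |V(F)| - q\<close> and \<open>\<lambda> = p / q\<close>. A red copy of \<open>F\<close> arises from \<open>p\<close> vertices of a
  red clique and any \<open>q\<close> vertices in their common red neighbourhood. By Ramsey's theorem all but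
  boundedly many vertices of every initial segment are covered by disjoint monochromatic cliques of a
  fixed size; let \<open>R\<close> and \<open>B\<close> be the unions of the red and of the blue cliques. Red copies cover \<open>R\<close> for
  free, and they cover as much of \<open>B \<inter> [T]\<close> as can be assigned to \<open>R\<close> along red edges with \<open>p\<close> vertices of
  \<open>R\<close> for each \<open>q\<close> vertices of \<open>B\<close>. A load-balancing argument, which replaces Hall's theorem, shows that if
  red copies leave \<open>cT\<close> vertices of \<open>[T]\<close> uncovered, there are sets \<open>I \<subseteq> B \<inter> [T]\<close> and \<open>M \<subseteq> R\<close> with
  \<open>|I| - |M| / \<lambda> \<ge> cT\<close>, up to small errors, such that only few vertices of \<open>R\<close> outside \<open>M\<close> have many red
  neighbours in \<open>I\<close>. The same holds for blue with \<open>J \<subseteq> R \<inter> [U]\<close> and \<open>L \<subseteq> B\<close>.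

  For all \<open>T\<close> and \<open>U\<close> almost all of \<open>J\<close> lies in \<open>M\<close> or almost all of \<open>I\<close> lies in \<open>L\<close>, because otherwise
  one colour would be dense between \<open>J - M\<close> and \<open>I - L\<close>. In terms of sizes this says that the points
  \<open>(|I|, |M|)\<close> and \<open>(|L|, |J|)\<close> can be separated by the path \<open>((x + g x) / 2, (x - g x) / 2)\<close> of a
  1-Lipschitz function \<open>g\<close>. Then \<open>|I| + |M|\<close> and \<open>|J| + |L|\<close> bound \<open>\<Gamma>\<^sup>+(g, t)\<close> and \<open>\<Gamma>\<^sup>-(g, t)\<close> for \<open>t\<close>
  proportional to \<open>cT\<close>, and \<open>|I| + |J| \<le> T\<close> turns this into an upper bound for \<open>h\<close>, that is, for \<open>f\<close> by
  \<open>1 - c\<close>.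
\<close>

section \<open>Blocks and common neighbours\<close>

lemma disjoint_family_on_lessThan_Suc:
  assumes "disjoint_family_on X {..<t}" "\<And>k. k < t \<Longrightarrow> Y \<inter> X k = {}"
  shows "disjoint_family_on (X(t := Y)) {..<Suc t}"
  unfolding disjoint_family_on_def
proof (intro ballI impI)
  fix i j assume ij: "i \<in> {..<Suc t}" "j \<in> {..<Suc t}" "i \<noteq> j"
  show "(X(t := Y)) i \<inter> (X(t := Y)) j = {}"
    using ij assms(2)[of i] assms(2)[of j] disjoint_family_onD[OF assms(1), of i j]
    by (cases "i = t"; cases "j = t") (simp_all add: Int_commute)
qed

text \<open>Induction on \<open>r\<close>: among \<open>Suc r * s\<close> elements the pieces other
  than \<open>Y r\<close> occupy at most \<open>r * s\<close>, so \<open>Y r\<close> can grow to a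
  block of size \<open>s\<close> that avoids them; the rest is left to the induction
  hypothesis.\<close>

lemma equal_blocks_extending:
  assumes "finite X" "card X = r * s"
    and "\<And>j. j < r \<Longrightarrow> Y j \<subseteq> X" "\<And>j. j < r \<Longrightarrow> card (Y j) \<le> s"
    and "disjoint_family_on Y {..<r}"
  shows "\<exists>blk. (\<forall>j<r. Y j \<subseteq> blk j \<and> card (blk j) = s) \<and> disjoint_family_on blk {..<r} \<and>
    (\<Union>j<r. blk j) = X"
  using assms
proof (induction r arbitrary: X)
  case 0
  then show ?case by (auto simp: disjoint_family_on_def)
next
  case (Suc r)
  let ?O = "\<Union>j<r. Y j"
  have O: "?O \<subseteq> X" using Suc.prems(3) by (metis UN_least lessThan_iff less_SucI)
  have "card ?O \<le> (\<Sum>j<r. card (Y j))" by (rule card_UN_le) simp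
  also have "\<dots> \<le> (\<Sum>j<r. s)" using Suc.prems(4) by (intro sum_mono) auto
  finally have cO: "card ?O \<le> r * s" by simp
  have "card (X - ?O) = card X - card ?O"
    using O Suc.prems(1) by (meson card_Diff_subset finite_subset)
  then have c: "s \<le> card (X - ?O)" using cO Suc.prems(2) by simp
  have "Y r \<inter> Y j = {}" if "j < r" for j
    using that disjoint_family_onD[OF Suc.prems(5), of r j] by simp
  then have "Y r \<subseteq> X - ?O" using Suc.prems(3)[of r] by blast
  then obtain X0 where X0: "Y r \<subseteq> X0" "X0 \<subseteq> X - ?O" "card X0 = s"
    using exists_subset_between[of "Y r" s "X - ?O"] c Suc.prems by auto
  have fX0: "finite X0" using X0(2) Suc.prems(1) by (meson finite_Diff finite_subset)
  have "\<exists>blk. (\<forall>j<r. Y j \<subseteq> blk j \<and> card (blk j) = s) \<and> disjoint_family_on blk {..<r} \<and>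
    (\<Union>j<r. blk j) = X - X0"
  proof (rule Suc.IH)
    show "finite (X - X0)" using Suc.prems by simp
    show "card (X - X0) = r * s"
      using X0 Suc.prems fX0 by (subst card_Diff_subset) auto
    show "Y j \<subseteq> X - X0" if "j < r" for j
      using that X0(2) Suc.prems(3)[of j] by auto
    show "card (Y j) \<le> s" if "j < r" for j using that Suc.prems(4) by simp
    show "disjoint_family_on Y {..<r}" using Suc.prems(5) by (auto simp: disjoint_family_on_def)
  qed
  then obtain blk where blk: "\<forall>j<r. Y j \<subseteq> blk j \<and> card (blk j) = s"
    "disjoint_family_on blk {..<r}" "(\<Union>j<r. blk j) = X - X0" by blast
  let ?b = "blk(r := X0)"
  have "(\<Union>j<Suc r. ?b j) = (\<Union>j<r. blk j) \<union> X0"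
    by (auto simp: less_Suc_eq)
  then have "(\<Union>j<Suc r. ?b j) = X" using blk(3) X0(2) by auto
  moreover have "disjoint_family_on ?b {..<Suc r}"
    using blk(3) by (intro disjoint_family_on_lessThan_Suc[OF blk(2)]) blast
  moreover have "\<forall>j<Suc r. Y j \<subseteq> ?b j \<and> card (?b j) = s"
    using blk(1) X0 by (auto simp: less_Suc_eq)
  ultimately show ?case by blast
qed

text \<open>Used to subdivide a block so that each piece \<open>Y k\<close> lands in a part of its
  own. The injection \<open>pos\<close> names that part; the remaining positions receive the empty
  piece.\<close>

lemma equal_blocks_family:
  assumes "finite X" "card X = r * s" "finite K" "card K \<le> r"
    and Y: "\<And>k. k \<in> K \<Longrightarrow> Y k \<subseteq> X" "\<And>k. k \<in> K \<Longrightarrow> card (Y k) \<le> s"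
    and disj: "disjoint_family_on Y K"
  shows "\<exists>blk pos. (\<forall>k\<in>K. pos k < r \<and> Y k \<subseteq> blk (pos k)) \<and> inj_on pos K \<and>
    (\<forall>j<r. card (blk j) = s) \<and> disjoint_family_on blk {..<r} \<and> (\<Union>j<r. blk j) = X"
proof -
  obtain pos where pos: "pos ` K \<subseteq> {..<r}" "inj_on pos K"
    using card_le_inj[of K "{..<r}"] assms(3,4) by auto
  define Y' where "Y' j = (if j \<in> pos ` K then Y (the_inv_into K pos j) else {})" for j
  have Y'k: "Y' (pos k) = Y k" if "k \<in> K" for k
    using that pos(2) by (simp add: Y'_def the_inv_into_f_f)
  have Y'0: "Y' j = {}" if "j \<notin> pos ` K" for j using that by (simp add: Y'_def)
  have sub: "Y' j \<subseteq> X \<and> card (Y' j) \<le> s" for j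
  proof (cases "j \<in> pos ` K")
    case True
    then obtain k where "k \<in> K" "j = pos k" by blast
    then show ?thesis using Y'k[of k] Y[of k] by simp
  qed (simp add: Y'0)
  have "disjoint_family_on Y' {..<r}"
    unfolding disjoint_family_on_def
  proof (intro ballI impI)
    fix i j :: nat assume ij: "i \<noteq> j"
    show "Y' i \<inter> Y' j = {}"
    proof (cases "i \<in> pos ` K \<and> j \<in> pos ` K")
      case True
      then obtain k l where "k \<in> K" "i = pos k" "l \<in> K" "j = pos l" by blast
      then show ?thesis using Y'k[of k] Y'k[of l] disjoint_family_onD[OF disj, of k l] ij by auto
    next
      case False
      then show ?thesis using Y'0 by blast
    qed
  qed
  then obtain blk where "\<forall>j<r. Y' j \<subseteq> blk j \<and> card (blk j) = s"
    "disjoint_family_on blk {..<r}" "(\<Union>j<r. blk j) = X"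
    using equal_blocks_extending[OF assms(1,2), of Y'] sub by blast
  moreover from this have "\<forall>k\<in>K. pos k < r \<and> Y k \<subseteq> blk (pos k)" using pos(1) Y'k by blast
  ultimately show ?thesis using pos(2) by (intro exI[of _ blk] exI[of _ pos]) blast
qed

text \<open>Vertices of \<open>I\<close> are classified by their trace on \<open>W\<close>; many have a large trace, and there are
  only \<open>2 ^ card W\<close> traces.\<close>

lemma common_neighbours:
  fixes E :: "'v \<Rightarrow> 'w \<Rightarrow> bool" and e T :: real
  assumes "finite I" "card I \<le> T" "finite W" "W \<noteq> {}" "0 < e" "0 < T"
    and deg: "\<And>v. v \<in> W \<Longrightarrow> e * T \<le> card {w \<in> I. E v w}"
    and s: "2 * real s \<le> card W * e"
  shows "\<exists>P\<subseteq>W. card P = s \<and> e * T / 2 ^ (card W + 1) \<le> card {w \<in> I. \<forall>v\<in>P. E v w}"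
proof -
  define n where "n = card W"
  have n0: "n > 0" using assms(3,4) by (simp add: n_def card_gt_0_iff)
  define tr where "tr w = {v \<in> W. E v w}" for w
  define I1 where "I1 = {w \<in> I. s \<le> card (tr w)}"
  have fI1: "finite I1" using assms(1) by (simp add: I1_def)
  \<comment> \<open>Double counting of the edges between \<open>W\<close> and
    \<open>I\<close>.\<close>
  have "(\<Sum>w\<in>I. card (tr w)) = (\<Sum>v\<in>W. card {w \<in> I. E v w})"
    using sum.swap[of "\<lambda>w v. if E v w then 1 else 0 :: nat" W I] assms(1,3)
    by (simp add: tr_def sum.If_cases Int_def)
  then have "real (\<Sum>w\<in>I. card (tr w)) = (\<Sum>v\<in>W. real (card {w \<in> I. E v w}))" by simp
  also have "\<dots> \<ge> (\<Sum>v\<in>W. e * T)" by (intro sum_mono deg)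
  finally have 1: "n * (e * T) \<le> real (\<Sum>w\<in>I. card (tr w))" by (simp add: n_def)
  \<comment> \<open>Traces outside \<open>I1\<close> are smaller than \<open>s\<close>, so by the
    choice of \<open>s\<close> they account for at most half of the lower bound
    \<open>n * (e * T)\<close>; the other half forces \<open>I1\<close> to be large.\<close>
  have "(\<Sum>w\<in>I. card (tr w)) = (\<Sum>w\<in>I1. card (tr w)) + (\<Sum>w\<in>I - I1. card (tr w))"
    using assms(1) by (subst sum.subset_diff[of I1]) (auto simp: I1_def)
  also have "\<dots> \<le> (\<Sum>w\<in>I1. n) + (\<Sum>w\<in>I - I1. s)"
    using assms(3) by (intro add_mono sum_mono) (auto simp: I1_def tr_def n_def intro!: card_mono)
  also have "\<dots> \<le> card I1 * n + card I * s"
    using assms(1) by (auto intro!: card_mono)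
  finally have "real (\<Sum>w\<in>I. card (tr w)) \<le> real (card I1 * n + card I * s)"
    using of_nat_mono by blast
  also have "\<dots> \<le> card I1 * n + T * s" using assms(2) by (simp add: mult_right_mono)
  also have "T * s \<le> T * (n * e / 2)"
    using s assms(6) by (intro mult_left_mono) (auto simp: n_def)
  finally have "n * (e * T) \<le> card I1 * n + n * (e * T / 2)" using 1 by (simp add: algebra_simps)
  then have "n * (e * T / 2) \<le> n * card I1" by (simp add: algebra_simps)
  then have I1: "e * T / 2 \<le> card I1" using n0 by simp
  have "\<exists>D\<in>Pow W. e * T / 2 / 2 ^ n \<le> card {w \<in> I1. tr w = D}"
  proof (rule ccontr)
    assume "\<not> ?thesis"
    then have lt: "\<forall>D\<in>Pow W. real (card {w \<in> I1. tr w = D}) < e * T / 2 / 2 ^ n"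
      unfolding bex_simps not_le .
    have "card I1 \<le> card (\<Union>D\<in>Pow W. {w \<in> I1. tr w = D})"
    proof (rule card_mono)
      show "finite (\<Union>D\<in>Pow W. {w \<in> I1. tr w = D})" by (rule finite_subset[OF _ fI1]) blast
      show "I1 \<subseteq> (\<Union>D\<in>Pow W. {w \<in> I1. tr w = D})"
      proof
        fix w assume "w \<in> I1"
        moreover have "tr w \<in> Pow W" by (auto simp: tr_def)
        ultimately show "w \<in> (\<Union>D\<in>Pow W. {w \<in> I1. tr w = D})" by blast
      qed
    qed
    also have "\<dots> \<le> (\<Sum>D\<in>Pow W. card {w \<in> I1. tr w = D})"
      using assms(3) by (intro card_UN_le) simp
    finally have "card I1 \<le> (\<Sum>D\<in>Pow W. card {w \<in> I1. tr w = D})" .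
    then have "real (card I1) \<le> (\<Sum>D\<in>Pow W. real (card {w \<in> I1. tr w = D}))"
      by (metis of_nat_le_iff of_nat_sum)
    also have "\<dots> < (\<Sum>D\<in>Pow W. e * T / 2 / 2 ^ n)"
      using assms(3) bspec[OF lt] by (intro sum_strict_mono) (simp_all add: Pow_not_empty)
    also have "\<dots> = e * T / 2" using assms(3) by (simp add: card_Pow n_def)
    finally show False using I1 by simp
  qed
  then obtain D where D: "D \<subseteq> W" "e * T / 2 / 2 ^ n \<le> card {w \<in> I1. tr w = D}" by blast
  have "0 < e * T / 2 / 2 ^ n" using assms by simp
  then have "{w \<in> I1. tr w = D} \<noteq> {}" using D(2) by (metis card.empty of_nat_0 not_le)
  then have "s \<le> card D" by (auto simp: I1_def)
  then obtain P where P: "P \<subseteq> D" "card P = s" by (meson obtain_subset_with_card_n)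
  have "card {w \<in> I1. tr w = D} \<le> card {w \<in> I. \<forall>v\<in>P. E v w}"
    using assms(1) P(1) by (intro card_mono) (auto simp: I1_def tr_def)
  then have "e * T / 2 / 2 ^ n \<le> card {w \<in> I. \<forall>v\<in>P. E v w}" using D(2) by linarith
  moreover have "e * T / 2 / 2 ^ n = e * T / 2 ^ (card W + 1)" by (simp add: n_def)
  ultimately have "e * T / 2 ^ (card W + 1) \<le> card {w \<in> I. \<forall>v\<in>P. E v w}" by argo
  then show ?thesis using P D(1) by blast
qed

section \<open>Layered assignments of vertices to cliques\<close>

text \<open>In the application \<open>KK\<close> consists of cliques of one colour, \<open>E\<close>
  is adjacency in that colour, and \<open>B\<close> is the part of \<open>[T]\<close> covered by
  cliques of the other colour. There \<open>a = p * H\<close> and \<open>b = q\<close>: after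
  \<open>H\<close> load steps of \<open>b * m\<close> vertices a block of size \<open>a * m\<close>
  and its assigned vertices are in the ratio \<open>p\<close> to \<open>q\<close>.\<close>

locale bipartite_cells =
  fixes E :: "'v \<Rightarrow> 'w \<Rightarrow> bool" and KK :: "'v set set" and B :: "'w set"
    and a b H :: nat and C T :: real
  assumes finite_B: "finite B" and card_B: "card B \<le> T"
    and card_cells: "card (\<Union>KK) \<le> C * T"
    and a_pos: "0 < a" and b_pos: "0 < b" and T_pos: "0 < T"
begin

text \<open>A refinement of the cells into blocks \<open>A x\<close> of scale \<open>m\<close>, together with disjoint sets \<open>Z x\<close> of
  vertices assigned to the blocks. The load of a block is \<open>lev x / H\<close>, and full load corresponds to
  the ratio \<open>b * H\<close> to \<open>a\<close> between assigned vertices and block size.\<close>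

definition layered ::
  "nat \<Rightarrow> nat \<Rightarrow> (nat \<Rightarrow> 'v set) \<Rightarrow> (nat \<Rightarrow> 'w set) \<Rightarrow> (nat \<Rightarrow> nat) \<Rightarrow> bool" where
  "layered m N A Z lev \<longleftrightarrow>
     (\<forall>x<N. (\<exists>K\<in>KK. A x \<subseteq> K) \<and> card (A x) = a * m \<and> Z x \<subseteq> B \<and> card (Z x) = b * m * lev x \<and>
        lev x \<le> H \<and> (\<forall>u\<in>A x. \<forall>w\<in>Z x. E u w)) \<and>
     disjoint_family_on A {..<N} \<and> disjoint_family_on Z {..<N} \<and> (\<Union>x<N. A x) = \<Union>KK"

definition sources :: "nat \<Rightarrow> nat \<Rightarrow> (nat \<Rightarrow> 'w set) \<Rightarrow> (nat \<Rightarrow> nat) \<Rightarrow> 'w set" where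
  "sources \<theta> N Z lev = B - (\<Union>x\<in>{x. x < N \<and> lev x \<le> \<theta>}. Z x)"

text \<open>Vertices that lie in blocks of low load but have many neighbours among the vertices that are
  unassigned or assigned to blocks of high load. Reassigning such neighbours balances the loads.\<close>

definition improvable ::
  "real \<Rightarrow> nat \<Rightarrow> nat \<Rightarrow> (nat \<Rightarrow> 'v set) \<Rightarrow> (nat \<Rightarrow> 'w set) \<Rightarrow> (nat \<Rightarrow> nat) \<Rightarrow> 'v set" where
  "improvable e \<theta> N A Z lev =
     {v \<in> (\<Union>x\<in>{x. x < N \<and> lev x < \<theta>}. A x). e * T \<le> card {w \<in> sources \<theta> N Z lev. E v w}}"

text \<open>The summand is concave and increasing in the load, hence the weight grows when vertices are
  newly assigned and when they are moved to a block whose load is smaller by at least two levels. It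
  does not change when blocks are subdivided.\<close>

definition weight :: "nat \<Rightarrow> nat \<Rightarrow> (nat \<Rightarrow> nat) \<Rightarrow> real" where
  "weight m N lev = m * (\<Sum>x<N. real (lev x) * (2 * real H - real (lev x)))"

text \<open>The \<open>k\<close>-th move adds the vertices \<open>Q k\<close> to the part \<open>P k\<close> of the block \<open>\<sigma> k\<close>. They are taken from
  the block \<open>\<tau> k\<close>, or are unassigned if \<open>\<tau> k = None\<close>. The last clause allows the source blocks to be
  subdivided into \<open>r\<close> parts each of which loses at most one set \<open>Q k\<close>.\<close>

definition moves :: "nat \<Rightarrow> nat \<Rightarrow> nat \<Rightarrow> nat \<Rightarrow> (nat \<Rightarrow> 'v set) \<Rightarrow> (nat \<Rightarrow> 'w set) \<Rightarrow> (nat \<Rightarrow> nat) \<Rightarrow>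
    nat \<Rightarrow> (nat \<Rightarrow> 'v set) \<Rightarrow> (nat \<Rightarrow> 'w set) \<Rightarrow> (nat \<Rightarrow> nat) \<Rightarrow> (nat \<Rightarrow> nat option) \<Rightarrow> bool" where
  "moves \<theta> m r N A Z lev t P Q \<sigma> \<tau> \<longleftrightarrow>
     (\<forall>k<t. \<sigma> k < N \<and> lev (\<sigma> k) < \<theta> \<and> P k \<subseteq> A (\<sigma> k) \<and> card (P k) = a * m \<and> card (Q k) = b * m \<and>
        Q k \<subseteq> B \<and> (\<forall>u\<in>P k. \<forall>w\<in>Q k. E u w) \<and>
        (\<tau> k = None \<longrightarrow> Q k \<inter> (\<Union>x<N. Z x) = {}) \<and>
        (\<forall>x. \<tau> k = Some x \<longrightarrow> x < N \<and> \<theta> < lev x \<and> Q k \<subseteq> Z x)) \<and>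
     disjoint_family_on P {..<t} \<and> disjoint_family_on Q {..<t} \<and>
     (\<forall>x. card {k. k < t \<and> \<tau> k = Some x} \<le> r)"

section \<open>Finding and performing balancing moves\<close>

lemma layeredD:
  assumes "layered m N A Z lev" "x < N"
  shows "\<exists>K\<in>KK. A x \<subseteq> K" "card (A x) = a * m" "Z x \<subseteq> B" "card (Z x) = b * m * lev x"
    "lev x \<le> H" "\<forall>u\<in>A x. \<forall>w\<in>Z x. E u w" "finite (Z x)" "0 < m \<Longrightarrow> finite (A x)"
  using assms a_pos finite_subset[OF _ finite_B, of "Z x"] card_ge_0_finite[of "A x"]
  unfolding layered_def by auto

lemma layered_count:
  assumes "layered m N A Z lev" "0 < m"
  shows "N * (a * m) = card (\<Union>KK)" "real N * (a * m) \<le> C * T"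
proof -
  have "card (\<Union>x<N. A x) = (\<Sum>x<N. card (A x))"
    using layeredD(8)[OF assms(1)] assms by (intro card_UN_disjoint)
      (auto simp: layered_def disjoint_family_on_def)
  also have "\<dots> = (\<Sum>x<N. a * m)" using layeredD(2)[OF assms(1)] by (intro sum.cong) auto
  finally show *: "N * (a * m) = card (\<Union>KK)" using assms(1) by (simp add: layered_def)
  show "real N * (a * m) \<le> C * T" using card_cells unfolding *[symmetric] by simp
qed

text \<open>Each summand equals \<open>H\<^sup>2 - (H - lev x)\<^sup>2\<close>, and
  \<open>m * N\<close> is at most the number of vertices in the cells. This ceiling is what limits
  the number of refinements.\<close>

lemma weight_le:
  assumes "layered m N A Z lev" "0 < m"
  shows "weight m N lev \<le> H\<^sup>2 * (C * T)"
proof -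
  have "real (lev x) * (2 * real H - real (lev x)) \<le> H\<^sup>2" for x
  proof -
    have "0 \<le> (real H - real (lev x))\<^sup>2" by simp
    then show ?thesis by (simp add: power2_eq_square algebra_simps)
  qed
  then have "(\<Sum>x<N. real (lev x) * (2 * real H - real (lev x))) \<le> (\<Sum>x<N. real (H\<^sup>2))"
    by (intro sum_mono) simp
  then have "weight m N lev \<le> m * (N * H\<^sup>2)"
    unfolding weight_def by (simp add: mult_left_mono)
  also have "\<dots> \<le> real (a * (m * (N * H\<^sup>2)))"
    unfolding of_nat_le_iff using a_pos by (cases a) auto
  also have "\<dots> = H\<^sup>2 * (real N * (a * m))" by (simp add: algebra_simps)
  also have "\<dots> \<le> H\<^sup>2 * (C * T)" using layered_count(2)[OF assms] by (intro mult_left_mono) simp_all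
  finally show ?thesis .
qed

text \<open>While few moves have been made, discarding everything they touched leaves
  \<open>e * T / 2\<close> improvable vertices with \<open>e / 2 * T\<close> usable neighbours each.
  Some block of low load contains \<open>n0\<close> of them, and \<open>common_neighbours\<close>
  selects the receiving set \<open>P'\<close> there, with \<open>e' * T\<close> usable common
  neighbours. Enough of these are unassigned or lie together in one source block.\<close>

lemma moves_step:
  fixes e e' :: real
  assumes L: "layered (r * m) N A Z lev" and m: "0 < m" and r: "0 < r" and e: "0 < e"
    and big: "e * T \<le> card (improvable e \<theta> N A Z lev)"
    and n0: "4 * real (a * m) \<le> n0 * e" "2 * C * n0 < e * (a * (r * m))"
    and e'_def: "e' = e / 2 / 2 ^ (n0 + 1)"
    and r': "2 \<le> r * e'" and T': "2 * real (b * m) \<le> e' * T"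
    and t: "real t * (m * (a + b + b * H)) \<le> e * T / 2"
    and mv: "moves \<theta> m r N A Z lev t P Q \<sigma> \<tau>"
  shows "\<exists>P Q \<sigma> \<tau>. moves \<theta> m r N A Z lev (Suc t) P Q \<sigma> \<tau>"
proof -
  define V where "V = improvable e \<theta> N A Z lev"
  define S where "S = sources \<theta> N Z lev"
  have rm: "0 < r * m" using r m by simp
  note LD = layeredD[OF L] and fA = layeredD(8)[OF L _ rm]
  have mvD: "\<sigma> k < N" "lev (\<sigma> k) < \<theta>" "P k \<subseteq> A (\<sigma> k)" "card (P k) = a * m" "card (Q k) = b * m"
    "Q k \<subseteq> B" "\<And>x. \<tau> k = Some x \<Longrightarrow> x < N \<and> \<theta> < lev x \<and> Q k \<subseteq> Z x" if "k < t" for k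
    using mv that unfolding moves_def by blast+
  \<comment> \<open>\<open>X\<close> collects the source blocks that have already given up
    \<open>r\<close> sets; their vertices are no longer usable, since each of the \<open>r\<close>
    parts may lose only one set.\<close>
  define V2 where "V2 = V - (\<Union>k<t. P k)"
  define X where "X = {x. x < N \<and> card {k. k < t \<and> \<tau> k = Some x} = r}"
  have fX: "finite X" by (simp add: X_def)
  define S2 where "S2 = S - (\<Union>k<t. Q k) - (\<Union>x\<in>X. Z x)"
  have fS: "finite S" using finite_B by (simp add: S_def sources_def)
  have Vsub: "V \<subseteq> (\<Union>x\<in>{x. x < N \<and> lev x < \<theta>}. A x)" by (auto simp: V_def improvable_def)
  have fV: "finite V" by (rule finite_subset[OF Vsub]) (auto intro: fA)
  have cP: "real (card (\<Union>k<t. P k)) \<le> real t * (m * a)"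
  proof -
    have "card (\<Union>k<t. P k) \<le> (\<Sum>k<t. card (P k))" by (rule card_UN_le) simp
    also have "\<dots> = (\<Sum>k<t. a * m)" using mvD(4) by (intro sum.cong) auto
    finally have "card (\<Union>k<t. P k) \<le> t * (m * a)" by (simp add: mult.commute)
    then show ?thesis by (metis of_nat_le_iff of_nat_mult)
  qed
  have cQ: "real (card (\<Union>k<t. Q k)) \<le> real t * (m * b)"
  proof -
    have "card (\<Union>k<t. Q k) \<le> (\<Sum>k<t. card (Q k))" by (rule card_UN_le) simp
    also have "\<dots> = (\<Sum>k<t. b * m)" using mvD(5) by (intro sum.cong) auto
    finally have "card (\<Union>k<t. Q k) \<le> t * (m * b)" by (simp add: mult.commute)
    then show ?thesis by (metis of_nat_le_iff of_nat_mult)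
  qed
  \<comment> \<open>Every exhausted block accounts for \<open>r\<close> of the \<open>t\<close>
    moves. This factor \<open>r\<close> cancels the factor \<open>r\<close> in the size of its
    assigned set, so the loss is bounded in terms of \<open>t * m\<close> alone.\<close>
  have "(\<Sum>x\<in>X. card {k. k < t \<and> \<tau> k = Some x}) = card (\<Union>x\<in>X. {k. k < t \<and> \<tau> k = Some x})"
    using fX by (intro card_UN_disjoint[symmetric]) auto
  also have "\<dots> \<le> card {..<t}" by (intro card_mono) auto
  finally have cX: "card X * r \<le> t" by (simp add: X_def)
  have cZ: "real (card (\<Union>x\<in>X. Z x)) \<le> real t * (m * (b * H))"
  proof -
    have "card (\<Union>x\<in>X. Z x) \<le> (\<Sum>x\<in>X. card (Z x))" by (rule card_UN_le) (rule fX)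
    also have "\<dots> \<le> (\<Sum>x\<in>X. b * (r * m) * H)"
      using LD(4,5) by (intro sum_mono) (auto simp: X_def)
    also have "\<dots> = card X * r * (m * (b * H))" by (simp add: algebra_simps)
    also have "\<dots> \<le> t * (m * (b * H))" using cX by (rule mult_right_mono) simp
    finally show ?thesis by (metis of_nat_le_iff of_nat_mult)
  qed
  have t': "real t * (m * a) + real t * (m * b) + real t * (m * (b * H)) \<le> e * T / 2"
    using t by (simp add: algebra_simps)
  have nn: "0 \<le> real t * (m * a)" "0 \<le> real t * (m * b)" "0 \<le> real t * (m * (b * H))" by simp_all
  have "card V \<le> card V2 + card (\<Union>k<t. P k)"
  proof -
    have "finite (\<Union>k<t. P k)"
      by (intro finite_UN_I finite_subset[OF mvD(3) fA] mvD(1)) auto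
    then have "card V \<le> card (V2 \<union> (\<Union>k<t. P k))"
      using fV by (intro card_mono) (auto simp: V2_def)
    then show ?thesis using card_Un_le le_trans by blast
  qed
  then have V2: "e * T / 2 \<le> card V2" using cP t' nn big unfolding V_def by linarith
  have deg: "e / 2 * T \<le> card {w \<in> S2. E v w}" if "v \<in> V2" for v
  proof -
    have "finite ((\<Union>k<t. Q k) \<union> (\<Union>x\<in>X. Z x))"
      by (rule finite_subset[OF _ finite_B]) (use mvD(6) LD(3) in \<open>auto simp: X_def\<close>)
    then have "card {w \<in> S. E v w} \<le> card ({w \<in> S2. E v w} \<union> ((\<Union>k<t. Q k) \<union> (\<Union>x\<in>X. Z x)))"
      using fS by (intro card_mono) (auto simp: S2_def)
    also have "\<dots> \<le> card {w \<in> S2. E v w} + card ((\<Union>k<t. Q k) \<union> (\<Union>x\<in>X. Z x))" by (rule card_Un_le)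
    also have "\<dots> \<le> card {w \<in> S2. E v w} + (card (\<Union>k<t. Q k) + card (\<Union>x\<in>X. Z x))"
      using card_Un_le by simp
    finally have "real (card {w \<in> S. E v w})
        \<le> card {w \<in> S2. E v w} + (real (card (\<Union>k<t. Q k)) + card (\<Union>x\<in>X. Z x))"
      by (metis of_nat_add of_nat_le_iff)
    moreover have "e * T \<le> card {w \<in> S. E v w}"
      using that by (simp add: V2_def V_def improvable_def S_def)
    ultimately show ?thesis using cQ cZ t' nn by linarith
  qed
  \<comment> \<open>Pigeonhole over the blocks: there are at most \<open>C * T / (a * r * m)\<close>
    of them, and by the second condition on \<open>n0\<close> fewer than \<open>n0 + 1\<close>
    vertices per block could not make up \<open>e * T / 2\<close>.\<close>
  have "\<exists>x<N. lev x < \<theta> \<and> n0 \<le> card (A x \<inter> V2)"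
  proof (rule ccontr)
    assume "\<not> ?thesis"
    then have lt: "card (A x \<inter> V2) \<le> n0" if "x < N" "lev x < \<theta>" for x
      using that nat_le_linear by blast
    have "card V2 \<le> card (\<Union>x\<in>{x. x < N \<and> lev x < \<theta>}. A x \<inter> V2)"
    proof (rule card_mono)
      show "finite (\<Union>x\<in>{x. x < N \<and> lev x < \<theta>}. A x \<inter> V2)"
        by (rule finite_subset[OF _ fV]) (auto simp: V2_def)
      show "V2 \<subseteq> (\<Union>x\<in>{x. x < N \<and> lev x < \<theta>}. A x \<inter> V2)" using Vsub by (auto simp: V2_def)
    qed
    also have "\<dots> \<le> (\<Sum>x\<in>{x. x < N \<and> lev x < \<theta>}. card (A x \<inter> V2))"
      by (rule card_UN_le) simp
    also have "\<dots> \<le> (\<Sum>x\<in>{x. x < N \<and> lev x < \<theta>}. n0)" using lt by (intro sum_mono) auto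
    also have "\<dots> \<le> N * n0"
    proof -
      have "card {x. x < N \<and> lev x < \<theta>} \<le> card {..<N}" by (intro card_mono) auto
      then show ?thesis by simp
    qed
    finally have "e * T / 2 \<le> real N * n0" using V2 by (metis of_nat_le_iff of_nat_mult order_trans)
    then have "e * T / 2 * (a * (r * m)) \<le> real N * n0 * (a * (r * m))"
      by (rule mult_right_mono) simp
    also have "\<dots> = n0 * (real N * (a * (r * m)))" by (simp add: algebra_simps)
    also have "\<dots> \<le> n0 * (C * T)" by (intro mult_left_mono layered_count(2)[OF L rm]) simp
    finally have "e * (a * (r * m)) * T \<le> 2 * C * n0 * T" by (simp add: algebra_simps)
    then show False using n0(2) T_pos by (simp add: mult_le_cancel_right)
  qed
  then obtain x where x: "x < N" "lev x < \<theta>" "n0 \<le> card (A x \<inter> V2)" by blast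
  obtain W where W: "W \<subseteq> A x \<inter> V2" "card W = n0"
    using x(3) by (meson obtain_subset_with_card_n)
  have "0 < real a * real m" using m a_pos by simp
  then have n0pos: "0 < n0" using n0(1) by (cases "n0 = 0") auto
  have fW: "finite W" "W \<noteq> {}" using W n0pos by (auto intro: card_ge_0_finite)
  have "\<exists>P'\<subseteq>W. card P' = a * m \<and>
      e / 2 * T / 2 ^ (card W + 1) \<le> card {w \<in> S2. \<forall>v\<in>P'. E v w}"
  proof (rule common_neighbours)
    show "finite S2" using fS by (simp add: S2_def)
    have "card S2 \<le> card B" using finite_B by (intro card_mono) (auto simp: S2_def S_def sources_def)
    then show "card S2 \<le> T" using card_B by linarith
    show "2 * real (a * m) \<le> card W * (e / 2)" using n0(1) W(2) by simp
    show "e / 2 * T \<le> card {w \<in> S2. E v w}" if "v \<in> W" for v using deg that W(1) by blast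
  qed (use fW e T_pos in auto)
  then obtain P' where P': "P' \<subseteq> W" "card P' = a * m"
    "e / 2 * T / 2 ^ (card W + 1) \<le> card {w \<in> S2. \<forall>v\<in>P'. E v w}" by blast
  define Y where "Y = {w \<in> S2. \<forall>v\<in>P'. E v w}"
  have fY: "finite Y" using fS by (simp add: Y_def S2_def)
  have Ysub: "Y \<subseteq> B" by (auto simp: Y_def S2_def S_def sources_def)
  have e'T: "e / 2 * T / 2 ^ (card W + 1) = e' * T" by (simp add: e'_def W(2))
  have cY: "e' * T \<le> card Y" using P'(3) unfolding e'T Y_def .
  define D where "D = {x. x < N \<and> \<theta> < lev x \<and> x \<notin> X}"
  have "\<exists>Q' o'. Q' \<subseteq> Y \<and> card Q' = b * m \<and> (o' = None \<longrightarrow> Q' \<inter> (\<Union>x<N. Z x) = {}) \<and>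
      (\<forall>y. o' = Some y \<longrightarrow> y \<in> D \<and> Q' \<subseteq> Z y)"
  proof (cases "b * m \<le> card (Y - (\<Union>x<N. Z x))")
    case True
    then obtain Q' where "Q' \<subseteq> Y - (\<Union>x<N. Z x)" "card Q' = b * m"
      by (meson obtain_subset_with_card_n)
    then show ?thesis by (intro exI[of _ Q'] exI[of _ None]) auto
  next
    case F: False
    \<comment> \<open>A source block has positive level and so holds at least
      \<open>b * r * m\<close> vertices; as \<open>2 \<le> r * e'\<close>, a share of
      \<open>b * m\<close> is at most the fraction \<open>e' / 2\<close> of it. Summed over the
      disjoint sets \<open>Z y\<close>, such shares and fewer than \<open>b * m\<close> unassigned
      vertices stay below \<open>e' * T\<close>.\<close>
    have "\<exists>y\<in>D. b * m \<le> card (Y \<inter> Z y)"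
    proof (rule ccontr)
      assume "\<not> ?thesis"
      then have lt: "card (Y \<inter> Z y) \<le> b * m" if "y \<in> D" for y
        using that nat_le_linear by blast
      have le: "real (card (Y \<inter> Z y)) \<le> e' / 2 * card (Z y)" if "y \<in> D" for y
      proof -
        have y: "y < N" "1 \<le> lev y" using that by (auto simp: D_def)
        have "real (card (Y \<inter> Z y)) \<le> real (b * m) * 1"
          using lt[OF that] by (simp only: of_nat_le_iff mult_1_right)
        also have "\<dots> \<le> real (b * m) * (r * e' / 2)" using r' by (intro mult_left_mono) simp_all
        also have "\<dots> = e' / 2 * (b * (r * m)) * 1" by simp
        also have "\<dots> \<le> e' / 2 * (b * (r * m)) * lev y"
          using y e by (intro mult_left_mono) (simp_all add: e'_def)
        also have "\<dots> = e' / 2 * card (Z y)" using LD(4)[OF y(1)] by simp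
        finally show ?thesis .
      qed
      have fD: "finite D" by (simp add: D_def)
      have "Y \<subseteq> (Y - (\<Union>x<N. Z x)) \<union> (\<Union>y\<in>D. Y \<inter> Z y)"
      proof
        fix w assume w: "w \<in> Y"
        show "w \<in> (Y - (\<Union>x<N. Z x)) \<union> (\<Union>y\<in>D. Y \<inter> Z y)"
        proof (cases "w \<in> (\<Union>x<N. Z x)")
          case True
          then obtain y where y: "y < N" "w \<in> Z y" by blast
          have w2: "w \<in> S2" using w by (simp add: Y_def)
          then have "w \<notin> (\<Union>x\<in>{x. x < N \<and> lev x \<le> \<theta>}. Z x)"
            by (simp add: S2_def S_def sources_def)
          then have "\<theta> < lev y" using y by (cases "lev y \<le> \<theta>") auto
          moreover have "y \<notin> X" using w2 y by (auto simp: S2_def)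
          ultimately show ?thesis using w y by (auto simp: D_def)
        qed (use w in blast)
      qed
      then have "card Y \<le> card ((Y - (\<Union>x<N. Z x)) \<union> (\<Union>y\<in>D. Y \<inter> Z y))"
        by (rule card_mono[rotated]) (use fY fD in auto)
      also have "\<dots> \<le> card (Y - (\<Union>x<N. Z x)) + card (\<Union>y\<in>D. Y \<inter> Z y)" by (rule card_Un_le)
      also have "\<dots> \<le> card (Y - (\<Union>x<N. Z x)) + (\<Sum>y\<in>D. card (Y \<inter> Z y))"
        by (intro add_left_mono card_UN_le fD)
      finally have "real (card Y) \<le> real (card (Y - (\<Union>x<N. Z x)) + (\<Sum>y\<in>D. card (Y \<inter> Z y)))"
        unfolding of_nat_le_iff .
      also have "\<dots> = card (Y - (\<Union>x<N. Z x)) + (\<Sum>y\<in>D. real (card (Y \<inter> Z y)))"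
        by (simp only: of_nat_add of_nat_sum)
      also have "(\<Sum>y\<in>D. real (card (Y \<inter> Z y))) \<le> (\<Sum>y\<in>D. e' / 2 * card (Z y))"
        by (intro sum_mono le)
      also have "\<dots> = e' / 2 * real (\<Sum>y\<in>D. card (Z y))" by (simp add: sum_distrib_left)
      also have "(\<Sum>y\<in>D. card (Z y)) = card (\<Union>y\<in>D. Z y)"
        using L LD(7) fD by (intro card_UN_disjoint[symmetric])
          (auto simp: D_def layered_def disjoint_family_on_def)
      also have "e' / 2 * real (card (\<Union>y\<in>D. Z y)) \<le> e' / 2 * T"
      proof (rule mult_left_mono)
        have "card (\<Union>y\<in>D. Z y) \<le> card B"
          using finite_B LD(3) by (intro card_mono) (auto simp: D_def)
        then show "card (\<Union>y\<in>D. Z y) \<le> T" using card_B by linarith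
      qed (use e in \<open>simp add: e'_def\<close>)
      finally have "real (card Y) \<le> card (Y - (\<Union>x<N. Z x)) + e' / 2 * T" by simp
      moreover have "real (card (Y - (\<Union>x<N. Z x))) < real (b * m)"
        using F by (simp only: of_nat_less_iff not_le)
      ultimately show False using cY T' by linarith
    qed
    then obtain y where y: "y \<in> D" "b * m \<le> card (Y \<inter> Z y)" by blast
    then obtain Q' where "Q' \<subseteq> Y \<inter> Z y" "card Q' = b * m"
      by (meson obtain_subset_with_card_n)
    then show ?thesis using y(1) by (intro exI[of _ Q'] exI[of _ "Some y"]) auto
  qed
  then obtain Q' o' where Q': "Q' \<subseteq> Y" "card Q' = b * m" "o' = None \<longrightarrow> Q' \<inter> (\<Union>x<N. Z x) = {}"
    "\<And>y. o' = Some y \<Longrightarrow> y \<in> D \<and> Q' \<subseteq> Z y" by blast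
  have "moves \<theta> m r N A Z lev (Suc t) (P(t := P')) (Q(t := Q')) (\<sigma>(t := x)) (\<tau>(t := o'))"
    unfolding moves_def
  proof (intro conjI allI impI)
    fix k assume k: "k < Suc t"
    then have kc: "k < t \<or> k = t" by linarith
    have old: "\<sigma> k < N \<and> lev (\<sigma> k) < \<theta> \<and> P k \<subseteq> A (\<sigma> k) \<and> card (P k) = a * m \<and> card (Q k) = b * m \<and>
        Q k \<subseteq> B \<and> (\<forall>u\<in>P k. \<forall>w\<in>Q k. E u w) \<and>
        (\<tau> k = None \<longrightarrow> Q k \<inter> (\<Union>x<N. Z x) = {}) \<and>
        (\<forall>x. \<tau> k = Some x \<longrightarrow> x < N \<and> \<theta> < lev x \<and> Q k \<subseteq> Z x)" if "k < t"
      using mv that unfolding moves_def by blast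
    show "(\<sigma>(t := x)) k < N" "lev ((\<sigma>(t := x)) k) < \<theta>"
      using kc x old by (cases "k = t"; simp)+
    show "(P(t := P')) k \<subseteq> A ((\<sigma>(t := x)) k)"
      using kc old P'(1) W(1) by (cases "k = t") auto
    show "card ((P(t := P')) k) = a * m" using kc old P'(2) by (cases "k = t") auto
    show "card ((Q(t := Q')) k) = b * m" using kc old Q'(2) by (cases "k = t") auto
    show "(Q(t := Q')) k \<subseteq> B" using kc old Q'(1) Ysub by (cases "k = t") auto
    show "\<forall>u\<in>(P(t := P')) k. \<forall>w\<in>(Q(t := Q')) k. E u w"
      using kc old Q'(1) by (cases "k = t") (auto simp: Y_def)
    show "(Q(t := Q')) k \<inter> (\<Union>x<N. Z x) = {}" if "(\<tau>(t := o')) k = None"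
      using kc old Q'(3) that by (cases "k = t") auto
    fix y assume y: "(\<tau>(t := o')) k = Some y"
    show "y < N" "\<theta> < lev y" "(Q(t := Q')) k \<subseteq> Z y"
      using kc old Q'(4)[of y] y by (cases "k = t"; simp add: D_def)+
  next
    have "P' \<inter> P k = {}" if "k < t" for k using that P'(1) W(1) by (auto simp: V2_def)
    then show "disjoint_family_on (P(t := P')) {..<Suc t}"
      using mv by (intro disjoint_family_on_lessThan_Suc) (auto simp: moves_def)
    have "Q' \<inter> Q k = {}" if "k < t" for k using that Q'(1) by (auto simp: Y_def S2_def)
    then show "disjoint_family_on (Q(t := Q')) {..<Suc t}"
      using mv by (intro disjoint_family_on_lessThan_Suc) (auto simp: moves_def)
  next
    fix y
    have le: "card {k. k < t \<and> \<tau> k = Some y} \<le> r" using mv unfolding moves_def by blast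
    show "card {k. k < Suc t \<and> (\<tau>(t := o')) k = Some y} \<le> r"
    proof (cases "o' = Some y")
      case True
      then have "y \<in> D" using Q'(4) by blast
      then have "card {k. k < t \<and> \<tau> k = Some y} < r" using le by (auto simp: D_def X_def)
      moreover have "{k. k < Suc t \<and> (\<tau>(t := o')) k = Some y} = insert t {k. k < t \<and> \<tau> k = Some y}"
        using True by auto
      ultimately show ?thesis by simp
    next
      case False
      then have "{k. k < Suc t \<and> (\<tau>(t := o')) k = Some y} = {k. k < t \<and> \<tau> k = Some y}"
        by (auto simp: less_Suc_eq)
      then show ?thesis using le by simp
    qed
  qed
  then show ?thesis by blast
qed

text \<open>Every block is cut into \<open>r\<close> parts such that each \<open>P k\<close> is a
  whole part and each \<open>Q k\<close> with a source block lies within the assigned set of a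
  single part. A move then raises the level of one part by one and lowers that of at most one other
  part by one, so the result is layered at scale \<open>m\<close>.\<close>

lemma apply_moves:
  assumes L: "layered (r * m) N A Z lev" and m: "0 < m" and r: "0 < r" and \<theta>: "\<theta> < H"
    and mv: "moves \<theta> m r N A Z lev t P Q \<sigma> \<tau>"
  shows "\<exists>N' A' Z' lev'. layered m N' A' Z' lev' \<and>
    weight (r * m) N lev + 2 * real m * t \<le> weight m N' lev'"
proof -
  have rm: "0 < r * m" using r m by simp
  have am: "0 < a * m" using a_pos m by simp
  note LD = layeredD[OF L] and fA = layeredD(8)[OF L _ rm]
  have LA: "disjoint_family_on A {..<N}" and LZ: "disjoint_family_on Z {..<N}"
    and LU: "(\<Union>x<N. A x) = \<Union>KK" using L by (auto simp: layered_def)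
  have mvD: "\<sigma> k < N" "lev (\<sigma> k) < \<theta>" "P k \<subseteq> A (\<sigma> k)" "card (P k) = a * m" "card (Q k) = b * m"
    "Q k \<subseteq> B" "\<forall>u\<in>P k. \<forall>w\<in>Q k. E u w" "\<tau> k = None \<Longrightarrow> Q k \<inter> (\<Union>x<N. Z x) = {}" if "k < t" for k
    using mv that unfolding moves_def by blast+
  have mvS: "x < N" "\<theta> < lev x" "Q k \<subseteq> Z x" if "k < t" "\<tau> k = Some x" for k x
    using mv that unfolding moves_def by blast+
  have dP: "disjoint_family_on P {..<t}" and dQ: "disjoint_family_on Q {..<t}"
    and cK2: "card {k. k < t \<and> \<tau> k = Some x} \<le> r" for x
    using mv unfolding moves_def by blast+
  have fP: "finite (P k)" if "k < t" for k 
    using finite_subset[OF mvD(3)[OF that] fA[OF mvD(1)[OF that]]] .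
  have fQ: "finite (Q k)" if "k < t" for k using finite_subset[OF mvD(6)[OF that] finite_B] .

  define PhiA where "PhiA x blk pos \<longleftrightarrow>
    (\<forall>k\<in>{k. k < t \<and> \<sigma> k = x}. pos k < r \<and> P k \<subseteq> blk (pos k)) \<and>
    inj_on pos {k. k < t \<and> \<sigma> k = x} \<and> (\<forall>j<r. card (blk j) = a * m) \<and>
    disjoint_family_on blk {..<r} \<and> (\<Union>j<r. blk j) = A x" for x and blk :: "nat \<Rightarrow> 'v set" and pos
  have "\<exists>blk pos. PhiA x blk pos" if True: "x < N" for x
  proof -
    let ?K = "{k. k < t \<and> \<sigma> k = x}"
    have dK: "disjoint_family_on P ?K" by (rule disjoint_family_on_mono[OF _ dP]) auto
    have "card (\<Union>k\<in>?K. P k) = (\<Sum>k\<in>?K. card (P k))"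
      using fP disjoint_family_onD[OF dK] by (intro card_UN_disjoint) auto
    also have "\<dots> = (\<Sum>k\<in>?K. a * m)" using mvD(4) by (intro sum.cong) auto
    finally have "card ?K * (a * m) = card (\<Union>k\<in>?K. P k)" by simp
    also have "\<dots> \<le> card (A x)" using mvD(3) fA[OF True] by (intro card_mono) blast+
    also have "\<dots> = r * (a * m)" using LD(2)[OF True] by simp
    finally have "card ?K \<le> r" using am by simp
    then have "\<exists>blk pos. (\<forall>k\<in>?K. pos k < r \<and> P k \<subseteq> blk (pos k)) \<and> inj_on pos ?K \<and>
        (\<forall>j<r. card (blk j) = a * m) \<and> disjoint_family_on blk {..<r} \<and> (\<Union>j<r. blk j) = A x"
      using fA[OF True] LD(2)[OF True] mvD(3,4) dK
      by (intro equal_blocks_family) auto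
    then show ?thesis unfolding PhiA_def .
  qed
  then obtain bA pA where A_ex: "\<And>x. x < N \<Longrightarrow> PhiA x (bA x) (pA x)"
    by metis
  note A_all = A_ex[unfolded PhiA_def]
  have bA: "pA (\<sigma> k) k < r" "P k \<subseteq> bA (\<sigma> k) (pA (\<sigma> k) k)" if "k < t" for k
    using A_all[OF mvD(1)[OF that]] that by blast+
  have bA2: "inj_on (pA x) {k. k < t \<and> \<sigma> k = x}" "disjoint_family_on (bA x) {..<r}"
    "(\<Union>j<r. bA x j) = A x" "\<And>j. j < r \<Longrightarrow> card (bA x j) = a * m" if "x < N" for x
    using A_all[OF that] by blast+

  define PhiZ where "PhiZ x blk pos \<longleftrightarrow>
    (\<forall>k\<in>{k. k < t \<and> \<tau> k = Some x}. pos k < r \<and> Q k \<subseteq> blk (pos k)) \<and>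
    inj_on pos {k. k < t \<and> \<tau> k = Some x} \<and> (\<forall>j<r. card (blk j) = b * m * lev x) \<and>
    disjoint_family_on blk {..<r} \<and> (\<Union>j<r. blk j) = Z x" for x and blk :: "nat \<Rightarrow> 'w set" and pos
  have "\<exists>blk pos. PhiZ x blk pos" if True: "x < N" for x
  proof -
    let ?K = "{k. k < t \<and> \<tau> k = Some x}"
    have dK: "disjoint_family_on Q ?K" by (rule disjoint_family_on_mono[OF _ dQ]) auto
    have "card (Q k) \<le> b * m * lev x" if "k \<in> ?K" for k
      using that mvD(5)[of k] mvS(2)[of k x] by (cases "lev x") auto
    then have "\<exists>blk pos. (\<forall>k\<in>?K. pos k < r \<and> Q k \<subseteq> blk (pos k)) \<and> inj_on pos ?K \<and>
        (\<forall>j<r. card (blk j) = b * m * lev x) \<and> disjoint_family_on blk {..<r} \<and>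
        (\<Union>j<r. blk j) = Z x"
      using LD(7)[OF True] LD(4)[OF True] cK2 dK mvS(3)
      by (intro equal_blocks_family) auto
    then show ?thesis unfolding PhiZ_def .
  qed
  then obtain bZ pZ where Z_ex: "\<And>x. x < N \<Longrightarrow> PhiZ x (bZ x) (pZ x)"
    by metis
  note Z_all = Z_ex[unfolded PhiZ_def]
  have bZ: "pZ x k < r" "Q k \<subseteq> bZ x (pZ x k)" if "k < t" "\<tau> k = Some x" for k x
    using Z_all[OF mvS(1)[OF that]] that by blast+
  have bZ2: "inj_on (pZ x) {k. k < t \<and> \<tau> k = Some x}" "disjoint_family_on (bZ x) {..<r}"
    "(\<Union>j<r. bZ x j) = Z x" "\<And>j. j < r \<Longrightarrow> card (bZ x j) = b * m * lev x" if "x < N" for x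
    using Z_all[OF that] by blast+

  \<comment> \<open>The \<open>j\<close>-th part of block \<open>x\<close> gets the index
    \<open>x * r + j\<close>. \<open>rc k\<close> is the part receiving \<open>Q k\<close>;
    \<open>dn k\<close> is the part losing it, meaningful only when
    \<open>\<tau> k \<noteq> None\<close>.\<close>
  define A' where "A' y = bA (y div r) (y mod r)" for y
  define Zb where "Zb y = bZ (y div r) (y mod r)" for y
  define rc where "rc k = \<sigma> k * r + pA (\<sigma> k) k" for k
  define dn where "dn k = the (\<tau> k) * r + pZ (the (\<tau> k)) k" for k
  define Y1 where "Y1 = rc ` {..<t}"
  define Y2 where "Y2 = dn ` {k. k < t \<and> \<tau> k \<noteq> None}"
  define Z' where "Z' y = (Zb y - (\<Union>k<t. Q k)) \<union> (\<Union>k\<in>{k. k < t \<and> rc k = y}. Q k)" for y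
  define lev' where "lev' y = (if y \<in> Y1 then lev (y div r) + 1 else
    if y \<in> Y2 then lev (y div r) - 1 else lev (y div r))" for y
  have idx: "y div r < N" "y mod r < r" if "y < N * r" for y
    using that r by (simp_all add: less_mult_imp_div_less)
  have comb: "x * r + j < N * r" "(x * r + j) div r = x" "(x * r + j) mod r = j"
    if "x < N" "j < r" for x j
  proof -
    have "x * r + j < Suc x * r" using that(2) by simp
    also have "\<dots> \<le> N * r" using that(1) by (intro mult_right_mono) auto
    finally show "x * r + j < N * r" .
    show "(x * r + j) div r = x" "(x * r + j) mod r = j" using that(2) by simp_all
  qed
  have rcD: "rc k < N * r" "rc k div r = \<sigma> k" "rc k mod r = pA (\<sigma> k) k" if "k < t" for k
    using comb[OF mvD(1)[OF that] bA(1)[OF that]] unfolding rc_def .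
  have dnD: "dn k < N * r" "dn k div r = x" "dn k mod r = pZ x k" if "k < t" "\<tau> k = Some x" for k x
    using comb[OF mvS(1)[OF that] bZ(1)[OF that]] that(2) by (simp_all add: dn_def)
  have inj_rc: "inj_on rc {..<t}"
  proof (rule inj_onI)
    fix k l assume kl: "k \<in> {..<t}" "l \<in> {..<t}" "rc k = rc l"
    then have s: "\<sigma> k = \<sigma> l" using rcD(2)[of k] rcD(2)[of l] by simp
    then have "pA (\<sigma> k) k = pA (\<sigma> k) l" using kl rcD(3)[of k] rcD(3)[of l] by simp
    then show "k = l" using bA2(1)[OF mvD(1)[of k]] kl s by (auto dest: inj_onD)
  qed
  have inj_dn: "k = l" if kl: "k < t" "\<tau> k \<noteq> None" "l < t" "\<tau> l \<noteq> None" "dn k = dn l" for k l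
  proof -
    obtain x y where xy: "\<tau> k = Some x" "\<tau> l = Some y" using kl(2,4) by auto
    then have s: "x = y" using that dnD(2)[of k x] dnD(2)[of l y] by simp
    then have "pZ x k = pZ x l" using that xy dnD(3)[of k x] dnD(3)[of l y] by simp
    then show "k = l" using bZ2(1)[OF mvS(1)[of k x]] that s xy by (auto dest: inj_onD)
  qed
  have Y1: "y < N * r" "lev (y div r) < \<theta>" if "y \<in> Y1" for y
    using that rcD mvD(2) by (auto simp: Y1_def)
  have Y2: "y < N * r" "\<theta> < lev (y div r)" if "y \<in> Y2" for y
    using that dnD mvS(2) by (auto simp: Y2_def)
  \<comment> \<open>Only adjacency to \<open>P k\<close> is known for the new vertices
    \<open>Q k\<close>; it suffices because \<open>P k\<close> has the size of a whole part and
    hence fills it.\<close>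
  have PA': "A' (rc k) = P k" if "k < t" for k
  proof -
    have c: "card (bA (\<sigma> k) (pA (\<sigma> k) k)) = a * m" using bA2(4)[OF mvD(1)[OF that] bA(1)[OF that]] .
    then have "finite (bA (\<sigma> k) (pA (\<sigma> k) k))" using am by (simp add: card_ge_0_finite)
    then have "P k = bA (\<sigma> k) (pA (\<sigma> k) k)"
      using bA(2)[OF that] c mvD(4)[OF that] by (simp add: card_subset_eq)
    then show ?thesis using rcD[OF that] by (simp add: A'_def)
  qed
  have A'sub: "A' y \<subseteq> A (y div r)" if "y < N * r" for y
    using bA2(3)[OF idx(1)[OF that]] idx(2)[OF that] by (auto simp: A'_def)
  have Zbsub: "Zb y \<subseteq> Z (y div r)" if "y < N * r" for y
    using bZ2(3)[OF idx(1)[OF that]] idx(2)[OF that] by (auto simp: Zb_def)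
  have fZb: "finite (Zb y)" if "y < N * r" for y
    using finite_subset[OF Zbsub[OF that] LD(7)[OF idx(1)[OF that]]] .
  have cZb: "card (Zb y) = b * m * lev (y div r)" if "y < N * r" for y
    using bZ2(4)[OF idx[OF that]] by (simp add: Zb_def)
  have neq: "y div r \<noteq> z div r \<or> y mod r \<noteq> z mod r" if "y \<noteq> z" for y z
    using that by (metis div_mult_mod_eq)
  have dA': "A' y \<inter> A' z = {}" if "y < N * r" "z < N * r" "y \<noteq> z" for y z
  proof (cases "y div r = z div r")
    case True
    then show ?thesis using neq[OF that(3)] idx(2)[OF that(1)] idx(2)[OF that(2)]
        disjoint_family_onD[OF bA2(2)[OF idx(1)[OF that(1)]], of "y mod r" "z mod r"]
      by (simp add: A'_def)
  next
    case False
    then have "A (y div r) \<inter> A (z div r) = {}"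
      using disjoint_family_onD[OF LA, of "y div r" "z div r"] idx(1) that by simp
    then show ?thesis using A'sub[OF that(1)] A'sub[OF that(2)] by blast
  qed
  have dZb: "Zb y \<inter> Zb z = {}" if "y < N * r" "z < N * r" "y \<noteq> z" for y z
  proof (cases "y div r = z div r")
    case True
    then show ?thesis using neq[OF that(3)] idx(2)[OF that(1)] idx(2)[OF that(2)]
        disjoint_family_onD[OF bZ2(2)[OF idx(1)[OF that(1)]], of "y mod r" "z mod r"]
      by (simp add: Zb_def)
  next
    case False
    then have "Z (y div r) \<inter> Z (z div r) = {}"
      using disjoint_family_onD[OF LZ, of "y div r" "z div r"] idx(1) that by simp
    then show ?thesis using Zbsub[OF that(1)] Zbsub[OF that(2)] by blast
  qed
  have QZb: "Q k \<subseteq> Zb (dn k)" if "k < t" "\<tau> k = Some x" for k x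
    using bZ(2)[OF that] dnD[OF that] by (simp add: Zb_def)
  have QZb0: "Q k \<inter> Zb y = {}" if k: "k < t" and y: "y < N * r" and "\<tau> k = None \<or> y \<noteq> dn k" for k y
  proof (cases "\<tau> k")
    case None
    then show ?thesis using mvD(8)[OF k] Zbsub[OF y] idx(1)[OF y] by blast
  next
    case (Some x)
    then have "Zb (dn k) \<inter> Zb y = {}" using that dnD(1)[OF k Some] by (intro dZb) auto
    then show ?thesis using QZb[OF k Some] by blast
  qed

  have lay: "layered m (N * r) A' Z' lev'"
    unfolding layered_def
  proof (intro conjI allI impI)
    fix y assume y: "y < N * r"
    show "\<exists>K\<in>KK. A' y \<subseteq> K" using LD(1)[OF idx(1)[OF y]] A'sub[OF y] by blast
    show "card (A' y) = a * m" using bA2(4)[OF idx[OF y]] by (simp add: A'_def)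
    show "Z' y \<subseteq> B" using Zbsub[OF y] LD(3)[OF idx(1)[OF y]] mvD(6) by (auto simp: Z'_def)
    show "lev' y \<le> H" using LD(5)[OF idx(1)[OF y]] Y1(2)[of y] \<theta> by (auto simp: lev'_def)
    show "card (Z' y) = b * m * lev' y"
    proof (cases "y \<in> Y1")
      case True
      then obtain k where k: "k < t" "y = rc k" by (auto simp: Y1_def)
      have "{l. l < t \<and> rc l = y} = {k}" using k inj_onD[OF inj_rc, of _ k] by auto
      \<comment> \<open>A receiving part has level below \<open>\<theta>\<close> and a losing part
        has level above \<open>\<theta>\<close>, so no part does both.\<close>
      moreover have disj: "Q l \<inter> Zb y = {}" if l: "l < t" for l
      proof (cases "\<tau> l")
        case None
        then show ?thesis using QZb0[OF l y] by simp
      next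
        case (Some x)
        then have "y \<noteq> dn l" using Y1(2)[OF True] mvS(2)[OF l Some] dnD(2)[OF l Some] by auto
        then show ?thesis using QZb0[OF l y] by simp
      qed
      ultimately have "Z' y = Zb y \<union> Q k" unfolding Z'_def by auto
      moreover have "card (Zb y \<union> Q k) = card (Zb y) + card (Q k)"
        using disj[OF k(1)] fZb[OF y] fQ[OF k(1)] by (intro card_Un_disjoint) auto
      ultimately show ?thesis using True cZb[OF y] mvD(5)[OF k(1)] by (simp add: lev'_def)
    next
      case n1: False
      then have e: "{l. l < t \<and> rc l = y} = {}" by (auto simp: Y1_def)
      show ?thesis
      proof (cases "y \<in> Y2")
        case True
        then obtain k x where k: "k < t" "\<tau> k = Some x" "y = dn k" by (auto simp: Y2_def)
        have "Q l \<inter> Zb y = {}" if l: "l < t" "l \<noteq> k" for l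
          using QZb0[OF l(1) y] inj_dn[of l k] l k by fastforce
        then have "Zb y \<inter> (\<Union>l<t. Q l) = Q k" using QZb[OF k(1,2)] k by auto
        then have "Z' y = Zb y - Q k" using e unfolding Z'_def by blast
        moreover have "card (Zb y - Q k) = card (Zb y) - card (Q k)"
          using QZb[OF k(1,2)] k fQ by (intro card_Diff_subset) auto
        ultimately show ?thesis
          using n1 True cZb[OF y] mvD(5)[OF k(1)] by (simp add: lev'_def diff_mult_distrib2)
      next
        case False
        have "Q l \<inter> Zb y = {}" if l: "l < t" for l
        proof (rule QZb0[OF l y])
          show "\<tau> l = None \<or> y \<noteq> dn l" using False l unfolding Y2_def by blast
        qed
        then have "Z' y = Zb y" using e unfolding Z'_def by blast
        then show ?thesis using n1 False cZb[OF y] by (simp add: lev'_def)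
      qed
    qed
    show "\<forall>u\<in>A' y. \<forall>w\<in>Z' y. E u w"
    proof (intro ballI)
      fix u w assume u: "u \<in> A' y" and w: "w \<in> Z' y"
      then consider "w \<in> Zb y" | k where "k < t" "rc k = y" "w \<in> Q k" by (auto simp: Z'_def)
      then show "E u w"
      proof cases
        case 1
        then show ?thesis using LD(6)[OF idx(1)[OF y]] A'sub[OF y] Zbsub[OF y] u by blast
      next
        case 2
        then show ?thesis using PA'[of k] mvD(7)[of k] u by blast
      qed
    qed
  next
    show "disjoint_family_on A' {..<N * r}" using dA' by (auto simp: disjoint_family_on_def)
    show "disjoint_family_on Z' {..<N * r}"
      unfolding disjoint_family_on_def
    proof (intro ballI impI)
      fix y z assume yz: "y \<in> {..<N * r}" "z \<in> {..<N * r}" "y \<noteq> z"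
      have "Q k \<inter> Q l = {}" if "k < t" "rc k = y" "l < t" "rc l = z" for k l
        using disjoint_family_onD[OF dQ, of k l] that yz by auto
      then have "(\<Union>k\<in>{k. k < t \<and> rc k = y}. Q k) \<inter> (\<Union>k\<in>{k. k < t \<and> rc k = z}. Q k) = {}"
        by blast
      moreover have "Zb y \<inter> Zb z = {}" using dZb yz by simp
      ultimately show "Z' y \<inter> Z' z = {}" unfolding Z'_def by blast
    qed
    show "(\<Union>y<N * r. A' y) = \<Union>KK"
    proof
      show "(\<Union>y<N * r. A' y) \<subseteq> \<Union>KK"
        unfolding LU[symmetric] using A'sub idx(1) by blast
      show "\<Union>KK \<subseteq> (\<Union>y<N * r. A' y)"
      proof
        fix v assume "v \<in> \<Union>KK"
        then obtain x where x: "x < N" "v \<in> A x" unfolding LU[symmetric] by blast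
        then obtain j where j: "j < r" "v \<in> bA x j" using bA2(3)[OF x(1)] by blast
        then have "v \<in> A' (x * r + j)" using comb[OF x(1) j(1)] by (simp add: A'_def)
        then show "v \<in> (\<Union>y<N * r. A' y)" using comb(1)[OF x(1) j(1)] by blast
      qed
    qed
  qed

  define \<psi> where "\<psi> l = real l * (2 * real H - real l)" for l :: nat
  \<comment> \<open>\<open>c1\<close> is the least increase of \<open>\<psi>\<close> when a level
    below \<open>\<theta>\<close> rises by one, and \<open>c2\<close> the greatest decrease when a
    level above \<open>\<theta>\<close> drops by one. The difference 2 is the net gain per move, up
    to the factor \<open>m\<close>; since \<open>\<theta> < H\<close>, \<open>c2\<close> is positive
    and moves of unassigned vertices gain even more.\<close>
  define c1 where "c1 = 2 * real H - 2 * real \<theta> + 1"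
  define c2 where "c2 = 2 * real H - 2 * real \<theta> - 1"
  have pt: "\<psi> (lev (y div r)) + (if y \<in> Y1 then c1 else 0) - (if y \<in> Y2 then c2 else 0) \<le> \<psi> (lev' y)" for y
  proof -
    consider "y \<in> Y1" | "y \<notin> Y1" "y \<in> Y2" | "y \<notin> Y1" "y \<notin> Y2" by blast
    then show ?thesis
    proof cases
      case 1
      then have "y \<notin> Y2" "real (lev (y div r)) + 1 \<le> \<theta>" using Y1(2)[of y] Y2(2)[of y] by auto
      then show ?thesis using 1 by (simp add: \<psi>_def c1_def lev'_def algebra_simps)
    next
      case 2
      then have g: "real \<theta> + 1 \<le> lev (y div r)" using Y2(2)[of y] by auto
      then have "real (lev (y div r) - 1) = real (lev (y div r)) - 1" by (simp add: of_nat_diff)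
      then show ?thesis using 2 g by (simp add: \<psi>_def c2_def lev'_def algebra_simps)
    next
      case 3
      then show ?thesis by (simp add: lev'_def)
    qed
  qed
  have cY1: "card Y1 = t" unfolding Y1_def using inj_rc by (simp add: card_image)
  have "card {k. k < t \<and> \<tau> k \<noteq> None} \<le> card {..<t}" by (intro card_mono) auto
  then have cY2: "card Y2 \<le> t" unfolding Y2_def
    using card_image_le[of "{k. k < t \<and> \<tau> k \<noteq> None}" dn] by simp
  have "2 * real t \<le> c1 * card Y1 - c2 * card Y2"
  proof -
    have "c2 * card Y2 \<le> c2 * t" using cY2 \<theta> by (intro mult_left_mono) (auto simp: c2_def)
    then show ?thesis by (simp add: cY1 c1_def c2_def algebra_simps)
  qed
  also have "c1 * card Y1 = (\<Sum>y<N * r. if y \<in> Y1 then c1 else 0)"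
  proof -
    have "{..<N * r} \<inter> Y1 = Y1" using Y1(1) by auto
    then show ?thesis by (simp add: sum.If_cases)
  qed
  also have "c2 * card Y2 = (\<Sum>y<N * r. if y \<in> Y2 then c2 else 0)"
  proof -
    have "{..<N * r} \<inter> Y2 = Y2" using Y2(1) by auto
    then show ?thesis by (simp add: sum.If_cases)
  qed
  finally have "(\<Sum>y<N * r. \<psi> (lev (y div r))) + 2 * real t
      \<le> (\<Sum>y<N * r. \<psi> (lev (y div r)) + (if y \<in> Y1 then c1 else 0) - (if y \<in> Y2 then c2 else 0))"
    by (simp add: sum.distrib sum_subtractf)
  also have "\<dots> \<le> (\<Sum>y<N * r. \<psi> (lev' y))" by (intro sum_mono pt)
  also have "(\<Sum>y<N * r. \<psi> (lev (y div r))) = (\<Sum>x<N. \<Sum>y\<in>{x * r..<x * r + r}. \<psi> (lev (y div r)))"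
    by (rule sum.nat_group[symmetric])
  also have "\<dots> = (\<Sum>x<N. \<Sum>y\<in>{x * r..<x * r + r}. \<psi> (lev x))"
  proof (intro sum.cong refl)
    fix x y assume "y \<in> {x * r..<x * r + r}"
    then have "y div r = x" by (intro div_nat_eqI) (auto simp: mult.commute)
    then show "\<psi> (lev (y div r)) = \<psi> (lev x)" by simp
  qed
  also have "\<dots> = r * (\<Sum>x<N. \<psi> (lev x))" by (simp add: sum_distrib_left)
  finally have "m * (r * (\<Sum>x<N. \<psi> (lev x)) + 2 * real t) \<le> m * (\<Sum>y<N * r. \<psi> (lev' y))"
    by (rule mult_left_mono) simp
  then have "weight (r * m) N lev + 2 * real m * t \<le> weight m (N * r) lev'"
    by (simp add: weight_def \<psi>_def algebra_simps)
  then show ?thesis using lay by blast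
qed

lemma moves_exist:
  fixes e e' :: real
  assumes L: "layered (r * m) N A Z lev" and m: "0 < m" and r: "0 < r" and e: "0 < e"
    and big: "e * T \<le> card (improvable e \<theta> N A Z lev)"
    and n0: "4 * real (a * m) \<le> n0 * e" "2 * C * n0 < e * (a * (r * m))"
    and e': "e' = e / 2 / 2 ^ (n0 + 1)" "2 \<le> r * e'" and T': "2 * real (b * m) \<le> e' * T"
    and t: "real t * (m * (a + b + b * H)) \<le> e * T / 2"
  shows "\<exists>P Q \<sigma> \<tau>. moves \<theta> m r N A Z lev t P Q \<sigma> \<tau>"
  using t
proof (induction t)
  case 0
  show ?case by (auto simp: moves_def disjoint_family_on_def)
next
  case (Suc t)
  have "real t * (m * (a + b + b * H)) \<le> real (Suc t) * (m * (a + b + b * H))"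
    by (intro mult_right_mono) simp_all
  then have t: "real t * (m * (a + b + b * H)) \<le> e * T / 2" using Suc.prems by linarith
  then obtain P Q \<sigma> \<tau> where "moves \<theta> m r N A Z lev t P Q \<sigma> \<tau>" using Suc.IH by blast
  then show ?case using moves_step[OF L m r e big n0 e' T' t] by blast
qed

text \<open>As many moves are made as the bound in \<open>moves_exist\<close> permits, about
  \<open>e * T / (2 * m * (a + b + b * H))\<close>, and each adds \<open>2 * m\<close> to the
  weight. The assumption \<open>T''\<close> lets half of the total gain absorb the rounding.\<close>

lemma weight_increase:
  fixes e e' :: real
  assumes L: "layered (r * m) N A Z lev" and m: "0 < m" and r: "0 < r" and e: "0 < e"
    and \<theta>: "\<theta> < H" and big: "e * T \<le> card (improvable e \<theta> N A Z lev)"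
    and n0: "4 * real (a * m) \<le> n0 * e" "2 * C * n0 < e * (a * (r * m))"
    and e': "e' = e / 2 / 2 ^ (n0 + 1)" "2 \<le> r * e'" and T': "2 * real (b * m) \<le> e' * T"
    and T'': "4 * real (m * (a + b + b * H)) \<le> e * T"
  shows "\<exists>N' A' Z' lev'. layered m N' A' Z' lev' \<and>
    weight (r * m) N lev + e / (2 * (a + b + b * H)) * T \<le> weight m N' lev'"
proof -
  define s where "s = real (a + b + b * H)"
  have s: "0 < s" using a_pos by (simp add: s_def add_pos_nonneg)
  have m': "0 < real m" using m by simp
  define t where "t = nat \<lfloor>e * T / 2 / (m * s)\<rfloor>"
  have nn: "0 \<le> e * T / 2 / (m * s)" using e T_pos s by simp
  then have t1: "real t \<le> e * T / 2 / (m * s)" by (simp add: t_def)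
  have t2: "e * T / 2 / (m * s) - 1 \<le> t" using nn by (simp add: t_def)
  have "real t * (m * (a + b + b * H)) = real t * (m * s)" by (simp add: s_def)
  also have "\<dots> \<le> e * T / 2" using t1 s m' by (simp add: pos_le_divide_eq)
  finally obtain P Q \<sigma> \<tau> where mv: "moves \<theta> m r N A Z lev t P Q \<sigma> \<tau>"
    using moves_exist[OF L m r e big n0 e' T'] by blast
  obtain N' A' Z' lev' where *: "layered m N' A' Z' lev'"
    "weight (r * m) N lev + 2 * real m * t \<le> weight m N' lev'"
    using apply_moves[OF L m r \<theta> mv] by blast
  define w where "w = e * T / s"
  have "w - 2 * real m = 2 * real m * (e * T / 2 / (m * s) - 1)"
    using m' s by (simp add: w_def field_simps)
  also have "\<dots> \<le> 2 * real m * t" using t2 by (intro mult_left_mono) simp_all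
  finally have "w - 2 * real m \<le> 2 * real m * t" .
  moreover have "2 * real m \<le> w / 2"
  proof -
    have "4 * (m * s) \<le> e * T" using T'' by (simp add: s_def)
    then show ?thesis using s by (simp add: w_def field_simps)
  qed
  ultimately have "w / 2 \<le> 2 * real m * t" by linarith
  moreover have "e / (2 * (a + b + b * H)) * T = w / 2" unfolding w_def s_def by simp
  ultimately show ?thesis using * by (intro exI[of _ N'] exI[of _ A'] exI[of _ Z'] exI[of _ lev']) linarith
qed

section \<open>Refining until no threshold admits many improvable vertices\<close>

lemma weight_nonneg:
  assumes "layered m N A Z lev"
  shows "0 \<le> weight m N lev"
  unfolding weight_def using layeredD(5)[OF assms]
  by (intro mult_nonneg_nonneg sum_nonneg) fastforce+

text \<open>The divisibility by \<open>n\<close>, later \<open>|V(F)|\<close>, ensures that the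
  vertices of a block left over by its load can be tiled exactly by copies of F.\<close>

definition stable :: "real \<Rightarrow> nat \<Rightarrow> bool" where
  "stable e n \<longleftrightarrow> (\<exists>m N A Z lev. 0 < m \<and> n dvd m \<and> layered m N A Z lev \<and>
     (\<forall>\<theta><H. card (improvable e \<theta> N A Z lev) < e * T))"

end

text \<open>Each refinement to a much smaller scale that is not stable increases the weight by a fixed
  proportion of \<open>T\<close>, which can happen only a bounded number of times.\<close>

lemma layered_stable:
  fixes C e :: real and a b H n :: nat
  assumes a: "0 < a" and b: "0 < b" and n: "0 < n" and e: "0 < e"
  shows "\<exists>M>0. \<exists>T0. \<forall>T\<ge>T0. \<forall>(E :: 'v \<Rightarrow> 'w \<Rightarrow> bool) KK B N A Z lev.
    bipartite_cells KK B a b C T \<longrightarrow> bipartite_cells.layered E KK B a b H (M * n) N A Z lev \<longrightarrow>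
    bipartite_cells.stable E KK B a b H T e n"
proof -
  define d where "d = e / (2 * (a + b + b * H))"
  have d: "0 < d" using e a by (simp add: d_def add_pos_nonneg)
  \<comment> \<open>Starting at scale \<open>M * n\<close>, either a stable assignment is met on the
    way or \<open>j\<close> rounds of improvement end at scale \<open>n\<close> with a total gain of
    \<open>j * d * T\<close>.\<close>
  define Q where "Q M T0 j \<longleftrightarrow> (\<forall>T\<ge>T0. \<forall>(E :: 'v \<Rightarrow> 'w \<Rightarrow> bool) KK B N A Z lev.
    bipartite_cells KK B a b C T \<longrightarrow> bipartite_cells.layered E KK B a b H (M * n) N A Z lev \<longrightarrow>
    bipartite_cells.stable E KK B a b H T e n \<or>
    (\<exists>N' A' Z' lev'. bipartite_cells.layered E KK B a b H n N' A' Z' lev' \<and>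
      bipartite_cells.weight H (M * n) N lev + real j * (d * T) \<le> bipartite_cells.weight H n N' lev'))"
    for M T0 j
  have steps: "\<exists>M>0. \<exists>T0. Q M T0 j" for j
  proof (induction j)
    case 0
    have "Q 1 0 0" unfolding Q_def by auto
    then show ?case by (metis zero_less_one)
  next
    case (Suc j)
    then obtain M T0 where M: "0 < M" and IH: "Q M T0 j" by blast
    define m where "m = M * n"
    have m: "0 < m" using M n by (simp add: m_def)
    \<comment> \<open>The constants are fixed in the order of dependence: \<open>n0\<close> is large
      enough to find \<open>a * m\<close> common vertices, \<open>e'\<close> is the resulting
      density of common neighbours, and \<open>r\<close> makes the coarse blocks large compared with
      \<open>n0\<close> and with \<open>1 / e'\<close>.\<close>
    define n0 where "n0 = nat \<lceil>4 * real (a * m) / e\<rceil>"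
    have n0: "4 * real (a * m) \<le> n0 * e"
    proof -
      have "4 * real (a * m) / e \<le> n0" unfolding n0_def by linarith
      then show ?thesis using e by (simp add: field_simps)
    qed
    define e' where "e' = e / 2 / 2 ^ (n0 + 1)"
    have e': "0 < e'" using e by (simp add: e'_def)
    define r where "r = nat \<lceil>2 / e'\<rceil> + nat \<lceil>2 * C * n0 / (e * (a * m))\<rceil> + 1"
    have r: "0 < r" by (simp add: r_def)
    have r1: "2 \<le> r * e'"
    proof -
      have "2 / e' \<le> r" unfolding r_def by linarith
      then show ?thesis using e' by (simp add: field_simps)
    qed
    have r2: "2 * C * n0 < e * (a * (r * m))"
    proof -
      have "2 * C * n0 / (e * (a * m)) < r" unfolding r_def by linarith
      then have "2 * C * n0 < r * (e * (a * m))" using e a m by (simp add: pos_divide_less_eq)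
      then show ?thesis by (simp add: algebra_simps)
    qed
    define T1 where "T1 = max T0 (max (2 * real (b * m) / e') (4 * real (m * (a + b + b * H)) / e))"
    have "Q (r * M) T1 (Suc j)"
      unfolding Q_def
    proof (intro allI impI)
      fix T and E :: "'v \<Rightarrow> 'w \<Rightarrow> bool" and KK B N A Z lev
      assume T: "T1 \<le> T" and loc: "bipartite_cells KK B a b C T"
        and L: "bipartite_cells.layered E KK B a b H (r * M * n) N A Z lev"
      interpret bipartite_cells E KK B a b H C T by (rule loc)
      have T': "2 * real (b * m) \<le> e' * T" "4 * real (m * (a + b + b * H)) \<le> e * T" "T0 \<le> T"
      proof -
        have "2 * real (b * m) / e' \<le> T" "4 * real (m * (a + b + b * H)) / e \<le> T"
          using T unfolding T1_def by simp_all
        then show "2 * real (b * m) \<le> e' * T" "4 * real (m * (a + b + b * H)) \<le> e * T"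
          using e e' by (simp_all only: pos_divide_le_eq mult.commute)
        show "T0 \<le> T" using T unfolding T1_def by simp
      qed
      have L': "layered (r * m) N A Z lev" using L by (simp only: m_def mult.assoc)
      show "stable e n \<or> (\<exists>N' A' Z' lev'. layered n N' A' Z' lev' \<and>
          weight (r * M * n) N lev + real (Suc j) * (d * T) \<le> weight n N' lev')"
      proof (cases "\<forall>\<theta><H. card (improvable e \<theta> N A Z lev) < e * T")
        case True
        moreover have "0 < r * m" "n dvd r * m" using r m by (simp_all add: m_def)
        ultimately have "stable e n" unfolding stable_def using L' by blast
        then show ?thesis ..
      next
        case False
        then obtain \<theta> where \<theta>: "\<theta> < H" "e * T \<le> card (improvable e \<theta> N A Z lev)"
          by (auto simp: not_less)
        obtain N1 A1 Z1 lev1 where 1: "layered m N1 A1 Z1 lev1"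
          "weight (r * m) N lev + d * T \<le> weight m N1 lev1"
          using weight_increase[OF L' m r e \<theta> n0 r2 e'_def r1 T'(1,2)] unfolding d_def by blast
        have "stable e n \<or> (\<exists>N' A' Z' lev'. layered n N' A' Z' lev' \<and>
            weight m N1 lev1 + real j * (d * T) \<le> weight n N' lev')"
          using IH T'(3) loc 1(1) unfolding Q_def m_def by blast
        then show ?thesis
        proof
          assume "\<exists>N' A' Z' lev'. layered n N' A' Z' lev' \<and>
            weight m N1 lev1 + real j * (d * T) \<le> weight n N' lev'"
          then obtain N' A' Z' lev' where 2: "layered n N' A' Z' lev'"
            "weight m N1 lev1 + real j * (d * T) \<le> weight n N' lev'" by blast
          have "weight (r * m) N lev + real (Suc j) * (d * T) \<le> weight n N' lev'"
            using 1(2) 2(2) by (simp add: distrib_right)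
          then have "weight (r * M * n) N lev + real (Suc j) * (d * T) \<le> weight n N' lev'"
            by (simp only: m_def mult.assoc)
          then show ?thesis using 2(1) by blast
        qed blast
      qed
    qed
    moreover have "0 < r * M" using r M by simp
    ultimately show ?case by blast
  qed
  \<comment> \<open>With this many rounds the gain exceeds the upper bound
    \<open>H\<^sup>2 * C * T\<close> on the weight.\<close>
  define j where "j = nat \<lceil>H\<^sup>2 * C / d\<rceil> + 1"
  have j: "H\<^sup>2 * C < j * d"
  proof -
    have "H\<^sup>2 * C / d < j" unfolding j_def by linarith
    then show ?thesis using d by (simp add: field_simps)
  qed
  obtain M T0 where M: "0 < M" and *: "Q M T0 j" using steps by blast
  show ?thesis
  proof (intro exI[of _ M] exI[of _ T0] conjI allI impI M)
    fix T and E :: "'v \<Rightarrow> 'w \<Rightarrow> bool" and KK B N A Z lev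
    assume T: "T0 \<le> T" and loc: "bipartite_cells KK B a b C T"
      and L: "bipartite_cells.layered E KK B a b H (M * n) N A Z lev"
    interpret bipartite_cells E KK B a b H C T by (rule loc)
    have "stable e n \<or> (\<exists>N' A' Z' lev'. layered n N' A' Z' lev' \<and>
        weight (M * n) N lev + real j * (d * T) \<le> weight n N' lev')"
      using * T loc L unfolding Q_def by blast
    then show "stable e n"
    proof
      assume "\<exists>N' A' Z' lev'. layered n N' A' Z' lev' \<and>
        weight (M * n) N lev + real j * (d * T) \<le> weight n N' lev'"
      then obtain N' A' Z' lev' where 2: "layered n N' A' Z' lev'"
        "weight (M * n) N lev + real j * (d * T) \<le> weight n N' lev'" by blast
      have "j * (d * T) \<le> H\<^sup>2 * (C * T)"
        using 2(2) weight_nonneg[OF L] weight_le[OF 2(1) n] by linarith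
      then have "(j * d) * T \<le> (H\<^sup>2 * C) * T" by (simp add: mult.assoc)
      then have False using j T_pos by (simp add: mult_le_cancel_right)
      then show ?thesis ..
    qed
  qed
qed

section \<open>A violated Hall condition from a load threshold\<close>

context bipartite_cells
begin

text \<open>Pigeonhole over the \<open>k\<close> levels just below \<open>H\<close>. Blocks of level
  exactly \<open>\<theta>\<close> will be counted in the neighbourhood but their vertices are not
  sources, so a threshold with few such blocks is wanted.\<close>

lemma exists_sparse_level:
  assumes "k \<le> H" "0 < k"
  shows "\<exists>\<theta>. H - k \<le> \<theta> \<and> \<theta> < H \<and> k * card {x. x < N \<and> lev x = \<theta>} \<le> N"
proof (rule ccontr)
  assume "\<not> ?thesis"
  then have gt: "N < k * card {x. x < N \<and> lev x = \<theta>}" if "\<theta> \<in> {H - k..<H}" for \<theta>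
    using that by (metis atLeastLessThan_iff not_le)
  have "k * N = (\<Sum>\<theta>\<in>{H - k..<H}. N)" using assms by simp
  also have "\<dots> < (\<Sum>\<theta>\<in>{H - k..<H}. k * card {x. x < N \<and> lev x = \<theta>})"
    using gt assms by (intro sum_strict_mono) auto
  also have "\<dots> = k * (\<Sum>\<theta>\<in>{H - k..<H}. card {x. x < N \<and> lev x = \<theta>})"
    by (simp add: sum_distrib_left)
  also have "(\<Sum>\<theta>\<in>{H - k..<H}. card {x. x < N \<and> lev x = \<theta>}) =
      card (\<Union>\<theta>\<in>{H - k..<H}. {x. x < N \<and> lev x = \<theta>})"
    by (intro card_UN_disjoint[symmetric]) auto
  also have "k * \<dots> \<le> k * card {..<N}" by (intro mult_left_mono card_mono) auto
  finally show False by simp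
qed

text \<open>The sources contain the unassigned vertices and everything assigned to blocks above
  \<open>\<theta>\<close>, whose load is at least \<open>1 - k / H\<close>. Since
  \<open>H = k * k\<close>, the missing load costs a proportion \<open>1 / k\<close>, and the blocks
  of level exactly \<open>\<theta>\<close> are a proportion of at most \<open>1 / k\<close>; these
  two losses make up the error term.\<close>

lemma threshold_deficiency:
  assumes L: "layered m N A Z lev" and m: "0 < m"
    and a: "a = p * H" and H: "H = k * k" and k: "0 < k" and p: "0 < p"
  shows "\<exists>\<theta><H. real (card (B - (\<Union>x<N. Z x))) \<le> card (sources \<theta> N Z lev)
    - real b / real p * card (\<Union>x\<in>{x. x < N \<and> \<theta> \<le> lev x}. A x) + 2 * real b * C * T / (real p * real k)"
proof -
  note LD = layeredD[OF L] and fA = layeredD(8)[OF L _ m]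
  have "k \<le> H" using H k by simp
  then obtain \<theta> where \<theta>: "H - k \<le> \<theta>" "\<theta> < H" "k * card {x. x < N \<and> lev x = \<theta>} \<le> N"
    using exists_sparse_level[OF _ k] by blast
  define X0 where "X0 = {x. x < N \<and> lev x = \<theta>}"
  define X1 where "X1 = {x. x < N \<and> \<theta> < lev x}"
  define U where "U = B - (\<Union>x<N. Z x)"
  have fX: "finite X0" "finite X1" by (simp_all add: X0_def X1_def)
  have X: "{x. x < N \<and> \<theta> \<le> lev x} = X0 \<union> X1" by (auto simp: X0_def X1_def)
  have dA: "disjoint_family_on A {..<N}" and dZ: "disjoint_family_on Z {..<N}"
    using L by (simp_all add: layered_def)
  have "card (\<Union>x\<in>X0 \<union> X1. A x) = (\<Sum>x\<in>X0 \<union> X1. card (A x))"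
    using fX fA disjoint_family_onD[OF dA] by (intro card_UN_disjoint) (auto simp: X0_def X1_def)
  also have "\<dots> = (\<Sum>x\<in>X0 \<union> X1. a * m)" using LD(2) by (intro sum.cong) (auto simp: X0_def X1_def)
  also have "\<dots> = (card X0 + card X1) * (a * m)"
    using fX by (simp add: card_Un_disjoint X0_def X1_def disjoint_iff)
  finally have cA: "real (card (\<Union>x\<in>X0 \<union> X1. A x)) = (real (card X0) + card X1) * (p * H * m)"
    by (simp add: a)
  have "(\<Sum>x\<in>X1. b * m * (H - k)) \<le> (\<Sum>x\<in>X1. card (Z x))"
    using LD(4) \<theta>(1) by (intro sum_mono) (auto simp: X1_def)
  also have "\<dots> = card (\<Union>x\<in>X1. Z x)"
    using fX LD(7) disjoint_family_onD[OF dZ] by (intro card_UN_disjoint[symmetric]) (auto simp: X1_def)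
  finally have cZ: "card X1 * (b * m * (H - k)) \<le> card (\<Union>x\<in>X1. Z x)" by simp
  have "card U + card (\<Union>x\<in>X1. Z x) = card (U \<union> (\<Union>x\<in>X1. Z x))"
    using finite_B fX LD(7) by (intro card_Un_disjoint[symmetric]) (auto simp: U_def X1_def)
  also have "\<dots> \<le> card (sources \<theta> N Z lev)"
  proof (rule card_mono)
    show "finite (sources \<theta> N Z lev)" using finite_B by (simp add: sources_def)
    have "Z x \<inter> Z z = {}" if "x < N" "z < N" "lev x \<le> \<theta>" "\<theta> < lev z" for x z
    proof -
      have "x \<noteq> z" using that by auto
      then show ?thesis using disjoint_family_onD[OF dZ, of x z] that by simp
    qed
    then show "U \<union> (\<Union>x\<in>X1. Z x) \<subseteq> sources \<theta> N Z lev"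
      using LD(3) unfolding sources_def U_def X1_def by blast
  qed
  finally have "card U + card X1 * (b * m * (H - k)) \<le> card (sources \<theta> N Z lev)" using cZ by linarith
  then have "real (card U + card X1 * (b * m * (H - k))) \<le> card (sources \<theta> N Z lev)"
    unfolding of_nat_le_iff .
  moreover have "real (H - k) = real H - real k" using \<open>k \<le> H\<close> by (simp add: of_nat_diff)
  ultimately have cS: "card U + card X1 * (b * m * (real H - real k)) \<le> card (sources \<theta> N Z lev)"
    by simp
  define w where "w = real m * N"
  have wCT: "w \<le> C * T / (p * H)"
  proof -
    have "w * (p * H) \<le> C * T" using layered_count(2)[OF L m] by (simp add: w_def a algebra_simps)
    then show ?thesis using p H k by (simp add: field_simps)
  qed
  have "real (card X1) \<le> N"
  proof -
    have "card X1 \<le> card {..<N}" by (intro card_mono) (auto simp: X1_def)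
    then show ?thesis by simp
  qed
  then have 1: "real (b * m * k) * card X1 \<le> real (b * m * k) * N" by (intro mult_left_mono) simp_all
  have "real k * card X0 \<le> N" using \<theta>(3) unfolding X0_def by (metis of_nat_le_iff of_nat_mult)
  then have "real (b * m * k) * (real k * card X0) \<le> real (b * m * k) * N" by (intro mult_left_mono) simp_all
  then have 2: "real (b * m * H) * card X0 \<le> real (b * m * k) * N" by (simp add: H algebra_simps)
  have "real (b * m * k) * N = real (b * k) * w" by (simp add: w_def)
  also have "\<dots> \<le> real (b * k) * (C * T / (p * H))" using wCT by (intro mult_left_mono) simp_all
  also have "\<dots> = real b * C * T / (real p * real k)" using k p by (simp add: H field_simps)
  finally have 3: "real (b * m * k) * N \<le> real b * C * T / (real p * real k)" .
  have 4: "real b / real p * card (\<Union>x\<in>X0 \<union> X1. A x) = real (b * m * H) * card X0 + real (b * m * H) * card X1"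
    unfolding cA using p by (simp add: field_simps)
  have 5: "card X1 * (b * m * (real H - real k)) = real (b * m * H) * card X1 - real (b * m * k) * card X1"
    by (simp add: algebra_simps)
  have 6: "2 * real b * C * T / (real p * real k) = real b * C * T / (real p * real k) + real b * C * T / (real p * real k)" by (simp add: field_simps)
  have key: "u \<le> s - (x0 + x1) + (z + z)" if "u + (x1 - y1) \<le> s" "y1 \<le> n" "x0 \<le> n" "n \<le> z"
    for u s x0 x1 y1 n z :: real using that by linarith
  have "real (card U) \<le> card (sources \<theta> N Z lev) - real b / real p * card (\<Union>x\<in>X0 \<union> X1. A x)
      + 2 * real b * C * T / (real p * real k)"
    unfolding 4 6 by (rule key[OF cS[unfolded 5] 1 2 3])
  then show ?thesis using \<theta>(2) unfolding U_def X[symmetric] by blast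
qed

text \<open>\<open>(I, M)\<close> is an approximate violation of Hall's condition that accounts for the unassigned
  vertices.\<close>

lemma deficient_pair:
  assumes st: "stable e n" and a: "a = p * H" and H: "H = k * k" and k: "0 < k" and p: "0 < p"
  shows "\<exists>m N A Z lev I M. 0 < m \<and> n dvd m \<and> layered m N A Z lev \<and> I \<subseteq> B \<and> M \<subseteq> \<Union>KK \<and>
    real (card (B - (\<Union>x<N. Z x))) \<le> card I - real b / real p * card M + 2 * real b * C * T / (real p * real k) \<and>
    card {v \<in> \<Union>KK - M. e * T \<le> card {w \<in> I. E v w}} < e * T"
proof -
  obtain m N A Z lev where *: "0 < m" "n dvd m" and L: "layered m N A Z lev"
    and imp: "\<And>\<theta>. \<theta> < H \<Longrightarrow> card (improvable e \<theta> N A Z lev) < e * T"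
    using st unfolding stable_def by blast
  from threshold_deficiency[OF L *(1) a H k p]
  obtain \<theta> where \<theta>: "\<theta> < H" and def: "real (card (B - (\<Union>x<N. Z x))) \<le> card (sources \<theta> N Z lev)
    - real b / real p * card (\<Union>x\<in>{x. x < N \<and> \<theta> \<le> lev x}. A x) + 2 * real b * C * T / (real p * real k)"
    by (elim exE conjE)
  \<comment> \<open>A vertex outside \<open>M\<close> lies in a block of load below
    \<open>\<theta>\<close>, so having many neighbours among the sources makes it improvable, and
    stability bounds the number of such vertices.\<close>
  define M where "M = (\<Union>x\<in>{x. x < N \<and> \<theta> \<le> lev x}. A x)"
  have U: "(\<Union>x<N. A x) = \<Union>KK" using L by (simp add: layered_def)
  have "{v \<in> \<Union>KK - M. e * T \<le> card {w \<in> sources \<theta> N Z lev. E v w}} \<subseteq> improvable e \<theta> N A Z lev"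
  proof
    fix v assume v: "v \<in> {v \<in> \<Union>KK - M. e * T \<le> card {w \<in> sources \<theta> N Z lev. E v w}}"
    then obtain x where x: "x < N" "v \<in> A x" unfolding U[symmetric] by blast
    then have "lev x < \<theta>" using v by (cases "\<theta> \<le> lev x") (auto simp: M_def)
    then show "v \<in> improvable e \<theta> N A Z lev" using v x by (auto simp: improvable_def)
  qed
  moreover have "finite (improvable e \<theta> N A Z lev)"
  proof (rule finite_subset)
    show "improvable e \<theta> N A Z lev \<subseteq> (\<Union>x<N. A x)" by (auto simp: improvable_def)
    show "finite (\<Union>x<N. A x)" using layeredD(8)[OF L _ *(1)] by auto
  qed
  ultimately have "card {v \<in> \<Union>KK - M. e * T \<le> card {w \<in> sources \<theta> N Z lev. E v w}}
      \<le> card (improvable e \<theta> N A Z lev)" by (rule card_mono[rotated])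
  then have "card {v \<in> \<Union>KK - M. e * T \<le> card {w \<in> sources \<theta> N Z lev. E v w}} < e * T"
    using imp[OF \<theta>] by linarith
  moreover have "sources \<theta> N Z lev \<subseteq> B" by (auto simp: sources_def)
  moreover have "M \<subseteq> \<Union>KK" unfolding U[symmetric] M_def by blast
  ultimately show ?thesis using * L def unfolding M_def by blast
qed

end

section \<open>Monochromatic copies and tilings\<close>

definition mono_copy :: "'a ugraph \<Rightarrow> (nat set \<Rightarrow> colour) \<Rightarrow> colour \<Rightarrow> nat set \<Rightarrow> bool" where
  "mono_copy F c k W \<longleftrightarrow> W \<subseteq> {1..} \<and>
     (\<exists>\<phi>. bij_betw \<phi> (verts F) W \<and> (\<forall>e\<in>edges F. c (\<phi> ` e) = k))"

definition mono_tiling :: "'a ugraph \<Rightarrow> (nat set \<Rightarrow> colour) \<Rightarrow> colour \<Rightarrow> nat set set \<Rightarrow> bool" where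
  "mono_tiling F c k WW \<longleftrightarrow> finite WW \<and> disjoint WW \<and> (\<forall>W\<in>WW. mono_copy F c k W)"

definition mono_clique :: "(nat set \<Rightarrow> colour) \<Rightarrow> colour \<Rightarrow> nat set \<Rightarrow> bool" where
  "mono_clique c k A \<longleftrightarrow> (\<forall>u\<in>A. \<forall>v\<in>A. u \<noteq> v \<longrightarrow> c {u, v} = k)"

lemma mono_clique_subset: "mono_clique c k A \<Longrightarrow> A' \<subseteq> A \<Longrightarrow> mono_clique c k A'"
  by (auto simp: mono_clique_def)

text \<open>The independent set \<open>S\<close> goes to \<open>Q\<close> and the remaining vertices
  to \<open>P\<close>. No edge of F lies inside \<open>S\<close>, so the colours inside
  \<open>Q\<close> do not matter.\<close>

lemma mono_copy_split:
  assumes F: "simple_graph F" "finite (verts F)" and S: "S \<subseteq> verts F" "indep S (edges F)"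
    and P: "finite P" "card P = card (verts F) - card S" and Q: "finite Q" "card Q = card S"
    and PQ: "P \<inter> Q = {}" "P \<union> Q \<subseteq> {1..}"
    and c: "mono_clique c k P" "\<And>u v. u \<in> P \<Longrightarrow> v \<in> Q \<Longrightarrow> c {u, v} = k"
  shows "mono_copy F c k (P \<union> Q)"
proof -
  have fS: "finite S" using S(1) F(2) by (rule finite_subset)
  have "card (verts F - S) = card P" using P(2) S(1) fS by (simp add: card_Diff_subset)
  then obtain f where f: "bij_betw f (verts F - S) P"
    using finite_same_card_bij[of "verts F - S" P] F(2) P(1) by auto
  obtain g where g: "bij_betw g S Q" using finite_same_card_bij[OF fS Q(1)] Q(2) by auto
  define \<phi> where "\<phi> v = (if v \<in> S then g v else f v)" for v
  have "bij_betw \<phi> (verts F - S) P" using f by (rule bij_betw_cong[THEN iffD1, rotated]) (simp add: \<phi>_def)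
  moreover have "bij_betw \<phi> S Q" using g by (rule bij_betw_cong[THEN iffD1, rotated]) (simp add: \<phi>_def)
  ultimately have "bij_betw \<phi> ((verts F - S) \<union> S) (P \<union> Q)" using PQ(1) by (rule bij_betw_combine)
  moreover have "(verts F - S) \<union> S = verts F" using S(1) by blast
  ultimately have bij: "bij_betw \<phi> (verts F) (P \<union> Q)" by simp
  have inP: "\<phi> v \<in> P" if "v \<in> verts F" "v \<notin> S" for v
    using that bij_betwE[OF f] by (simp add: \<phi>_def)
  have inQ: "\<phi> v \<in> Q" if "v \<in> S" for v using that bij_betwE[OF g] by (simp add: \<phi>_def)
  have "c (\<phi> ` e) = k" if e: "e \<in> edges F" for e
  proof -
    have "e \<in> [verts F]\<^bsup>2\<^esup>" using e F(1) by (auto simp: simple_graph_def)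
    then obtain u v where uv: "e = {u, v}" "u \<in> verts F" "v \<in> verts F" "u \<noteq> v"
      by (auto elim: nsets2_E)
    then have ne: "\<phi> u \<noteq> \<phi> v" using bij by (auto simp: bij_betw_def dest: inj_onD)
    have nS: "\<not> (u \<in> S \<and> v \<in> S)" using S(2) e uv by (auto simp: indep_def)
    have im: "\<phi> ` e = {\<phi> u, \<phi> v}" using uv by auto
    show ?thesis
    proof (cases "u \<in> S")
      case True
      then have "c {\<phi> v, \<phi> u} = k" using nS c(2)[OF inP[of v] inQ[of u]] uv by blast
      then show ?thesis by (simp add: im insert_commute)
    next
      case u: False
      show ?thesis
      proof (cases "v \<in> S")
        case True
        then show ?thesis using u c(2)[OF inP[of u] inQ[of v]] uv by (simp add: im)
      next
        case False
        then show ?thesis using u c(1) inP[of u] inP[of v] uv ne by (auto simp: im mono_clique_def)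
      qed
    qed
  qed
  then show ?thesis using bij PQ(2) unfolding mono_copy_def by blast
qed

lemma mono_tiling_insert:
  assumes "mono_tiling F c k WW" "mono_copy F c k W" "W \<inter> \<Union>WW = {}"
  shows "mono_tiling F c k (insert W WW)"
  using assms unfolding mono_tiling_def disjoint_def by blast

lemma mono_tiling_Union:
  assumes "finite X" and "\<And>x. x \<in> X \<Longrightarrow> mono_tiling F c k (WW x)"
    and "\<And>x y. x \<in> X \<Longrightarrow> y \<in> X \<Longrightarrow> x \<noteq> y \<Longrightarrow> \<Union>(WW x) \<inter> \<Union>(WW y) = {}"
  shows "mono_tiling F c k (\<Union>x\<in>X. WW x)"
proof -
  have "finite (\<Union>x\<in>X. WW x)" using assms by (auto simp: mono_tiling_def)
  moreover have "disjoint (\<Union>x\<in>X. WW x)"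
    unfolding disjoint_def
  proof (intro ballI impI)
    fix V W assume V: "V \<in> (\<Union>x\<in>X. WW x)" and W: "W \<in> (\<Union>x\<in>X. WW x)" and ne: "V \<noteq> W"
    obtain x y where xy: "x \<in> X" "V \<in> WW x" "y \<in> X" "W \<in> WW y" using V W by blast
    show "V \<inter> W = {}"
    proof (cases "x = y")
      case True
      then show ?thesis using assms(2)[OF xy(1)] xy ne by (auto simp: mono_tiling_def disjoint_def)
    next
      case False
      then show ?thesis using assms(3)[OF xy(1,3)] xy by blast
    qed
  qed
  ultimately show ?thesis using assms(2) unfolding mono_tiling_def by blast
qed

lemma clique_tiling:
  assumes F: "simple_graph F" "finite (verts F)" and n: "card (verts F) = n"
    and A: "finite A" "card A = n * u" "A \<subseteq> {1..}" "mono_clique c k A"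
  shows "\<exists>WW. mono_tiling F c k WW \<and> \<Union>WW = A"
  using A
proof (induction u arbitrary: A)
  case 0
  then show ?case by (intro exI[of _ "{}"]) (auto simp: mono_tiling_def)
next
  case (Suc u)
  have "n \<le> card A" using Suc.prems(2) by simp
  then obtain P where P: "P \<subseteq> A" "card P = n" by (meson obtain_subset_with_card_n)
  have fP: "finite P" using P(1) Suc.prems(1) by (rule finite_subset)
  have "\<exists>WW. mono_tiling F c k WW \<and> \<Union>WW = A - P"
    using Suc.prems P fP mono_clique_subset[OF Suc.prems(4), of "A - P"]
    by (intro Suc.IH) (auto simp: card_Diff_subset)
  then obtain WW where WW: "mono_tiling F c k WW" "\<Union>WW = A - P" by (elim exE conjE)
  \<comment> \<open>The split with the empty independent set places the whole of F inside the
    clique.\<close>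
  have "mono_copy F c k (P \<union> {})"
  proof (rule mono_copy_split[OF F, of "{}"])
    show "P \<union> {} \<subseteq> {1..}" using P(1) Suc.prems(3) by blast
    show "mono_clique c k P" by (rule mono_clique_subset[OF Suc.prems(4) P(1)])
  qed (use P fP n in simp_all)
  moreover have "P \<inter> \<Union>WW = {}" unfolding WW(2) by blast
  ultimately have "mono_tiling F c k (insert P WW)" using WW(1) by (intro mono_tiling_insert) simp_all
  moreover have "\<Union>(insert P WW) = A" unfolding Union_insert WW(2) using P(1) by blast
  ultimately show ?case by (intro exI conjI)
qed

text \<open>Using \<open>p\<close> vertices of \<open>A\<close> and \<open>q\<close> of
  \<open>Z\<close> at a time exhausts \<open>Z\<close> after \<open>s\<close> copies; what remains
  of the clique \<open>A\<close> is a multiple of \<open>p + q\<close> and is tiled on its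
  own.\<close>

lemma block_tiling:
  assumes F: "simple_graph F" "finite (verts F)" and n: "card (verts F) = p + q"
    and S: "S \<subseteq> verts F" "indep S (edges F)" "card S = q"
    and A: "finite A" "card A = p * s + (p + q) * u" "A \<subseteq> {1..}" "mono_clique c k A"
    and Z: "finite Z" "card Z = q * s" "Z \<subseteq> {1..}" "A \<inter> Z = {}"
    and c: "\<And>u v. u \<in> A \<Longrightarrow> v \<in> Z \<Longrightarrow> c {u, v} = k"
  shows "\<exists>WW. mono_tiling F c k WW \<and> \<Union>WW = A \<union> Z"
  using A Z c
proof (induction s arbitrary: A Z)
  case 0
  then show ?case using clique_tiling[OF F n, of A u c k] by auto
next
  case (Suc s)
  have "p \<le> card A" "q \<le> card Z" using Suc.prems(2,6) by auto
  then obtain P Q where P: "P \<subseteq> A" "card P = p" and Q: "Q \<subseteq> Z" "card Q = q"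
    by (meson obtain_subset_with_card_n)
  have fP: "finite P" and fQ: "finite Q" using P(1) Q(1) Suc.prems(1,5) by (auto intro: finite_subset)
  have "\<exists>WW. mono_tiling F c k WW \<and> \<Union>WW = (A - P) \<union> (Z - Q)"
  proof (rule Suc.IH)
    show "card (A - P) = p * s + (p + q) * u" using P fP Suc.prems(2) by (simp add: card_Diff_subset)
    show "card (Z - Q) = q * s" using Q fQ Suc.prems(6) by (simp add: card_Diff_subset)
    show "mono_clique c k (A - P)" by (rule mono_clique_subset[OF Suc.prems(4)]) blast
    show "c {u, v} = k" if "u \<in> A - P" "v \<in> Z - Q" for u v using that Suc.prems(9) by blast
    show "finite (A - P)" "finite (Z - Q)" using Suc.prems(1,5) by simp_all
    show "A - P \<subseteq> {1..}" "Z - Q \<subseteq> {1..}" "(A - P) \<inter> (Z - Q) = {}"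
      using Suc.prems(3,7,8) by blast+
  qed
  then obtain WW where WW: "mono_tiling F c k WW" "\<Union>WW = (A - P) \<union> (Z - Q)"
    by (elim exE conjE)
  have "mono_copy F c k (P \<union> Q)"
  proof (rule mono_copy_split[OF F S(1,2)])
    show "mono_clique c k P" by (rule mono_clique_subset[OF Suc.prems(4) P(1)])
    show "c {u, v} = k" if "u \<in> P" "v \<in> Q" for u v using that Suc.prems(9) P(1) Q(1) by blast
    show "card P = card (verts F) - card S" "card Q = card S" using P Q n S(3) by simp_all
    show "P \<inter> Q = {}" "P \<union> Q \<subseteq> {1..}" using P(1) Q(1) Suc.prems(3,7,8) by blast+
  qed (fact fP fQ)+
  moreover have "(P \<union> Q) \<inter> \<Union>WW = {}" unfolding WW(2) using P(1) Q(1) Suc.prems(8) by blast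
  ultimately have "mono_tiling F c k (insert (P \<union> Q) WW)" using WW(1) by (intro mono_tiling_insert)
  moreover have "\<Union>(insert (P \<union> Q) WW) = A \<union> Z"
    unfolding Union_insert WW(2) using P(1) Q(1) by blast
  ultimately show ?case by (intro exI conjI)
qed

text \<open>A greedy partition: the family inside \<open>{1..T}\<close> is enlarged to a maximal one at each step, so what
  remains uncovered is bounded by a Ramsey number.\<close>

lemma mono_clique_partition:
  fixes c :: "nat set \<Rightarrow> colour"
  assumes s: "0 < s"
  shows "\<exists>QQ D. disjoint QQ \<and>
    (\<forall>Q\<in>QQ. Q \<subseteq> {1..} \<and> card Q = s \<and> (mono_clique c Red Q \<or> mono_clique c Blue Q)) \<and>
    (\<forall>T. card ({1..T} - \<Union>{Q \<in> QQ. Q \<subseteq> {1..T}}) \<le> D)"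
proof -
  obtain D where D: "\<And>(V :: nat set) E. finite V \<Longrightarrow> D \<le> card V \<Longrightarrow>
      \<exists>R\<subseteq>V. card R = s \<and> clique R E \<or> card R = s \<and> indep R E"
    using ramsey2[of s s] by blast
  define ok where "ok Q \<longleftrightarrow> card Q = s \<and> (mono_clique c Red Q \<or> mono_clique c Blue Q)" for Q
  have ram: "\<exists>R\<subseteq>V. ok R" if V: "finite V" "D \<le> card V" for V
  proof -
    obtain R where R: "R \<subseteq> V" "card R = s" "clique R {e. c e = Red} \<or> indep R {e. c e = Red}"
      using D[OF V, of "{e. c e = Red}"] by blast
    have "c {u, v} = Blue" if "c {u, v} \<noteq> Red" for u v using that by (cases "c {u, v}") auto
    then have "ok R" using R by (auto simp: ok_def mono_clique_def clique_def indep_def)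
    then show ?thesis using R by blast
  qed
  define fam where "fam T QQ \<longleftrightarrow> disjoint QQ \<and> (\<forall>Q\<in>QQ. Q \<subseteq> {1..T} \<and> ok Q) \<and>
    card ({1..T} - \<Union>QQ) \<le> D" for T :: nat and QQ
  have extend: "\<exists>QQ'. fam T QQ' \<and> QQ \<subseteq> QQ'" if Q0: "disjoint QQ" "\<forall>Q\<in>QQ. Q \<subseteq> {1..T} \<and> ok Q" for T QQ
  proof -
    define cand where "cand = {QQ'. QQ \<subseteq> QQ' \<and> disjoint QQ' \<and> (\<forall>Q\<in>QQ'. Q \<subseteq> {1..T} \<and> ok Q)}"
    have "finite cand" by (rule finite_subset[of _ "Pow (Pow {1..T})"]) (auto simp: cand_def)
    moreover have "QQ \<in> cand" using Q0 by (simp add: cand_def)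
    ultimately obtain QQ' where QQ': "QQ' \<in> cand" and mx: "\<And>R. R \<in> cand \<Longrightarrow> QQ' \<subseteq> R \<Longrightarrow> QQ' = R"
      using finite_has_maximal[of cand] by blast
    have "card ({1..T} - \<Union>QQ') \<le> D"
    proof (rule ccontr)
      assume "\<not> ?thesis"
      then obtain R where R: "R \<subseteq> {1..T} - \<Union>QQ'" "ok R" using ram[of "{1..T} - \<Union>QQ'"] by auto
      have QQ'D: "QQ \<subseteq> QQ'" "disjoint QQ'" "\<forall>Q\<in>QQ'. Q \<subseteq> {1..T} \<and> ok Q"
        using QQ' by (simp_all add: cand_def)
      have "R \<inter> Q = {}" if "Q \<in> QQ'" for Q using R(1) that by blast
      then have "disjoint (insert R QQ')" using QQ'D(2) unfolding disjoint_def by (simp add: Int_commute)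
      moreover have "R \<subseteq> {1..T}" using R(1) by blast
      ultimately have "insert R QQ' \<in> cand" using QQ'D R(2) by (auto simp: cand_def)
      then have "R \<in> QQ'" using mx by blast
      then have "R = {}" using R(1) by blast
      then show False using R(2) s by (simp add: ok_def)
    qed
    then have "fam T QQ'" using QQ' by (simp add: fam_def cand_def)
    then show ?thesis using QQ' by (auto simp: cand_def)
  qed
  have "\<exists>f. \<forall>T. fam T (f T) \<and> f T \<subseteq> f (Suc T)"
  proof (rule dependent_nat_choice[where P = fam and Q = "\<lambda>_ QQ QQ'. QQ \<subseteq> QQ'"])
    show "\<exists>QQ. fam 0 QQ" using extend[of "{}" 0] by auto
    fix QQ T assume "fam T QQ"
    then have "disjoint QQ" "\<forall>Q\<in>QQ. Q \<subseteq> {1..Suc T} \<and> ok Q" by (force simp: fam_def)+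
    then show "\<exists>QQ'. fam (Suc T) QQ' \<and> QQ \<subseteq> QQ'" by (rule extend)
  qed
  then obtain f where f: "\<And>T. fam T (f T)" "\<And>T. f T \<subseteq> f (Suc T)" by blast
  have mono: "f i \<subseteq> f j" if "i \<le> j" for i j using f(2) that by (rule lift_Suc_mono_le)
  define QQ where "QQ = (\<Union>T. f T)"
  have "disjoint QQ"
    unfolding disjoint_def
  proof (intro ballI impI)
    fix V W assume "V \<in> QQ" "W \<in> QQ" and ne: "V \<noteq> W"
    then obtain i j where ij: "V \<in> f i" "W \<in> f j" by (auto simp: QQ_def)
    then have "V \<in> f (max i j)" "W \<in> f (max i j)" using mono[of i "max i j"] mono[of j "max i j"] by auto
    then show "V \<inter> W = {}" using f(1)[of "max i j"] ne by (simp add: fam_def disjoint_def)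
  qed
  moreover have "Q \<subseteq> {1..} \<and> card Q = s \<and> (mono_clique c Red Q \<or> mono_clique c Blue Q)" if "Q \<in> QQ" for Q
  proof -
    obtain T where "Q \<in> f T" using \<open>Q \<in> QQ\<close> by (auto simp: QQ_def)
    then have "Q \<subseteq> {1..T}" "ok Q" using f(1)[of T] by (auto simp: fam_def)
    then show ?thesis unfolding ok_def by auto
  qed
  moreover have "card ({1..T} - \<Union>{Q \<in> QQ. Q \<subseteq> {1..T}}) \<le> D" for T
  proof -
    have "f T \<subseteq> {Q \<in> QQ. Q \<subseteq> {1..T}}" using f(1)[of T] by (auto simp: fam_def QQ_def)
    then have "card ({1..T} - \<Union>{Q \<in> QQ. Q \<subseteq> {1..T}}) \<le> card ({1..T} - \<Union>(f T))"
      by (intro card_mono) auto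
    also have "\<dots> \<le> D" using f(1)[of T] by (simp add: fam_def)
    finally show ?thesis .
  qed
  ultimately show ?thesis by (intro exI[of _ QQ] exI[of _ D]) simp
qed

section \<open>Assembling infinitely many copies\<close>

lemma mono_copy_card:
  assumes "mono_copy F c k W" "finite (verts F)"
  shows "finite W" "card W = card (verts F)"
proof -
  obtain \<phi> where \<phi>: "bij_betw \<phi> (verts F) W" using assms(1) unfolding mono_copy_def by blast
  show "finite W" using bij_betw_finite[OF \<phi>] assms(2) by simp
  show "card W = card (verts F)" using bij_betw_same_card[OF \<phi>] by simp
qed

text \<open>The copies of \<open>WW\<close> that avoid \<open>X\<close> are added to it. The others
  are disjoint and each meets the union of \<open>X\<close>, so their number is at most its
  size.\<close>

lemma mono_tiling_extend:
  assumes fin: "finite (verts F)" and X: "mono_tiling F c k X"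
    and WW: "mono_tiling F c k WW"
  shows "\<exists>X'. X \<subseteq> X' \<and> mono_tiling F c k X' \<and>
    real (card (\<Union>WW \<inter> {1..T})) \<le> card (\<Union>X' \<inter> {1..T}) + real (card (verts F) * card (\<Union>X))"
proof -
  define W1 where "W1 = {W \<in> WW. W \<inter> \<Union>X = {}}"
  define W2 where "W2 = WW - W1"
  have fW: "finite WW" and dW: "disjoint WW" and cW: "\<And>W. W \<in> WW \<Longrightarrow> mono_copy F c k W"
    using WW by (auto simp: mono_tiling_def)
  have fX: "finite X" and dX: "disjoint X" and cX: "\<And>W. W \<in> X \<Longrightarrow> mono_copy F c k W"
    using X by (auto simp: mono_tiling_def)
  have fUX: "finite (\<Union>X)" using fX mono_copy_card(1)[OF cX fin] by blast
  have f2: "finite W2" using fW by (simp add: W2_def)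
  have "card W2 = (\<Sum>W\<in>W2. 1)" by simp
  also have "\<dots> \<le> (\<Sum>W\<in>W2. card (W \<inter> \<Union>X))"
  proof (rule sum_mono)
    fix W assume "W \<in> W2"
    then have "W \<inter> \<Union>X \<noteq> {}" by (auto simp: W2_def W1_def)
    moreover have "finite (W \<inter> \<Union>X)" using fUX by blast
    ultimately show "1 \<le> card (W \<inter> \<Union>X)" by (simp add: Suc_le_eq card_gt_0_iff)
  qed
  also have "\<dots> = card (\<Union>W\<in>W2. W \<inter> \<Union>X)"
  proof (rule card_UN_disjoint[symmetric, OF f2])
    show "\<forall>W\<in>W2. finite (W \<inter> \<Union>X)" using fUX by blast
    show "\<forall>V\<in>W2. \<forall>W\<in>W2. V \<noteq> W \<longrightarrow> V \<inter> \<Union>X \<inter> (W \<inter> \<Union>X) = {}"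
      using dW unfolding W2_def disjoint_def by blast
  qed
  also have "\<dots> \<le> card (\<Union>X)" using fUX by (intro card_mono) auto
  finally have c2: "card W2 \<le> card (\<Union>X)" .
  have "card (\<Union>W2) \<le> (\<Sum>W\<in>W2. card W)" by (rule card_Union_le_sum_card)
  also have "\<dots> = (\<Sum>W\<in>W2. card (verts F))"
    using mono_copy_card(2)[OF cW fin] by (intro sum.cong) (auto simp: W2_def)
  also have "\<dots> \<le> card (verts F) * card (\<Union>X)" using c2 by simp
  finally have cU2: "card (\<Union>W2) \<le> card (verts F) * card (\<Union>X)" .
  define X' where "X' = X \<union> W1"
  have "disjoint X'"
    unfolding disjoint_def
  proof (intro ballI impI)
    fix V W assume VW: "V \<in> X'" "W \<in> X'" "V \<noteq> W"
    have x: "V \<inter> W = {}" if "V \<in> X" "W \<in> W1" for V W using that by (auto simp: W1_def)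
    have "V \<inter> W = {}" if "V \<in> X" "W \<in> X" using dX that VW(3) by (simp add: disjoint_def)
    moreover have "V \<inter> W = {}" if "V \<in> W1" "W \<in> W1" using dW that VW(3) by (simp add: disjoint_def W1_def)
    moreover have "V \<inter> W = {}" if "V \<in> W1" "W \<in> X" using x[OF that(2,1)] by (simp add: Int_commute)
    ultimately show "V \<inter> W = {}" using VW(1,2) x[of V W] unfolding X'_def by blast
  qed
  then have "mono_tiling F c k X'" using fX fW cX cW by (auto simp: mono_tiling_def X'_def W1_def)
  moreover have "card (\<Union>WW \<inter> {1..T}) \<le> card ((\<Union>X' \<inter> {1..T}) \<union> \<Union>W2)"
  proof (rule card_mono)
    show "finite ((\<Union>X' \<inter> {1..T}) \<union> \<Union>W2)"
      using f2 mono_copy_card(1)[OF cW fin] by (auto simp: W2_def)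
    show "\<Union>WW \<inter> {1..T} \<subseteq> (\<Union>X' \<inter> {1..T}) \<union> \<Union>W2" by (auto simp: X'_def W2_def)
  qed
  then have "card (\<Union>WW \<inter> {1..T}) \<le> card (\<Union>X' \<inter> {1..T}) + card (verts F) * card (\<Union>X)"
    using card_Un_le[of "\<Union>X' \<inter> {1..T}" "\<Union>W2"] cU2 by linarith
  then have "real (card (\<Union>WW \<inter> {1..T})) \<le> real (card (\<Union>X' \<inter> {1..T}) + card (verts F) * card (\<Union>X))"
    unfolding of_nat_le_iff .
  moreover have "X \<subseteq> X'" by (simp add: X'_def)
  ultimately show ?thesis by (intro exI[of _ X']) simp
qed

lemma upper_density_ge:
  assumes "\<And>i :: nat. \<exists>T>i. (l - 1 / (real i + 1)) * real T \<le> card (V \<inter> {1..T})"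
  shows "ereal l \<le> upper_density V"
proof (rule ccontr)
  assume "\<not> ?thesis"
  then have "upper_density V < ereal l" by simp
  then obtain r where r: "upper_density V < ereal r" "r < l"
    using ereal_dense2[of "upper_density V" "ereal l"] by auto
  have "eventually (\<lambda>t. ereal (real (card (V \<inter> {1..t})) / real t) < ereal r) sequentially"
    using r(1) unfolding upper_density_def by (rule Limsup_lessD)
  then obtain N where N: "\<And>t. t \<ge> N \<Longrightarrow> real (card (V \<inter> {1..t})) / real t < r"
    by (auto simp: eventually_sequentially)
  define i where "i = N + nat \<lceil>1 / (l - r)\<rceil>"
  have "1 / (l - r) < real i + 1" unfolding i_def by linarith
  then have i: "1 / (real i + 1) < l - r" using r(2) by (simp add: field_simps)
  obtain T where T: "T > i" "(l - 1 / (real i + 1)) * real T \<le> card (V \<inter> {1..T})" using assms by blast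
  have T0: "0 < real T" using T(1) by simp
  have "real (card (V \<inter> {1..T})) < r * T" using N[of T] T(1) T0 by (simp add: i_def pos_divide_less_eq)
  moreover have "r * T \<le> (l - 1 / (real i + 1)) * T" using i T0 by (intro mult_right_mono) auto
  ultimately show False using T(2) by linarith
qed

lemma omega_copies_of_copies:
  assumes F: "simple_graph F" and YY: "disjoint YY" "countable YY" "infinite YY"
    and copies: "\<And>W. W \<in> YY \<Longrightarrow> mono_copy F c k W"
  shows "\<exists>H'. subgraph H' K_nat \<and> monochromatic_graph c H' \<and> graph_iso (omega_copies F) H' \<and>
    verts H' = \<Union>YY"
proof -
  define w where "w = from_nat_into YY"
  have w: "bij_betw w UNIV YY" unfolding w_def using YY by (intro bij_betw_from_nat_into)
  have wY: "w i \<in> YY" for i using w by (auto simp: bij_betw_def)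
  have "\<forall>i. \<exists>\<phi>. bij_betw \<phi> (verts F) (w i) \<and> (\<forall>e\<in>edges F. c (\<phi> ` e) = k)"
    using copies[OF wY] unfolding mono_copy_def by blast
  from choice[OF this] obtain \<phi> where \<phi>: "\<And>i. bij_betw (\<phi> i) (verts F) (w i)"
    and col: "\<And>i e. e \<in> edges F \<Longrightarrow> c (\<phi> i ` e) = k" by blast
  define \<Phi> where "\<Phi> = (\<lambda>(v, i). \<phi> i v)"
  have inj: "inj_on \<Phi> (verts F \<times> UNIV)"
  proof (rule inj_onI)
    fix x y assume xy: "x \<in> verts F \<times> UNIV" "y \<in> verts F \<times> UNIV" "\<Phi> x = \<Phi> y"
    obtain u i v j where uv: "x = (u, i)" "y = (v, j)" "u \<in> verts F" "v \<in> verts F" using xy by auto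
    have eq: "\<phi> i u = \<phi> j v" using xy(3) uv by (simp add: \<Phi>_def)
    have "\<phi> i u \<in> w i" "\<phi> j v \<in> w j" using bij_betwE[OF \<phi>] uv by blast+
    then have "w i \<inter> w j \<noteq> {}" using eq by auto
    then have "w i = w j" using YY(1) wY[of i] wY[of j] unfolding disjoint_def by blast
    then have ij: "i = j" using w by (auto simp: bij_betw_def dest: injD)
    then have "u = v" using eq \<phi>[of i] uv by (auto simp: bij_betw_def dest: inj_onD)
    then show "x = y" using uv ij by simp
  qed
  have im: "\<Phi> ` (verts F \<times> UNIV) = \<Union>YY"
  proof -
    have "\<Phi> ` (verts F \<times> UNIV) = (\<Union>i. \<phi> i ` verts F)" by (force simp: \<Phi>_def)
    also have "\<dots> = (\<Union>i. w i)" using \<phi> by (simp add: bij_betw_def)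
    also have "\<dots> = \<Union>YY" using w by (simp add: bij_betw_def)
    finally show ?thesis .
  qed
  \<comment> \<open>Only the images of edges are taken, so that \<open>\<Phi>\<close> is an
    isomorphism although \<open>K_nat\<close> has all other edges as well.\<close>
  define H' where "H' = \<lparr>verts = \<Union>YY, edges = (\<lambda>e. \<Phi> ` e) ` edges (omega_copies F)\<rparr>"
  have edge: "\<Phi> ` (e \<times> {i}) = \<phi> i ` e" for e i by (force simp: \<Phi>_def)
  have eF: "e \<subseteq> verts F" "finite e" "card e = 2" if "e \<in> edges F" for e
    using F that by (auto simp: simple_graph_def nsets_def)
  have pos: "\<Union>YY \<subseteq> {1..}" using copies by (auto simp: mono_copy_def)
  have "edges H' \<subseteq> [\<Union>YY]\<^bsup>2\<^esup>"
  proof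
    fix f assume "f \<in> edges H'"
    then obtain e i where e: "e \<in> edges F" "f = \<phi> i ` e"
      by (auto simp: H'_def omega_copies_def edge)
    have "inj_on (\<phi> i) e" using \<phi>[of i] eF(1)[OF e(1)] by (auto simp: bij_betw_def intro: inj_on_subset)
    then have "card f = 2" using e eF[OF e(1)] by (simp add: card_image)
    moreover have "f \<subseteq> w i" using \<phi>[of i] eF(1)[OF e(1)] e(2) by (auto simp: bij_betw_def)
    ultimately show "f \<in> [\<Union>YY]\<^bsup>2\<^esup>" using wY[of i] e(2) eF(2)[OF e(1)] by (auto simp: nsets_def)
  qed
  moreover have "[\<Union>YY]\<^bsup>2\<^esup> \<subseteq> [{1..}]\<^bsup>2\<^esup>" using pos by (rule nsets_mono)
  ultimately have "subgraph H' K_nat"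
    using pos by (auto simp: subgraph_def simple_graph_def K_nat_def H'_def)
  moreover have "monochromatic_graph c H'"
    unfolding monochromatic_graph_def
  proof (intro exI[of _ k] ballI)
    fix f assume "f \<in> edges H'"
    then show "c f = k" using col by (auto simp: H'_def omega_copies_def edge)
  qed
  moreover have "graph_iso (omega_copies F) H'"
    unfolding graph_iso_def
  proof (intro exI[of _ \<Phi>] conjI ballI)
    show "bij_betw \<Phi> (verts (omega_copies F)) (verts H')"
      using inj im by (simp add: bij_betw_def omega_copies_def H'_def)
    fix x y assume xy: "x \<in> verts (omega_copies F)" "y \<in> verts (omega_copies F)"
    then have xy': "{x, y} \<subseteq> verts F \<times> UNIV" by (simp add: omega_copies_def)
    show "{x, y} \<in> edges (omega_copies F) \<longleftrightarrow> {\<Phi> x, \<Phi> y} \<in> edges H'"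
    proof
      assume "{x, y} \<in> edges (omega_copies F)"
      then have "\<Phi> ` {x, y} \<in> edges H'" unfolding H'_def by (simp only: ugraph.simps image_eqI)
      then show "{\<Phi> x, \<Phi> y} \<in> edges H'" by simp
    next
      assume "{\<Phi> x, \<Phi> y} \<in> edges H'"
      then obtain f where f: "f \<in> edges (omega_copies F)" "\<Phi> ` {x, y} = \<Phi> ` f"
        by (auto simp: H'_def)
      have "f \<subseteq> verts F \<times> UNIV" using f(1) eF(1) by (auto simp: omega_copies_def)
      then have "{x, y} = f" using inj_on_image_eq_iff[OF inj xy', of f] f(2) by blast
      then show "{x, y} \<in> edges (omega_copies F)" using f(1) by simp
    qed
  qed
  ultimately show ?thesis by (intro exI[of _ H']) (simp add: H'_def)
qed

text \<open>Nested finite tilings are chosen, the \<open>i\<close>-th one being dense at some time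
  \<open>T > i\<close>. Their union inherits the density at all these times.\<close>

lemma omega_copies_dense:
  assumes F: "simple_graph F" "finite (verts F)" and l: "0 < l"
    and dense: "\<And>T0. \<exists>T\<ge>T0. \<exists>WW. mono_tiling F c k WW \<and> l * real T \<le> card (\<Union>WW \<inter> {1..T})"
  shows "\<exists>H'. subgraph H' K_nat \<and> monochromatic_graph c H' \<and> graph_iso (omega_copies F) H' \<and>
    ereal l \<le> upper_density (verts H')"
proof -
  define P where "P i X \<longleftrightarrow> mono_tiling F c k X \<and>
    (\<exists>T>i. (l - 1 / (real i + 1)) * real T \<le> card (\<Union>X \<inter> {1..T}))" for i :: nat and X
  have step: "\<exists>X'. P i X' \<and> X \<subseteq> X'" if X: "mono_tiling F c k X" for i X
  proof -
    define d where "d = card (verts F) * card (\<Union>X)"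
    \<comment> \<open>\<open>T\<close> is so late that keeping the copies chosen earlier, which
      costs at most \<open>d\<close> vertices, loses at most \<open>T / (i + 1)\<close>.\<close>
    obtain T WW where T: "T \<ge> max (Suc i) (d * Suc i)" and WW: "mono_tiling F c k WW"
      "l * real T \<le> card (\<Union>WW \<inter> {1..T})" using dense by blast
    obtain X' where X': "X \<subseteq> X'" "mono_tiling F c k X'"
      "real (card (\<Union>WW \<inter> {1..T})) \<le> card (\<Union>X' \<inter> {1..T}) + real d"
      using mono_tiling_extend[OF F(2) X WW(1), of T] unfolding d_def by blast
    have "real d * (real i + 1) \<le> T"
    proof -
      have "d * Suc i \<le> T" using T by simp
      then have "real (d * Suc i) \<le> real T" unfolding of_nat_le_iff .
      then show ?thesis by (simp add: algebra_simps)
    qed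
    then have "real d \<le> 1 / (real i + 1) * T" by (simp add: field_simps)
    then have "(l - 1 / (real i + 1)) * T \<le> card (\<Union>X' \<inter> {1..T})"
      using WW(2) X'(3) by (simp add: left_diff_distrib)
    moreover have "i < T" using T by simp
    ultimately show ?thesis using X'(1,2) unfolding P_def by blast
  qed
  have "\<exists>f. \<forall>i. P i (f i) \<and> f i \<subseteq> f (Suc i)"
  proof (rule dependent_nat_choice[where P = P and Q = "\<lambda>_ X X'. X \<subseteq> X'"])
    have "mono_tiling F c k {}" by (simp add: mono_tiling_def)
    then show "\<exists>X. P 0 X" using step by blast
    show "\<exists>X'. P (Suc i) X' \<and> X \<subseteq> X'" if "P i X" for X i using step that unfolding P_def by blast
  qed
  then obtain f where f: "\<And>i. P i (f i)" "\<And>i. f i \<subseteq> f (Suc i)" by blast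
  have mono: "f i \<subseteq> f j" if "i \<le> j" for i j using f(2) that by (rule lift_Suc_mono_le)
  have til: "mono_tiling F c k (f i)" for i using f(1) by (simp add: P_def)
  define YY where "YY = (\<Union>i. f i)"
  have dens: "\<exists>T>i. (l - 1 / (real i + 1)) * real T \<le> card (\<Union>YY \<inter> {1..T})" for i
  proof -
    obtain T where T: "T > i" "(l - 1 / (real i + 1)) * real T \<le> card (\<Union>(f i) \<inter> {1..T})"
      using f(1)[of i] unfolding P_def by blast
    have "card (\<Union>(f i) \<inter> {1..T}) \<le> card (\<Union>YY \<inter> {1..T})"
      by (intro card_mono) (auto simp: YY_def)
    then show ?thesis using T by (intro exI[of _ T]) linarith
  qed
  have disj: "disjoint YY"
    unfolding disjoint_def
  proof (intro ballI impI)
    fix V W assume "V \<in> YY" "W \<in> YY" and ne: "V \<noteq> W"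
    then obtain i j where ij: "V \<in> f i" "W \<in> f j" by (auto simp: YY_def)
    then have "V \<in> f (max i j)" "W \<in> f (max i j)" using mono[of i "max i j"] mono[of j "max i j"] by auto
    then show "V \<inter> W = {}" using til[of "max i j"] ne by (simp add: mono_tiling_def disjoint_def)
  qed
  have count: "countable YY"
    unfolding YY_def using til by (intro countable_UN) (auto simp: mono_tiling_def intro: countable_finite)
  have copies: "mono_copy F c k W" if "W \<in> YY" for W using that til by (auto simp: YY_def mono_tiling_def)
  have inf: "infinite YY"
  proof
    assume "finite YY"
    then have fin: "finite (\<Union>YY)" using mono_copy_card(1)[OF copies F(2)] by blast
    \<comment> \<open>For this \<open>i\<close> the density at the time \<open>T > i\<close> is at
      least \<open>l / 2\<close>, so more than \<open>l / 2 * i\<close> vertices would be covered,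
      while the finite union has at most that many.\<close>
    define i where "i = nat \<lceil>2 / l\<rceil> + nat \<lceil>2 * card (\<Union>YY) / l\<rceil>"
    have i1: "2 / l \<le> real i + 1" unfolding i_def by linarith
    have i2: "2 * card (\<Union>YY) / l \<le> i" unfolding i_def by linarith
    obtain T where T: "T > i" "(l - 1 / (real i + 1)) * real T \<le> card (\<Union>YY \<inter> {1..T})" using dens by blast
    have "1 / (real i + 1) \<le> l / 2" using i1 l by (simp add: field_simps)
    then have "l / 2 * T \<le> (l - 1 / (real i + 1)) * T" by (intro mult_right_mono) auto
    also have "\<dots> \<le> card (\<Union>YY \<inter> {1..T})" by (rule T(2))
    also have "\<dots> \<le> card (\<Union>YY)" using fin by (intro of_nat_mono card_mono) auto
    also have "\<dots> \<le> l / 2 * i" using i2 l by (simp add: field_simps)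
    finally have "l / 2 * T \<le> l / 2 * i" .
    then show False using l T(1) by simp
  qed
  obtain H' where "subgraph H' K_nat" "monochromatic_graph c H'" "graph_iso (omega_copies F) H'"
    "verts H' = \<Union>YY" using omega_copies_of_copies[OF F(1) disj count inf copies] by blast
  then show ?thesis using upper_density_ge[OF dens] by (intro exI[of _ H']) simp
qed

section \<open>Upper bounds for the function h\<close>

text \<open>Closedness and the lower bound 0 make the infimum attained, so that \<open>LEAST\<close>
  denotes it.\<close>

lemma min_or_infinity_eq_Inf:
  assumes "closed X" "X \<subseteq> {0..}" "X \<noteq> {}"
  shows "min_or_infinity X = ereal (Inf X)" "Inf X \<in> X" "bdd_below X"
proof -
  show bdd: "bdd_below X" using assms(2) by (meson bdd_below_Ici bdd_below_mono)
  show "Inf X \<in> X" using assms bdd by (intro closed_contains_Inf)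
  then have "(LEAST z. z \<in> X) = Inf X"
    by (intro Least_equality) (auto intro: cInf_lower bdd)
  then show "min_or_infinity X = ereal (Inf X)" using assms(3) by (simp add: min_or_infinity_def)
qed

lemma min_or_infinity_le:
  assumes "closed X" "X \<subseteq> {0..}" "x \<in> X"
  shows "min_or_infinity X \<le> ereal x"
proof -
  have "X \<noteq> {}" using assms(3) by blast
  from min_or_infinity_eq_Inf[OF assms(1,2) this] show ?thesis
    using assms(3) by (simp add: cInf_lower)
qed

lemma min_or_infinity_nonneg:
  assumes "closed X" "X \<subseteq> {0..}"
  shows "0 \<le> min_or_infinity X"
proof (cases "X = {}")
  case False
  then show ?thesis using min_or_infinity_eq_Inf(1,2)[OF assms] assms(2) by auto
qed (simp add: min_or_infinity_def)

text \<open>The function \<open>g\<close> is a McShane extension: it has to be at least \<open>\<beta> - \<rho>\<close> at the points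
  \<open>\<beta> + \<rho>\<close> and at most \<open>\<beta>' - \<rho>'\<close> at the points \<open>\<beta>' + \<rho>'\<close>, up to the error terms, and the assumption
  \<open>cross\<close> says exactly that these requirements are compatible with a Lipschitz constant 1.\<close>

lemma h_fun_le:
  fixes lam c e :: real and \<beta> \<rho> \<beta>' \<rho>' :: "nat \<Rightarrow> real"
  defines "\<tau> \<equiv> 2 * lam * c / (lam + 1) - 2 * e"
  assumes lam: "0 < lam" and e: "0 \<le> e" and \<tau>: "0 < \<tau>"
    and nonneg: "\<And>T. T \<ge> T1 \<Longrightarrow> 0 \<le> \<beta> T \<and> 0 \<le> \<rho> T \<and> 0 \<le> \<beta>' T \<and> 0 \<le> \<rho>' T"
    and d1: "\<And>T. T \<ge> T1 \<Longrightarrow> c * T \<le> \<beta> T - \<rho> T / lam"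
    and d2: "\<And>T. T \<ge> T1 \<Longrightarrow> c * T \<le> \<rho>' T - \<beta>' T / lam"
    and total: "\<And>T. T \<ge> T1 \<Longrightarrow> \<beta> T + \<rho>' T \<le> T"
    and cross: "\<And>S T. S \<ge> T1 \<Longrightarrow> T \<ge> T1 \<Longrightarrow>
      \<rho>' S \<le> \<rho> T + e * (real T + real S) \<or> \<beta> T \<le> \<beta>' S + e * (real T + real S)"
  shows "h_fun ((lam - 1) / (lam + 1)) \<le> ereal ((1 + lam - 2 * lam * c) / \<tau>)"
proof -
  define \<gamma> where "\<gamma> = (lam - 1) / (lam + 1)"
  define x where "x T = \<beta> T + \<rho> T" for T
  define G where "G T = \<beta> T - \<rho> T" for T
  define y where "y T = \<beta>' T + \<rho>' T" for T
  define G' where "G' T = \<beta>' T - \<rho>' T" for T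
  \<comment> \<open>Each element is a function of \<open>z\<close> with Lipschitz constant 1, and
    \<open>g\<close> is their supremum. The member \<open>- \<bar>z\<bar>\<close> makes
    \<open>g 0 \<ge> 0\<close>; the others are at most 0 at \<open>z = 0\<close> because
    \<open>G T \<le> x T\<close>.\<close>
  define S where "S z = insert (- \<bar>z\<bar>) ((\<lambda>T. G T - 2 * e * T - \<bar>z - x T\<bar>) ` {T1..})" for z
  define g where "g z = Sup (S z)" for z
  have x0: "0 \<le> x T" "G T \<le> x T" "0 \<le> y T" "- y T \<le> G' T" if "T \<ge> T1" for T
    using nonneg[OF that] by (auto simp: x_def G_def y_def G'_def)
  have Sle: "s \<le> \<bar>z\<bar>" if s: "s \<in> S z" for s z
  proof -
    consider "s = - \<bar>z\<bar>" | T where "T \<ge> T1" "s = G T - 2 * e * T - \<bar>z - x T\<bar>"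
      using s unfolding S_def by blast
    then show ?thesis
    proof cases
      case 2
      have "0 \<le> e * T" using e by simp
      then show ?thesis using 2 x0[of T] by linarith
    qed simp
  qed
  have bdd: "bdd_above (S z)" for z using Sle by (meson bdd_aboveI)
  have ne: "S z \<noteq> {}" for z by (simp add: S_def)
  have ge: "s \<le> g z" if "s \<in> S z" for s z unfolding g_def using bdd that by (rule cSup_upper[rotated])
  have half: "g z \<le> g w + \<bar>z - w\<bar>" for z w
    unfolding g_def[of z]
  proof (rule cSup_least[OF ne])
    fix s assume "s \<in> S z"
    then consider "s = - \<bar>z\<bar>" | T where "T \<ge> T1" "s = G T - 2 * e * T - \<bar>z - x T\<bar>"
      unfolding S_def by blast
    then show "s \<le> g w + \<bar>z - w\<bar>"
    proof cases
      case 1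
      have "- \<bar>w\<bar> \<le> g w" by (rule ge) (simp add: S_def)
      then show ?thesis using 1 by linarith
    next
      case 2
      have "G T - 2 * e * T - \<bar>w - x T\<bar> \<le> g w" by (rule ge) (use 2 in \<open>simp add: S_def\<close>)
      then show ?thesis using 2 by linarith
    qed
  qed
  have lip: "1-lipschitz_on UNIV g"
  proof (rule lipschitz_onI)
    fix z w
    show "dist (g z) (g w) \<le> 1 * dist z w"
      using half[of z w] half[of w z] by (simp add: dist_real_def abs_le_iff abs_minus_commute)
  qed simp
  have cont: "continuous_on UNIV g" using lip by (rule lipschitz_on_continuous_on)
  have g0: "g 0 = 0"
  proof (rule antisym)
    show "g 0 \<le> 0" unfolding g_def using Sle[of _ 0] by (intro cSup_least[OF ne]) simp
    show "0 \<le> g 0" by (rule ge) (simp add: S_def)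
  qed
  have gx: "G T - 2 * e * T \<le> g (x T)" if "T \<ge> T1" for T
  proof -
    have "G T - 2 * e * T - \<bar>x T - x T\<bar> \<in> S (x T)" unfolding S_def using that by blast
    from ge[OF this] show ?thesis by simp
  qed
  have gy: "g (y U) \<le> G' U + 2 * e * U" if U: "U \<ge> T1" for U
    unfolding g_def
  proof (rule cSup_least[OF ne])
    fix s assume "s \<in> S (y U)"
    then consider "s = - \<bar>y U\<bar>" | T where "T \<ge> T1" "s = G T - 2 * e * T - \<bar>y U - x T\<bar>"
      unfolding S_def by blast
    then show "s \<le> G' U + 2 * e * U"
    proof cases
      case 1
      have "0 \<le> e * U" using e by simp
      then show ?thesis using 1 x0[OF U] by linarith
    next
      case 2
      \<comment> \<open>The first alternative of \<open>cross\<close> is combined with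
        \<open>\<bar>y U - x T\<bar> \<ge> x T - y U\<close>, the second with the opposite sign: the
        differences of the coordinates are then twice \<open>\<rho>' U - \<rho> T\<close> and twice
        \<open>\<beta> T - \<beta>' U\<close>.\<close>
      have "e * (real T + real U) = e * T + e * U" by (rule distrib_left)
      then have "\<rho>' U \<le> \<rho> T + e * T + e * U \<or> \<beta> T \<le> \<beta>' U + e * T + e * U"
        using cross[OF U 2(1)] by linarith
      then show ?thesis unfolding 2(2) x_def y_def G_def G'_def by linarith
    qed
  qed
  have clos: "closed {z. z \<ge> 0 \<and> \<gamma> * z + g z \<ge> t}" "closed {z. z \<ge> 0 \<and> \<gamma> * z - g z \<ge> t}" for t
    by (intro closed_Collect_conj closed_Collect_le continuous_intros cont)+
  have Gp: "Gamma_plus \<gamma> g t \<le> ereal (x T)" if T: "T \<ge> T1" "t \<le> \<tau> * T" for t T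
    unfolding Gamma_plus_def
  proof (rule min_or_infinity_le[OF clos(1)])
    \<comment> \<open>The identity \<open>\<gamma> * x T + G T = 2 * (\<beta> T * lam - \<rho> T) /
      (lam + 1)\<close> turns \<open>d1\<close> into a lower bound on this quantity. The term
      \<open>- 2 * e\<close> in \<open>\<tau>\<close> pays for the error in
      \<open>gx\<close>.\<close>
    have "c * T * lam \<le> (\<beta> T - \<rho> T / lam) * lam" using d1[OF T(1)] lam by (intro mult_right_mono) auto
    then have 1: "c * T * lam \<le> \<beta> T * lam - \<rho> T" using lam by (simp add: algebra_simps)
    have "\<tau> * T + 2 * e * T = 2 * (c * T * lam) / (lam + 1)" by (simp add: \<tau>_def algebra_simps)
    also have "\<dots> \<le> 2 * (\<beta> T * lam - \<rho> T) / (lam + 1)" using 1 lam by (intro divide_right_mono) auto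
    also have "\<dots> = \<gamma> * x T + G T" using lam by (simp add: \<gamma>_def x_def G_def field_simps)
    finally have "t \<le> \<gamma> * x T + g (x T)" using gx[OF T(1)] T(2) by linarith
    then show "x T \<in> {z. z \<ge> 0 \<and> \<gamma> * z + g z \<ge> t}" using x0[OF T(1)] by simp
  qed auto
  have Gm: "Gamma_minus \<gamma> g t \<le> ereal (y T)" if T: "T \<ge> T1" "t \<le> \<tau> * T" for t T
    unfolding Gamma_minus_def
  proof (rule min_or_infinity_le[OF clos(2)])
    have "c * T * lam \<le> (\<rho>' T - \<beta>' T / lam) * lam" using d2[OF T(1)] lam by (intro mult_right_mono) auto
    then have 1: "c * T * lam \<le> \<rho>' T * lam - \<beta>' T" using lam by (simp add: algebra_simps)
    have "\<tau> * T + 2 * e * T = 2 * (c * T * lam) / (lam + 1)" by (simp add: \<tau>_def algebra_simps)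
    also have "\<dots> \<le> 2 * (\<rho>' T * lam - \<beta>' T) / (lam + 1)" using 1 lam by (intro divide_right_mono) auto
    also have "\<dots> = \<gamma> * y T - G' T" using lam by (simp add: \<gamma>_def y_def G'_def field_simps)
    finally have "t \<le> \<gamma> * y T - g (y T)" using gy[OF T(1)] T(2) by linarith
    then show "y T \<in> {z. z \<ge> 0 \<and> \<gamma> * z - g z \<ge> t}" using x0[OF T(1)] by simp
  qed auto
  define K where "K = 1 + lam - 2 * lam * c"
  have xy: "x T + y T \<le> K * T" if T: "T \<ge> T1" for T
  proof -
    have "c * T * lam \<le> (\<beta> T - \<rho> T / lam) * lam" "c * T * lam \<le> (\<rho>' T - \<beta>' T / lam) * lam"
      using d1[OF T] d2[OF T] lam by (auto intro: mult_right_mono)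
    then have "\<rho> T \<le> \<beta> T * lam - c * T * lam" "\<beta>' T \<le> \<rho>' T * lam - c * T * lam"
      using lam by (simp_all add: algebra_simps)
    \<comment> \<open>\<open>d1\<close> and \<open>d2\<close> bound \<open>\<rho> T\<close> and
      \<open>\<beta>' T\<close> by \<open>\<beta> T\<close> and \<open>\<rho>' T\<close>, whose sum
      is at most \<open>T\<close> by \<open>total\<close>.\<close>
    then have "x T + y T \<le> (\<beta> T + \<rho>' T) * (1 + lam) - 2 * (c * T * lam)"
      by (simp add: x_def y_def algebra_simps)
    also have "\<dots> \<le> T * (1 + lam) - 2 * (c * T * lam)"
      using mult_right_mono[OF total[OF T], of "1 + lam"] lam by simp
    finally show ?thesis by (simp add: K_def algebra_simps)
  qed
  have K: "0 \<le> K"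
  proof -
    have "0 \<le> K * real (Suc T1)" using xy[of "Suc T1"] x0[of "Suc T1"] by linarith
    then show ?thesis by (simp add: zero_le_mult_iff)
  qed
  have ev: "eventually (\<lambda>t::real. (Gamma_plus \<gamma> g t + Gamma_minus \<gamma> g t) / ereal t
      \<le> ereal (K * (1 / \<tau> + inverse t))) at_top"
    using eventually_ge_at_top[of "max 1 (\<tau> * T1)"]
  proof eventually_elim
    case (elim t)
    \<comment> \<open>The first integer time with \<open>t \<le> \<tau> * T\<close>; rounding adds
      at most 1, which vanishes after division by \<open>t\<close>.\<close>
    define T where "T = nat \<lceil>t / \<tau>\<rceil>"
    have t: "1 \<le> t" "T1 \<le> t / \<tau>" using elim \<tau> by (auto simp: field_simps)
    have T: "t / \<tau> \<le> T" unfolding T_def by linarith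
    have T2: "T \<le> t / \<tau> + 1" unfolding T_def using t \<tau> by simp
    have T3: "T1 \<le> T" using T t by linarith
    have T4: "t \<le> \<tau> * T" using T \<tau> by (simp add: field_simps)
    have "Gamma_plus \<gamma> g t + Gamma_minus \<gamma> g t \<le> ereal (x T) + ereal (y T)"
      by (intro add_mono Gp[OF T3 T4] Gm[OF T3 T4])
    also have "\<dots> \<le> ereal (K * (t / \<tau> + 1))"
      using xy[OF T3] mult_left_mono[OF T2 K] by simp
    finally have "(Gamma_plus \<gamma> g t + Gamma_minus \<gamma> g t) / ereal t \<le> ereal (K * (t / \<tau> + 1)) / ereal t"
      using t by (intro ereal_divide_right_mono) auto
    also have "\<dots> = ereal (K * (1 / \<tau> + inverse t))" using t \<tau> by (simp add: field_simps)
    finally show ?case .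
  qed
  have "((\<lambda>t. ereal (K * (1 / \<tau> + inverse t))) \<longlongrightarrow> ereal (K * (1 / \<tau> + 0))) at_top"
    by (intro tendsto_intros tendsto_inverse_0_at_top filterlim_ident)
  then have "Limsup at_top (\<lambda>t. ereal (K * (1 / \<tau> + inverse t))) = ereal (K * (1 / \<tau> + 0))"
    by (intro lim_imp_Limsup) simp_all
  then have "Limsup at_top (\<lambda>t. (Gamma_plus \<gamma> g t + Gamma_minus \<gamma> g t) / ereal t) \<le> ereal (K / \<tau>)"
    using Limsup_mono[OF ev] by simp
  moreover have "1-lipschitz_on {0..} g" using lip by (rule lipschitz_on_subset) simp
  ultimately have "h_fun \<gamma> \<le> ereal (K / \<tau>)"
    unfolding h_fun_def using g0 by (intro INF_lower2[of g]) auto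
  then show ?thesis unfolding \<gamma>_def K_def .
qed

section \<open>Deficient pairs of a colouring\<close>

text \<open>Block \<open>x\<close> carries \<open>m * lev x\<close> copies with \<open>p\<close>
  vertices in \<open>A x\<close> and \<open>q\<close> in \<open>Z x\<close>. The other
  \<open>p * m * (H - lev x)\<close> vertices of the clique \<open>A x\<close> form a multiple of
  \<open>p + q\<close> because \<open>p + q\<close> divides \<open>m\<close>.\<close>

lemma layered_tiling:
  fixes c :: "nat set \<Rightarrow> colour"
  assumes loc: "bipartite_cells KK B a q C T"
    and L: "bipartite_cells.layered (\<lambda>u v. c {u, v} = k) KK B a q H m N A Z lev"
    and m: "0 < m" "(p + q) dvd m" and a: "a = p * H"
    and F: "simple_graph F" "finite (verts F)" "card (verts F) = p + q"
    and S: "S \<subseteq> verts F" "indep S (edges F)" "card S = q"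
    and KK: "\<And>K. K \<in> KK \<Longrightarrow> mono_clique c k K \<and> K \<subseteq> {1..}"
    and B: "B \<subseteq> {1..}" "\<Union>KK \<inter> B = {}"
  shows "\<exists>WW. mono_tiling F c k WW \<and> \<Union>WW = \<Union>KK \<union> (\<Union>x<N. Z x)"
proof -
  interpret bipartite_cells "\<lambda>u v. c {u, v} = k" KK B a q H C T by (rule loc)
  note LD = layeredD[OF L] and fA = layeredD(8)[OF L _ m(1)]
  have dA: "disjoint_family_on A {..<N}" and dZ: "disjoint_family_on Z {..<N}"
    and U: "(\<Union>x<N. A x) = \<Union>KK" using L by (simp_all add: layered_def)
  have AK: "A x \<subseteq> \<Union>KK" if "x < N" for x using that U by blast
  have ex: "\<exists>WW. mono_tiling F c k WW \<and> \<Union>WW = A x \<union> Z x" if x: "x < N" for x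
  proof -
    obtain K where K: "K \<in> KK" "A x \<subseteq> K" using LD(1)[OF x] by blast
    show ?thesis
    proof (rule block_tiling[OF F S])
      have "(p + q) * (p * (m div (p + q)) * (H - lev x)) = p * ((p + q) * (m div (p + q))) * (H - lev x)"
        by (simp only: mult_ac)
      also have "(p + q) * (m div (p + q)) = m" using m(2) by simp
      finally have "p * (m * lev x) + (p + q) * (p * (m div (p + q)) * (H - lev x)) = p * m * (lev x + (H - lev x))"
        by (simp add: distrib_left mult.assoc)
      also have "\<dots> = p * m * H" using LD(5)[OF x] by simp
      finally show "card (A x) = p * (m * lev x) + (p + q) * (p * (m div (p + q)) * (H - lev x))"
        using LD(2)[OF x] by (simp add: a)
      show "card (Z x) = q * (m * lev x)" using LD(4)[OF x] by simp
      show "A x \<subseteq> {1..}" using K KK by blast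
      show "mono_clique c k (A x)" using K KK mono_clique_subset by blast
      show "Z x \<subseteq> {1..}" using LD(3)[OF x] B(1) by blast
      show "A x \<inter> Z x = {}" using LD(3)[OF x] AK[OF x] B(2) by blast
      show "c {u, v} = k" if "u \<in> A x" "v \<in> Z x" for u v using LD(6)[OF x] that by blast
      show "finite (A x)" by (rule fA[OF x])
      show "finite (Z x)" by (rule LD(7)[OF x])
    qed
  qed
  have "\<forall>x\<in>{..<N}. \<exists>WW. mono_tiling F c k WW \<and> \<Union>WW = A x \<union> Z x" by (intro ballI ex) simp
  from bchoice[OF this] obtain WW
    where WW: "\<forall>x\<in>{..<N}. mono_tiling F c k (WW x) \<and> \<Union>(WW x) = A x \<union> Z x"
    by (elim exE)
  have "mono_tiling F c k (\<Union>x\<in>{..<N}. WW x)"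
  proof (rule mono_tiling_Union)
    fix x y assume xy: "x \<in> {..<N}" "y \<in> {..<N}" "x \<noteq> y"
    have "A x \<inter> A y = {}" "Z x \<inter> Z y = {}"
      using disjoint_family_onD[OF dA xy] disjoint_family_onD[OF dZ xy] by simp_all
    moreover have "A x \<inter> Z y = {}" "Z x \<inter> A y = {}"
      using AK[of x] AK[of y] LD(3)[of x] LD(3)[of y] B(2) xy by auto
    moreover have "\<Union>(WW x) = A x \<union> Z x" "\<Union>(WW y) = A y \<union> Z y" using WW xy by simp_all
    ultimately show "\<Union>(WW x) \<inter> \<Union>(WW y) = {}" by auto
  qed (use WW in simp_all)
  moreover have "\<Union>(\<Union>x\<in>{..<N}. WW x) = \<Union>KK \<union> (\<Union>x<N. Z x)"
  proof -
    have "\<Union>(\<Union>x\<in>{..<N}. WW x) = (\<Union>x<N. \<Union>(WW x))" by blast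
    also have "\<dots> = (\<Union>x<N. A x \<union> Z x)" using WW by (intro SUP_cong) simp_all
    also have "\<dots> = (\<Union>x<N. A x) \<union> (\<Union>x<N. Z x)" by blast
    finally show ?thesis unfolding U .
  qed
  ultimately show ?thesis by (intro exI conjI)
qed

text \<open>The tiling of a stable assignment misses in \<open>[T]\<close> only unassigned vertices
  and at most \<open>D\<close> vertices outside the cliques, so \<open>sparse\<close> forces at
  least \<open>\<gamma> * T - D\<close> unassigned ones and \<open>deficient_pair\<close> applies.
  The cells reach up to \<open>n0 * T\<close> so that pairs for different times can be compared
  later.\<close>

lemma colour_pair:
  fixes c :: "nat set \<Rightarrow> colour" and \<gamma> e :: real and T n0 H :: nat and fam1 fam2 :: "nat set set"
  defines "KK \<equiv> {Q \<in> fam1. Q \<subseteq> {1..n0 * T}}" and "B \<equiv> \<Union>{Q \<in> fam2. Q \<subseteq> {1..T}}"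
  assumes F: "simple_graph F" "finite (verts F)" "card (verts F) = p + q"
    and S: "S \<subseteq> verts F" "indep S (edges F)" "card S = q" and p: "0 < p" and q: "0 < q"
    and H: "H = h * h" "0 < h"
    and stab: "\<And>N A Z lev. bipartite_cells KK B (p * H) q (real n0) T \<Longrightarrow>
      bipartite_cells.layered (\<lambda>u v. c {u, v} = k) KK B (p * H) q H (M * (p + q)) N A Z lev \<Longrightarrow>
      bipartite_cells.stable (\<lambda>u v. c {u, v} = k) KK B (p * H) q H T e (p + q)"
    and M: "0 < M" and T: "0 < T" and n0: "0 < n0"
    and fam: "disjoint (fam1 \<union> fam2)" "fam1 \<inter> fam2 = {}"
      "\<And>Q. Q \<in> fam1 \<union> fam2 \<Longrightarrow> Q \<subseteq> {1..} \<and> card Q = p * H * (M * (p + q))"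
      "\<And>Q. Q \<in> fam1 \<Longrightarrow> mono_clique c k Q"
    and D: "card ({1..T} - \<Union>{Q \<in> fam1 \<union> fam2. Q \<subseteq> {1..T}}) \<le> D"
    and sparse: "\<And>WW. mono_tiling F c k WW \<Longrightarrow> card (\<Union>WW \<inter> {1..T}) \<le> (1 - \<gamma>) * T"
  shows "\<exists>I M'. I \<subseteq> B \<and> M' \<subseteq> \<Union>KK \<and>
    \<gamma> * T - D \<le> card I - real q / real p * card M' + 2 * real q * real n0 * T / (real p * real h) \<and>
    card {v \<in> \<Union>KK - M'. e * T \<le> card {w \<in> I. c {v, w} = k}} < e * T"
proof -
  have fKK: "finite KK" by (rule finite_subset[of _ "Pow {1..n0 * T}"]) (auto simp: KK_def)
  have Bsub: "B \<subseteq> {1..T}" by (auto simp: B_def)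
  have Ksub: "\<Union>KK \<subseteq> {1..n0 * T}" by (auto simp: KK_def)
  have Hpos: "0 < H" using H by simp
  have loc: "bipartite_cells KK B (p * H) q (real n0) T"
  proof
    show "finite B" using Bsub by (rule finite_subset) simp
    have "card B \<le> card {1..T}" using Bsub by (intro card_mono) auto
    then show "real (card B) \<le> real T" by simp
    have "card (\<Union>KK) \<le> card {1..n0 * T}" using Ksub by (intro card_mono) auto
    then have "card (\<Union>KK) \<le> n0 * T" by simp
    then show "real (card (\<Union>KK)) \<le> real n0 * real T" by (metis of_nat_le_iff of_nat_mult)
    show "0 < p * H" "0 < q" "0 < real T" using p q Hpos T by simp_all
  qed
  then interpret bipartite_cells "\<lambda>u v. c {u, v} = k" KK B "p * H" q H "real n0" T .
  have KB: "\<Union>KK \<inter> B = {}"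
  proof -
    have "Q \<inter> R = {}" if "Q \<in> fam1" "R \<in> fam2" for Q R
    proof -
      have "Q \<noteq> R" using that fam(2) by blast
      then show ?thesis using fam(1) that unfolding disjoint_def by blast
    qed
    then show ?thesis unfolding KK_def B_def by blast
  qed
  obtain A where A: "bij_betw A {0..<card KK} KK" using ex_bij_betw_nat_finite[OF fKK] by blast
  have AK: "A x \<in> KK" if "x < card KK" for x using bij_betwE[OF A] that by simp
  \<comment> \<open>The start of the refinement: whole cliques as blocks, nothing assigned, all
    loads 0.\<close>
  have "layered (M * (p + q)) (card KK) A (\<lambda>_. {}) (\<lambda>_. 0)"
    unfolding layered_def
  proof (intro conjI allI impI)
    fix x assume x: "x < card KK"
    show "\<exists>K\<in>KK. A x \<subseteq> K" using AK[OF x] by blast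
    show "card (A x) = p * H * (M * (p + q))" using AK[OF x] fam(3) by (simp add: KK_def)
  next
    show "disjoint_family_on A {..<card KK}"
      unfolding disjoint_family_on_def
    proof (intro ballI impI)
      fix x y assume xy: "x \<in> {..<card KK}" "y \<in> {..<card KK}" "x \<noteq> y"
      then have "A x \<noteq> A y" using bij_betw_imp_inj_on[OF A] by (auto dest: inj_onD)
      moreover have "A x \<in> fam1 \<union> fam2" "A y \<in> fam1 \<union> fam2" using AK xy by (simp_all add: KK_def)
      ultimately show "A x \<inter> A y = {}" using fam(1) unfolding disjoint_def by blast
    qed
    show "disjoint_family_on (\<lambda>_. {}) {..<card KK}" by (simp add: disjoint_family_on_def)
    have "A ` {..<card KK} = KK" using A by (simp add: bij_betw_def lessThan_atLeast0)
    then show "(\<Union>x<card KK. A x) = \<Union>KK" by simp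
  qed simp_all
  then have "stable e (p + q)" by (rule stab[OF loc])
  from deficient_pair[OF this refl H p] obtain m N A Z lev I M' where *: "0 < m" "(p + q) dvd m"
    and L: "layered m N A Z lev" and I: "I \<subseteq> B" and M': "M' \<subseteq> \<Union>KK"
    and def: "real (card (B - (\<Union>x<N. Z x)))
      \<le> card I - real q / real p * card M' + 2 * real q * real n0 * T / (real p * real h)"
    and few: "card {v \<in> \<Union>KK - M'. e * T \<le> card {w \<in> I. c {v, w} = k}} < e * T"
    by (elim exE conjE)
  have "K \<in> KK \<Longrightarrow> mono_clique c k K \<and> K \<subseteq> {1..}" for K using fam(3,4) by (auto simp: KK_def)
  moreover have "B \<subseteq> {1..}" using Bsub by auto
  ultimately obtain WW where WW: "mono_tiling F c k WW" "\<Union>WW = \<Union>KK \<union> (\<Union>x<N. Z x)"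
    using layered_tiling[OF loc L * refl F S _ _ KB] by metis
  define U where "U = B - (\<Union>x<N. Z x)"
  have "{1..T} \<subseteq> (\<Union>WW \<inter> {1..T}) \<union> (({1..T} - \<Union>{Q \<in> fam1 \<union> fam2. Q \<subseteq> {1..T}}) \<union> U)"
  proof
    fix v assume v: "v \<in> {1..T}"
    show "v \<in> (\<Union>WW \<inter> {1..T}) \<union> (({1..T} - \<Union>{Q \<in> fam1 \<union> fam2. Q \<subseteq> {1..T}}) \<union> U)"
    proof (cases "v \<in> \<Union>{Q \<in> fam1 \<union> fam2. Q \<subseteq> {1..T}}")
      case True
      then obtain Q where Q: "v \<in> Q" "Q \<in> fam1 \<union> fam2" "Q \<subseteq> {1..T}" by blast
      have "T \<le> n0 * T" using n0 by simp
      then have sub: "{1..T} \<subseteq> {1..n0 * T}" by auto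
      have "v \<in> \<Union>KK \<or> v \<in> B" using Q sub unfolding KK_def B_def by blast
      then show ?thesis using v unfolding WW(2) U_def by blast
    qed (use v in blast)
  qed
  then have "card {1..T} \<le> card ((\<Union>WW \<inter> {1..T}) \<union> (({1..T} - \<Union>{Q \<in> fam1 \<union> fam2. Q \<subseteq> {1..T}}) \<union> U))"
    by (rule card_mono[rotated]) (simp add: U_def finite_B)
  also have "\<dots> \<le> card (\<Union>WW \<inter> {1..T}) + card (({1..T} - \<Union>{Q \<in> fam1 \<union> fam2. Q \<subseteq> {1..T}}) \<union> U)"
    by (rule card_Un_le)
  also have "\<dots> \<le> card (\<Union>WW \<inter> {1..T}) + (card ({1..T} - \<Union>{Q \<in> fam1 \<union> fam2. Q \<subseteq> {1..T}}) + card U)"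
    by (intro add_left_mono card_Un_le)
  also have "\<dots> \<le> card (\<Union>WW \<inter> {1..T}) + (D + card U)" using D by simp
  finally have "real T \<le> real (card (\<Union>WW \<inter> {1..T})) + (real D + real (card U))"
    by simp
  then have "\<gamma> * T - D \<le> card U" using sparse[OF WW(1)] by (simp add: left_diff_distrib)
  then have "\<gamma> * T - D \<le> card I - real q / real p * card M' + 2 * real q * real n0 * T / (real p * real h)"
    using def unfolding U_def by (rule order_trans)
  then show ?thesis using I M' few by (intro exI conjI)
qed

text \<open>If both alternatives failed, fewer than half of the pairs would satisfy \<open>R\<close>
  and fewer than half would violate it: less than a quarter come from vertices of large degree and
  at most a quarter from the others.\<close>

lemma dense_bipartite:
  assumes "finite X" "finite Y" "X \<noteq> {}" "Y \<noteq> {}"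
  shows "card X / 4 \<le> card {v \<in> X. card Y / 4 \<le> card {w \<in> Y. R v w}} \<or>
    card Y / 4 \<le> card {w \<in> Y. card X / 4 \<le> card {v \<in> X. \<not> R v w}}"
proof (rule ccontr)
  assume neg: "\<not> ?thesis"
  have bound: "real (\<Sum>v\<in>X. card {w \<in> Y. P v w}) \<le> x * card Y + card X * (card Y / 4)"
    if "finite X" "finite Y" and x: "real (card {v \<in> X. card Y / 4 \<le> card {w \<in> Y. P v w}}) \<le> x"
    for X :: "'x set" and Y :: "'y set" and P and x :: real
  proof -
    define X1 where "X1 = {v \<in> X. card Y / 4 \<le> card {w \<in> Y. P v w}}"
    have "real (\<Sum>v\<in>X. card {w \<in> Y. P v w})
        \<le> (\<Sum>v\<in>X. (if v \<in> X1 then real (card Y) else 0) + card Y / 4)"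
      unfolding of_nat_sum
    proof (rule sum_mono)
      fix v assume "v \<in> X"
      moreover have "card {w \<in> Y. P v w} \<le> card Y" using that(2) by (intro card_mono) auto
      ultimately show "real (card {w \<in> Y. P v w}) \<le> (if v \<in> X1 then real (card Y) else 0) + card Y / 4"
        by (auto simp: X1_def)
    qed
    also have "\<dots> = card X1 * real (card Y) + card X * (card Y / 4)"
    proof -
      have "X \<inter> X1 = X1" by (auto simp: X1_def)
      then show ?thesis using that(1) by (simp add: sum.distrib sum.If_cases)
    qed
    also have "card X1 * real (card Y) \<le> x * card Y"
      using x unfolding X1_def by (intro mult_right_mono) simp_all
    finally show ?thesis by simp
  qed
  define a where "a = real (card X)"
  define b where "b = real (card Y)"
  have ab: "0 < a" "0 < b" using assms by (simp_all add: a_def b_def card_gt_0_iff)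
  define x1 where "x1 = real (card {v \<in> X. card Y / 4 \<le> card {w \<in> Y. R v w}})"
  define y1 where "y1 = real (card {w \<in> Y. card X / 4 \<le> card {v \<in> X. \<not> R v w}})"
  have lt: "x1 < a / 4" "y1 < b / 4" using neg by (auto simp: x1_def y1_def a_def b_def not_le)
  have 1: "real (\<Sum>v\<in>X. card {w \<in> Y. R v w}) \<le> x1 * b + a * (b / 4)"
    unfolding a_def b_def by (rule bound[OF assms(1,2)]) (simp add: x1_def)
  have 2: "real (\<Sum>w\<in>Y. card {v \<in> X. \<not> R v w}) \<le> y1 * a + b * (a / 4)"
    unfolding a_def b_def by (rule bound[OF assms(2,1)]) (simp add: y1_def)
  have "(\<Sum>w\<in>Y. card {v \<in> X. \<not> R v w}) = (\<Sum>v\<in>X. card {w \<in> Y. \<not> R v w})"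
    using sum.swap[of "\<lambda>w v. if \<not> R v w then 1 else 0 :: nat" X Y] assms
    by (simp add: sum.If_cases Int_def)
  then have "(\<Sum>v\<in>X. card {w \<in> Y. R v w}) + (\<Sum>w\<in>Y. card {v \<in> X. \<not> R v w})
      = (\<Sum>v\<in>X. card {w \<in> Y. R v w} + card {w \<in> Y. \<not> R v w})" by (simp add: sum.distrib)
  also have "\<dots> = (\<Sum>v\<in>X. card Y)"
  proof (rule sum.cong[OF refl])
    fix v
    have "card Y = card ({w \<in> Y. R v w} \<union> {w \<in> Y. \<not> R v w})" by (rule arg_cong[of _ _ card]) blast
    also have "\<dots> = card {w \<in> Y. R v w} + card {w \<in> Y. \<not> R v w}"
      using assms(2) by (intro card_Un_disjoint) auto
    finally show "card {w \<in> Y. R v w} + card {w \<in> Y. \<not> R v w} = card Y" ..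
  qed
  finally have "real ((\<Sum>v\<in>X. card {w \<in> Y. R v w}) + (\<Sum>w\<in>Y. card {v \<in> X. \<not> R v w})) = a * b"
    by (simp add: a_def b_def)
  then have "a * b \<le> (x1 * b + a * (b / 4)) + (y1 * a + b * (a / 4))"
    using 1 2 unfolding of_nat_add by linarith
  moreover have "x1 * b < a / 4 * b" "y1 * a < b / 4 * a" using lt ab by simp_all
  ultimately show False by (simp add: field_simps)
qed

text \<open>If both alternatives of the last clause failed, then \<open>I Blue U - M Red T\<close> and
  \<open>I Red T - M Blue U\<close> would span a complete bipartite graph of linear size, at least half of which has
  one of the two colours; this contradicts the choice of \<open>M\<close> for that colour.\<close>

lemma deficient_families:
  fixes c :: "nat set \<Rightarrow> colour" and \<gamma> e :: real
  assumes F: "simple_graph F" "finite (verts F)" "card (verts F) = p + q"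
    and S: "S \<subseteq> verts F" "indep S (edges F)" "card S = q" and p: "0 < p" and q: "0 < q"
    and e: "0 < e"
    and sparse: "\<forall>T\<ge>T0. \<forall>k WW. mono_tiling F c k WW \<longrightarrow> card (\<Union>WW \<inter> {1..T}) \<le> (1 - \<gamma>) * real T"
  shows "\<exists>T1 (I :: colour \<Rightarrow> nat \<Rightarrow> nat set) (M :: colour \<Rightarrow> nat \<Rightarrow> nat set).
    (\<forall>T\<ge>T1. \<forall>k. (\<gamma> - e) * T \<le> card (I k T) - real q / real p * card (M k T)) \<and>
    (\<forall>T\<ge>T1. card (I Red T) + card (I Blue T) \<le> T) \<and>
    (\<forall>U\<ge>T1. \<forall>T\<ge>T1. card (I Blue U) \<le> card (M Red T) + e * (real T + real U) \<or>
      card (I Red T) \<le> card (M Blue U) + e * (real T + real U))"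
proof -
  \<comment> \<open>Chosen so that two times whose ratio is at most \<open>1 / e\<close> also differ
    by at most the integer factor \<open>n0\<close>.\<close>
  define n0 where "n0 = nat \<lceil>1 / e\<rceil> + 1"
  have n0: "0 < n0" "1 / e \<le> real n0" unfolding n0_def by (simp, linarith)
  \<comment> \<open>Makes the rounding error of the loads at most \<open>e / 2 * T\<close>; the
    other half of \<open>e\<close> absorbs \<open>D\<close> through the choice of
    \<open>T1\<close>.\<close>
  define h where "h = nat \<lceil>4 * (real q * real n0) / (real p * e)\<rceil> + 1"
  have h0: "0 < h" by (simp add: h_def)
  have h: "2 * real q * real n0 / (real p * real h) \<le> e / 2"
  proof -
    have "4 * (real q * real n0) / (real p * e) \<le> real h" unfolding h_def by linarith
    then have "4 * (real q * real n0) \<le> real h * (real p * e)"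
      using p e by (simp add: pos_divide_le_eq)
    then show ?thesis using p h0 by (simp add: field_simps)
  qed
  define H where "H = h * h"
  have Hpos: "0 < H" using h0 by (simp add: H_def)
  have "0 < p * H" "0 < p + q" "0 < e / 4" using p Hpos e by simp_all
  from layered_stable[OF this(1) q this(2,3), of "real n0" H]
  obtain M0 T2 where M0: "0 < M0" and stab: "\<forall>T\<ge>T2. \<forall>(E :: nat \<Rightarrow> nat \<Rightarrow> bool) KK B N A Z lev.
    bipartite_cells KK B (p * H) q (real n0) T \<longrightarrow>
    bipartite_cells.layered E KK B (p * H) q H (M0 * (p + q)) N A Z lev \<longrightarrow>
    bipartite_cells.stable E KK B (p * H) q H T (e / 4) (p + q)"
    by (elim exE conjE)
  have spos: "0 < p * H * (M0 * (p + q))" using p Hpos M0 by simp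
  from mono_clique_partition[OF spos, of c] obtain QQ D where QQ: "disjoint QQ"
    "\<forall>Q\<in>QQ. Q \<subseteq> {1..} \<and> card Q = p * H * (M0 * (p + q)) \<and> (mono_clique c Red Q \<or> mono_clique c Blue Q)"
    and D: "\<forall>T. card ({1..T} - \<Union>{Q \<in> QQ. Q \<subseteq> {1..T}}) \<le> D"
    by (elim exE conjE)
  define fam where "fam k = {Q \<in> QQ. mono_clique c Red Q \<longleftrightarrow> k = Red}" for k
  define other where "other k = (if k = Red then Blue else Red)" for k
  have fam_un: "fam k \<union> fam (other k) = QQ" and fam_int: "fam k \<inter> fam (other k) = {}" for k
    by (cases k; auto simp: fam_def other_def)+
  have fam_cl: "mono_clique c k Q" if "Q \<in> fam k" for k Q
    using that QQ(2) by (cases k) (auto simp: fam_def)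
  define cells where "cells k T = \<Union>{Q \<in> fam k. Q \<subseteq> {1..T}}" for k T
  define T1 where "T1 = T0 + nat \<lceil>T2\<rceil> + nat \<lceil>2 * real D / e\<rceil> + 1"
  define good where "good k T I M \<longleftrightarrow> I \<subseteq> cells (other k) T \<and> M \<subseteq> cells k (n0 * T) \<and>
    (\<gamma> - e) * real T \<le> card I - real q / real p * card M \<and>
    card {v \<in> cells k (n0 * T) - M. e / 4 * T \<le> card {w \<in> I. c {v, w} = k}} < e / 4 * T" for k T I M
  have pair: "\<exists>I M. good k T I M" if T: "T \<ge> T1" for k T
  proof -
    have T': "T0 \<le> T" "T2 \<le> real T" "0 < T" "2 * real D / e \<le> real T"
      using T unfolding T1_def by linarith+
    have "\<exists>I M'. I \<subseteq> \<Union>{Q \<in> fam (other k). Q \<subseteq> {1..T}} \<and> M' \<subseteq> \<Union>{Q \<in> fam k. Q \<subseteq> {1..n0 * T}} \<and>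
      \<gamma> * T - D \<le> card I - real q / real p * card M' + 2 * real q * real n0 * T / (real p * real h) \<and>
      card {v \<in> \<Union>{Q \<in> fam k. Q \<subseteq> {1..n0 * T}} - M'. e / 4 * T \<le> card {w \<in> I. c {v, w} = k}} < e / 4 * T"
    proof (rule colour_pair[OF F S p q H_def h0 _ M0 T'(3) n0(1)])
      show "disjoint (fam k \<union> fam (other k))" unfolding fam_un by (rule QQ(1))
      show "Q \<subseteq> {1..} \<and> card Q = p * H * (M0 * (p + q))" if "Q \<in> fam k \<union> fam (other k)" for Q
        using QQ(2) that unfolding fam_un by blast
      show "card ({1..T} - \<Union>{Q \<in> fam k \<union> fam (other k). Q \<subseteq> {1..T}}) \<le> D"
        unfolding fam_un using D by blast
      show "card (\<Union>WW \<inter> {1..T}) \<le> (1 - \<gamma>) * real T" if "mono_tiling F c k WW" for WW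
        by (rule sparse[rule_format, OF T'(1) that])
      fix N A Z lev
      assume "bipartite_cells {Q \<in> fam k. Q \<subseteq> {1..n0 * T}} (\<Union>{Q \<in> fam (other k). Q \<subseteq> {1..T}}) (p * H) q (real n0) (real T)"
        "bipartite_cells.layered (\<lambda>u v. c {u, v} = k) {Q \<in> fam k. Q \<subseteq> {1..n0 * T}}
          (\<Union>{Q \<in> fam (other k). Q \<subseteq> {1..T}}) (p * H) q H (M0 * (p + q)) N A Z lev"
      then show "bipartite_cells.stable (\<lambda>u v. c {u, v} = k) {Q \<in> fam k. Q \<subseteq> {1..n0 * T}}
          (\<Union>{Q \<in> fam (other k). Q \<subseteq> {1..T}}) (p * H) q H (real T) (e / 4) (p + q)"
        using stab T'(2) by blast
    qed (fact fam_int fam_cl)+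
    then obtain I M' where IM: "I \<subseteq> cells (other k) T" "M' \<subseteq> cells k (n0 * T)"
      and def: "\<gamma> * T - D \<le> card I - real q / real p * card M' + 2 * real q * real n0 * T / (real p * real h)"
      and few: "card {v \<in> cells k (n0 * T) - M'. e / 4 * T \<le> card {w \<in> I. c {v, w} = k}} < e / 4 * T"
      unfolding cells_def by (elim exE conjE)
    have "2 * real q * real n0 * T / (real p * real h) = 2 * real q * real n0 / (real p * real h) * T" by simp
    also have "\<dots> \<le> e / 2 * T" by (intro mult_right_mono h) simp
    finally have 1: "2 * real q * real n0 * T / (real p * real h) \<le> e / 2 * T" .
    have 2: "real D \<le> e / 2 * T" using T'(4) e by (simp add: field_simps)
    have 3: "(\<gamma> - e) * T = \<gamma> * T - e / 2 * T - e / 2 * T" by (simp add: algebra_simps)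
    have "(\<gamma> - e) * T \<le> card I - real q / real p * card M'" unfolding 3 using def 1 2 by linarith
    then have "good k T I M'" unfolding good_def using IM few by (intro conjI)
    then show ?thesis by blast
  qed
  define I where "I k T = (SOME I. \<exists>M. good k T I M)" for k T
  define M where "M k T = (SOME M. good k T (I k T) M)" for k T
  have good: "good k T (I k T) (M k T)" if "T \<ge> T1" for k T
    unfolding M_def I_def by (rule someI_ex[OF someI_ex[OF pair[OF that]]])
  have Isub: "I k T \<subseteq> cells (other k) T" and Ndef: "(\<gamma> - e) * T \<le> card (I k T) - real q / real p * card (M k T)"
    and few: "card {v \<in> cells k (n0 * T) - M k T. e / 4 * T \<le> card {w \<in> I k T. c {v, w} = k}} < e / 4 * T"
    if "T \<ge> T1" for k T
    using good[OF that, of k] unfolding good_def by blast+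
  have cells_sub: "cells k T \<subseteq> {1..T}" for k T by (auto simp: cells_def)
  have fcells: "finite (cells k T)" for k T by (rule finite_subset[OF cells_sub]) simp
  have cells_mono: "cells k T \<subseteq> cells k U" if "T \<le> U" for k T U
  proof -
    have "{1..T} \<subseteq> {1..U}" using that by auto
    then show ?thesis unfolding cells_def by blast
  qed
  have oth: "other Red = Blue" "other Blue = Red" by (simp_all add: other_def)
  have cells_disj: "cells Red T \<inter> cells Blue U = {}" for T U
  proof -
    have "P \<inter> Q = {}" if "P \<in> fam Red" "Q \<in> fam Blue" for P Q
    proof -
      have "P \<noteq> Q" using that fam_int[of Red] unfolding oth by blast
      then show ?thesis using that QQ(1) unfolding fam_def disjoint_def by blast
    qed
    then show ?thesis unfolding cells_def by blast
  qed
  have fI: "finite (I k T)" if "T \<ge> T1" for k T using finite_subset[OF Isub[OF that] fcells] .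
  have total: "card (I Red T) + card (I Blue T) \<le> T" if T: "T \<ge> T1" for T
  proof -
    have sub: "I Red T \<subseteq> cells Blue T" "I Blue T \<subseteq> cells Red T"
      using Isub[OF T, of Red] Isub[OF T, of Blue] unfolding oth .
    then have "I Red T \<inter> I Blue T = {}" using cells_disj[of T T] by blast
    then have "card (I Red T) + card (I Blue T) = card (I Red T \<union> I Blue T)"
      using fI[OF T] by (simp add: card_Un_disjoint)
    also have "\<dots> \<le> card {1..T}"
    proof (rule card_mono)
      show "I Red T \<union> I Blue T \<subseteq> {1..T}" using sub cells_sub by blast
    qed simp
    finally show ?thesis by simp
  qed
  have cI: "real (card (I k T)) \<le> T" if "T \<ge> T1" for k T using total[OF that] by (cases k) auto
  have cross: "card (I Blue U) \<le> card (M Red T) + e * (real T + real U) \<or>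
      card (I Red T) \<le> card (M Blue U) + e * (real T + real U)" if U: "U \<ge> T1" and T: "T \<ge> T1" for U T
  proof (rule ccontr)
    assume neg: "\<not> ?thesis"
    define X where "X = I Blue U - M Red T"
    define Y where "Y = I Red T - M Blue U"
    have fXY: "finite X" "finite Y" using fI U T by (simp_all add: X_def Y_def)
    have fM: "finite (M Red T)" "finite (M Blue U)"
      using good[OF T, of Red] good[OF U, of Blue] finite_subset[OF _ fcells] unfolding good_def by blast+
    have "card (I Blue U) \<le> card (M Red T) + card X"
      using card_mono[of "M Red T \<union> X" "I Blue U"] card_Un_le[of "M Red T" X] fM fXY
      by (auto simp: X_def)
    then have X1: "e * (real T + real U) < card X" using neg by linarith
    have "card (I Red T) \<le> card (M Blue U) + card Y"
      using card_mono[of "M Blue U \<union> Y" "I Red T"] card_Un_le[of "M Blue U" Y] fM fXY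
      by (auto simp: Y_def)
    then have Y1: "e * (real T + real U) < card Y" using neg by linarith
    have nn: "0 \<le> e * real T" "0 \<le> e * real U" using e by simp_all
    have eTU: "e * (real T + real U) = e * T + e * U" by (rule distrib_left)
    have cX: "real (card X) \<le> U" "real (card Y) \<le> T"
    proof -
      have "card X \<le> card (I Blue U)" "card Y \<le> card (I Red T)"
        using fI U T by (auto simp: X_def Y_def intro!: card_mono)
      then show "real (card X) \<le> U" "real (card Y) \<le> T" using cI[OF U, of Blue] cI[OF T, of Red] by linarith+
    qed
    have bnd: "b \<le> n0 * a" if "e * b \<le> real a" for a b :: nat
    proof -
      have "real b \<le> 1 / e * a" using that e by (simp add: field_simps)
      also have "\<dots> \<le> real n0 * a" using n0(2) by (intro mult_right_mono) simp_all
      finally have "real b \<le> real (n0 * a)" by simp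
      then show ?thesis unfolding of_nat_le_iff .
    qed
    \<comment> \<open>\<open>X\<close> has at most \<open>U\<close> and \<open>Y\<close> at most
      \<open>T\<close> elements, yet both exceed \<open>e * (T + U)\<close>. Hence \<open>T\<close>
      and \<open>U\<close> are comparable, and \<open>X\<close> and \<open>Y\<close> lie within the
      cells of the pair for the other time.\<close>
    have UT: "U \<le> n0 * T" "T \<le> n0 * U" using bnd[of U T] bnd[of T U] X1 Y1 cX nn unfolding eTU by linarith+
    have Xc: "X \<subseteq> cells Red (n0 * T) - M Red T"
      using Isub[OF U, of Blue] cells_mono[OF UT(1), of Red] unfolding oth X_def by blast
    have Yc: "Y \<subseteq> cells Blue (n0 * U) - M Blue U"
      using Isub[OF T, of Red] cells_mono[OF UT(2), of Blue] unfolding oth Y_def by blast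
    have ne: "X \<noteq> {}" "Y \<noteq> {}" using X1 Y1 nn unfolding eTU by auto
    have XY4: "e / 4 * T \<le> card X / 4" "e / 4 * T \<le> card Y / 4" "e / 4 * U \<le> card X / 4" "e / 4 * U \<le> card Y / 4"
      using X1 Y1 nn unfolding eTU by linarith+
    from dense_bipartite[OF fXY ne, of "\<lambda>v w. c {v, w} = Red"] show False
    proof
      assume *: "card X / 4 \<le> card {v \<in> X. card Y / 4 \<le> card {w \<in> Y. c {v, w} = Red}}"
      have "card {v \<in> X. card Y / 4 \<le> card {w \<in> Y. c {v, w} = Red}}
          \<le> card {v \<in> cells Red (n0 * T) - M Red T. e / 4 * T \<le> card {w \<in> I Red T. c {v, w} = Red}}"
      proof (rule card_mono)
        show "finite {v \<in> cells Red (n0 * T) - M Red T. e / 4 * T \<le> card {w \<in> I Red T. c {v, w} = Red}}"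
          using fcells by simp
        show "{v \<in> X. card Y / 4 \<le> card {w \<in> Y. c {v, w} = Red}}
          \<subseteq> {v \<in> cells Red (n0 * T) - M Red T. e / 4 * T \<le> card {w \<in> I Red T. c {v, w} = Red}}"
        proof
          fix v assume v: "v \<in> {v \<in> X. card Y / 4 \<le> card {w \<in> Y. c {v, w} = Red}}"
          have "card {w \<in> Y. c {v, w} = Red} \<le> card {w \<in> I Red T. c {v, w} = Red}"
            using fI[OF T] by (intro card_mono) (auto simp: Y_def)
          then have "e / 4 * T \<le> card {w \<in> I Red T. c {v, w} = Red}" using v XY4(2) by auto
          then show "v \<in> {v \<in> cells Red (n0 * T) - M Red T. e / 4 * T \<le> card {w \<in> I Red T. c {v, w} = Red}}"
            using v Xc by blast
        qed
      qed
      then show False using few[OF T, of Red] * XY4(1) by linarith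
    next
      assume *: "card Y / 4 \<le> card {w \<in> Y. card X / 4 \<le> card {v \<in> X. c {v, w} \<noteq> Red}}"
      have blue: "c {v, w} \<noteq> Red \<longleftrightarrow> c {w, v} = Blue" for v w
        by (cases "c {v, w}") (auto simp: insert_commute)
      have "card {w \<in> Y. card X / 4 \<le> card {v \<in> X. c {v, w} \<noteq> Red}}
          \<le> card {w \<in> cells Blue (n0 * U) - M Blue U. e / 4 * U \<le> card {v \<in> I Blue U. c {w, v} = Blue}}"
      proof (rule card_mono)
        show "finite {w \<in> cells Blue (n0 * U) - M Blue U. e / 4 * U \<le> card {v \<in> I Blue U. c {w, v} = Blue}}"
          using fcells by simp
        show "{w \<in> Y. card X / 4 \<le> card {v \<in> X. c {v, w} \<noteq> Red}}
          \<subseteq> {w \<in> cells Blue (n0 * U) - M Blue U. e / 4 * U \<le> card {v \<in> I Blue U. c {w, v} = Blue}}"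
        proof
          fix w assume w: "w \<in> {w \<in> Y. card X / 4 \<le> card {v \<in> X. c {v, w} \<noteq> Red}}"
          have "card {v \<in> X. c {v, w} \<noteq> Red} \<le> card {v \<in> I Blue U. c {w, v} = Blue}"
            using fI[OF U] unfolding blue by (intro card_mono) (auto simp: X_def)
          then have "e / 4 * U \<le> card {v \<in> I Blue U. c {w, v} = Blue}" using w XY4(3) by auto
          then show "w \<in> {w \<in> cells Blue (n0 * U) - M Blue U. e / 4 * U \<le> card {v \<in> I Blue U. c {w, v} = Blue}}"
            using w Yc by blast
        qed
      qed
      then show False using few[OF U, of Blue] * XY4(4) by linarith
    qed
  qed
  show ?thesis
    by (intro exI[of _ T1] exI[of _ I] exI[of _ M] conjI allI impI Ndef total cross)
qed

section \<open>From the bound on h to a bound on f\<close>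

text \<open>Rules out the value \<open>-\<infinity>\<close>: a real upper bound then makes
  \<open>h_fun\<close> real, and the denominator in \<open>f_fun\<close> is positive.\<close>

lemma h_fun_nonneg: "0 \<le> h_fun \<gamma>"
  unfolding h_fun_def
proof (rule INF_greatest)
  fix g :: "real \<Rightarrow> real" assume "g \<in> {g. 1-lipschitz_on {0..} g \<and> g 0 = 0}"
  then have cont: "continuous_on {0..} g" by (auto intro: lipschitz_on_continuous_on)
  have "closed {z \<in> {0..}. t \<le> \<gamma> * z + g z}" "closed {z \<in> {0..}. t \<le> \<gamma> * z - g z}" for t
    by (intro continuous_on_closed_Collect_le continuous_intros cont closed_atLeast)+
  then have cl: "closed {z. z \<ge> 0 \<and> \<gamma> * z + g z \<ge> t}" "closed {z. z \<ge> 0 \<and> \<gamma> * z - g z \<ge> t}" for t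
    by (simp_all add: atLeast_def)
  have nn: "0 \<le> Gamma_plus \<gamma> g t + Gamma_minus \<gamma> g t" for t
    unfolding Gamma_plus_def Gamma_minus_def
    by (intro add_nonneg_nonneg min_or_infinity_nonneg cl) auto
  have "eventually (\<lambda>t::real. 0 \<le> (Gamma_plus \<gamma> g t + Gamma_minus \<gamma> g t) / ereal t) at_top"
    using eventually_gt_at_top[of 0]
  proof eventually_elim
    case (elim t)
    then show ?case using nn[of t] ereal_divide_right_mono[OF nn[of t], of "ereal t"] by simp
  qed
  then show "0 \<le> Limsup at_top (\<lambda>t::real. (Gamma_plus \<gamma> g t + Gamma_minus \<gamma> g t) / ereal t)"
    by (intro le_Limsup) simp_all
qed

lemma f_fun_eq:
  assumes "0 < lam"
  shows "f_fun (ereal lam) = 1 - 1 / (ereal (2 * lam / (1 + lam)\<^sup>2) * h_fun ((lam - 1) / (lam + 1))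
    + ereal (2 * lam / (1 + lam)))"
  using assms by (simp add: f_fun_def Let_def zero_ereal_def)

lemma f_fun_le_1:
  assumes "0 < lam"
  shows "f_fun (ereal lam) \<le> 1"
proof -
  have "0 \<le> ereal (2 * lam / (1 + lam)\<^sup>2) * h_fun ((lam - 1) / (lam + 1)) + ereal (2 * lam / (1 + lam))"
    using assms h_fun_nonneg by (intro add_nonneg_nonneg ereal_0_le_mult) simp_all
  then show ?thesis unfolding f_fun_eq[OF assms]
    by (cases "ereal (2 * lam / (1 + lam)\<^sup>2) * h_fun ((lam - 1) / (lam + 1)) + ereal (2 * lam / (1 + lam))")
      (auto simp: one_ereal_def divide_ereal_def)
qed

text \<open>The assumption is the bound of \<open>h_fun_le\<close> for \<open>c = \<gamma>\<close>
  and \<open>e = 0\<close>. Inserted into the denominator of \<open>f_fun\<close> it simplifies to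
  exactly \<open>1 / \<gamma>\<close>.\<close>

lemma f_fun_le:
  assumes lam: "0 < lam" and \<gamma>: "0 < \<gamma>"
    and h: "h_fun ((lam - 1) / (lam + 1)) \<le> ereal ((1 + lam - 2 * lam * \<gamma>) / (2 * lam * \<gamma> / (lam + 1)))"
  shows "f_fun (ereal lam) \<le> ereal (1 - \<gamma>)"
proof -
  obtain r where r: "h_fun ((lam - 1) / (lam + 1)) = ereal r" "0 \<le> r"
    using h h_fun_nonneg[of "(lam - 1) / (lam + 1)"] by (cases "h_fun ((lam - 1) / (lam + 1))") auto
  define z where "z = 2 * lam / (1 + lam)\<^sup>2 * r + 2 * lam / (1 + lam)"
  have z0: "0 < z" unfolding z_def using lam r(2) by (intro add_nonneg_pos) simp_all
  have "r \<le> (1 + lam - 2 * lam * \<gamma>) / (2 * lam * \<gamma> / (lam + 1))" using h r(1) by simp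
  then have "z \<le> 2 * lam / (1 + lam)\<^sup>2 * ((1 + lam - 2 * lam * \<gamma>) / (2 * lam * \<gamma> / (lam + 1))) + 2 * lam / (1 + lam)"
    unfolding z_def using lam by (intro add_right_mono mult_left_mono) simp_all
  also have "\<dots> = 1 / \<gamma>"
  proof -
    define s where "s = 1 + lam"
    have s: "s > 0" using lam by (simp add: s_def)
    have "2 * lam / s\<^sup>2 * ((s - 2 * lam * \<gamma>) / (2 * lam * \<gamma> / s)) + 2 * lam / s = 1 / \<gamma>"
      using s lam \<gamma> by (simp add: field_simps power2_eq_square)
    then show ?thesis by (simp add: s_def add.commute)
  qed
  finally have "\<gamma> \<le> 1 / z" using z0 \<gamma> by (simp add: field_simps)
  moreover have "f_fun (ereal lam) = ereal (1 - 1 / z)"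
    unfolding f_fun_eq[OF lam] r(1) using z0 by (simp add: z_def one_ereal_def)
  ultimately show ?thesis by simp
qed

text \<open>Otherwise both colours leave a proportion \<open>\<gamma> = 1 - l\<close> uncovered at
  all late times. Then \<open>total\<close> alone gives \<open>l \<ge> 1 / 2\<close>, and
  \<open>h_fun_le\<close> with \<open>f_fun_le\<close> gives
  \<open>f_fun (ereal lam) \<le> l\<close>.\<close>

lemma dense_tilings:
  fixes c :: "nat set \<Rightarrow> colour" and l :: real
  assumes F: "simple_graph F" "finite (verts F)" "card (verts F) = p + q"
    and S: "S \<subseteq> verts F" "indep S (edges F)" "card S = q" and p: "0 < p" and q: "0 < q"
    and l: "l < 1" "l < 1 / 2 \<or> ereal l < f_fun (ereal (real p / real q))"
  shows "\<exists>k. \<forall>T0. \<exists>T\<ge>T0. \<exists>WW. mono_tiling F c k WW \<and> l * real T \<le> card (\<Union>WW \<inter> {1..T})"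
proof (rule ccontr)
  assume "\<not> ?thesis"
  then have "\<forall>k. \<exists>T0. \<forall>T\<ge>T0. \<forall>WW. mono_tiling F c k WW \<longrightarrow> \<not> l * real T \<le> card (\<Union>WW \<inter> {1..T})"
    by blast
  from choice[OF this] obtain T0 where T0:
    "\<forall>k. \<forall>T\<ge>T0 k. \<forall>WW. mono_tiling F c k WW \<longrightarrow> \<not> l * real T \<le> card (\<Union>WW \<inter> {1..T})"
    by (elim exE)
  define \<gamma> where "\<gamma> = 1 - l"
  have \<gamma>: "0 < \<gamma>" using l(1) by (simp add: \<gamma>_def)
  have sparse: "\<forall>T\<ge>max (T0 Red) (T0 Blue). \<forall>k WW. mono_tiling F c k WW \<longrightarrow>
    card (\<Union>WW \<inter> {1..T}) \<le> (1 - \<gamma>) * real T"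
  proof (intro allI impI)
    fix T k WW assume T: "T \<ge> max (T0 Red) (T0 Blue)" and WW: "mono_tiling F c k WW"
    have "T0 k \<le> T" using T by (cases k) auto
    then show "card (\<Union>WW \<inter> {1..T}) \<le> (1 - \<gamma>) * real T"
      using T0[rule_format, OF _ WW] unfolding \<gamma>_def by fastforce
  qed
  define lam where "lam = real p / real q"
  have lam: "0 < lam" using p q by (simp add: lam_def)
  have ql: "real q / real p * x = x / lam" for x by (simp add: lam_def)
  have bounds: "2 * (\<gamma> - e) \<le> 1 \<and> (0 < 2 * lam * (\<gamma> - e) / (lam + 1) - 2 * e \<longrightarrow>
      h_fun ((lam - 1) / (lam + 1))
        \<le> ereal ((1 + lam - 2 * lam * (\<gamma> - e)) / (2 * lam * (\<gamma> - e) / (lam + 1) - 2 * e)))"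
    if e: "0 < e" for e
  proof -
    from deficient_families[OF F S p q e sparse] obtain T1 and I M :: "colour \<Rightarrow> nat \<Rightarrow> nat set" where
      d: "\<forall>T\<ge>T1. \<forall>k. (\<gamma> - e) * real T \<le> card (I k T) - real q / real p * card (M k T)"
      and total: "\<forall>T\<ge>T1. card (I Red T) + card (I Blue T) \<le> T"
      and cross: "\<forall>U\<ge>T1. \<forall>T\<ge>T1. card (I Blue U) \<le> card (M Red T) + e * (real T + real U) \<or>
        card (I Red T) \<le> card (M Blue U) + e * (real T + real U)"
      by (elim exE conjE)
    have total': "real (card (I Red T)) + real (card (I Blue T)) \<le> T" if "T \<ge> T1" for T
    proof -
      have "real (card (I Red T) + card (I Blue T)) \<le> real T"
        using total that unfolding of_nat_le_iff by blast
      then show ?thesis by simp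
    qed
    have "2 * (\<gamma> - e) \<le> 1"
    proof -
      define T where "T = Suc T1"
      have T: "T \<ge> T1" "0 < real T" by (simp_all add: T_def)
      have nn: "0 \<le> real q / real p * card (M Red T)" "0 \<le> real q / real p * card (M Blue T)" by simp_all
      have "(\<gamma> - e) * T \<le> card (I Red T)" "(\<gamma> - e) * T \<le> card (I Blue T)"
        using d[rule_format, OF T(1), of Red] d[rule_format, OF T(1), of Blue] nn by linarith+
      then have "2 * (\<gamma> - e) * T \<le> 1 * real T" using total'[OF T(1)] by linarith
      then show ?thesis using T(2) by (rule mult_right_le_imp_le)
    qed
    moreover have "h_fun ((lam - 1) / (lam + 1))
        \<le> ereal ((1 + lam - 2 * lam * (\<gamma> - e)) / (2 * lam * (\<gamma> - e) / (lam + 1) - 2 * e))"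
      if pos: "0 < 2 * lam * (\<gamma> - e) / (lam + 1) - 2 * e"
    proof (rule h_fun_le[OF lam _ pos, where \<beta> = "\<lambda>T. real (card (I Red T))" and \<rho> = "\<lambda>T. real (card (M Red T))"
          and \<beta>' = "\<lambda>T. real (card (M Blue T))" and \<rho>' = "\<lambda>T. real (card (I Blue T))"])
      show "(\<gamma> - e) * real T \<le> real (card (I Red T)) - real (card (M Red T)) / lam" if "T \<ge> T1" for T
        using d[rule_format, OF that, of Red] unfolding ql .
      show "(\<gamma> - e) * real T \<le> real (card (I Blue T)) - real (card (M Blue T)) / lam" if "T \<ge> T1" for T
        using d[rule_format, OF that, of Blue] unfolding ql .
      show "real (card (I Blue U)) \<le> real (card (M Red T)) + e * (real T + real U) \<or>
        real (card (I Red T)) \<le> real (card (M Blue U)) + e * (real T + real U)"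
        if "U \<ge> T1" "T \<ge> T1" for U T
        using cross that by blast
    qed (use e total' in simp_all)
    ultimately show ?thesis by blast
  qed
  have "\<gamma> \<le> 1 / 2"
  proof (rule field_le_epsilon)
    fix e :: real assume "0 < e"
    then show "\<gamma> \<le> 1 / 2 + e" using bounds by fastforce
  qed
  then have l2: "ereal l < f_fun (ereal lam)" using l(2) unfolding \<gamma>_def lam_def by auto
  \<comment> \<open>The bound on \<open>h_fun\<close> holds for all small positive \<open>e\<close>;
    its right-hand side is continuous at 0, where the denominator is positive, so \<open>e\<close>
    can tend to 0.\<close>
  define \<phi> where "\<phi> e = (1 + lam - 2 * lam * (\<gamma> - e)) / (2 * lam * (\<gamma> - e) / (lam + 1) - 2 * e)" for e
  have den: "((\<lambda>e. 2 * lam * (\<gamma> - e) / (lam + 1) - 2 * e) \<longlongrightarrow> 2 * lam * (\<gamma> - 0) / (lam + 1) - 2 * 0) (at_right 0)"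
    using lam by (intro tendsto_intros) simp
  have den0: "0 < 2 * lam * (\<gamma> - 0) / (lam + 1) - 2 * 0" using lam \<gamma> by simp
  have "((\<lambda>e. ereal (\<phi> e)) \<longlongrightarrow> ereal (\<phi> 0)) (at_right 0)"
    unfolding \<phi>_def using den0 by (intro tendsto_intros den) auto
  moreover have "eventually (\<lambda>e. h_fun ((lam - 1) / (lam + 1)) \<le> ereal (\<phi> e)) (at_right 0)"
    using order_tendstoD(1)[OF den den0] eventually_at_right_less[of 0]
  proof eventually_elim
    case (elim e)
    then show ?case using bounds[of e] unfolding \<phi>_def by blast
  qed
  ultimately have "h_fun ((lam - 1) / (lam + 1)) \<le> ereal (\<phi> 0)"
    by (rule tendsto_lowerbound) simp
  then have "f_fun (ereal lam) \<le> ereal (1 - \<gamma>)"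
    by (intro f_fun_le[OF lam \<gamma>]) (simp add: \<phi>_def)
  then show False using l2 by (simp add: \<gamma>_def)
qed

section \<open>The lower bound for the Ramsey density\<close>

text \<open>The case of ratio 0, where \<open>f_fun\<close> is 1. Without edges any bijection onto
  the vertices of \<open>K_nat\<close> gives a copy; \<open>Suc\<close> is there because these start
  at 1.\<close>

lemma ramsey_density_edgeless:
  assumes "finite (verts F)" "verts F \<noteq> {}" "edges F = {}"
  shows "1 \<le> ramsey_density (omega_copies F)"
proof -
  have "infinite (verts F \<times> (UNIV :: nat set))" using assms(2) by (simp add: finite_cartesian_product_iff)
  moreover have "countable (verts F \<times> (UNIV :: nat set))" using assms(1) by (simp add: countable_finite)
  ultimately have "bij_betw (to_nat_on (verts F \<times> (UNIV :: nat set))) (verts F \<times> UNIV) UNIV"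
    by (intro to_nat_on_infinite)
  moreover have "bij_betw Suc UNIV {1..}"
    by (auto simp: bij_betw_def image_def) (metis Suc_le_D)
  ultimately have bij: "bij_betw (Suc \<circ> to_nat_on (verts F \<times> (UNIV :: nat set))) (verts F \<times> UNIV) {1..}"
    by (rule bij_betw_trans)
  define H' :: "nat ugraph" where "H' = \<lparr>verts = {1..}, edges = {}\<rparr>"
  have "subgraph H' K_nat" by (simp add: subgraph_def simple_graph_def H'_def K_nat_def)
  moreover have "monochromatic_graph c H'" for c by (simp add: monochromatic_graph_def H'_def)
  moreover have "graph_iso (omega_copies F) H'"
    unfolding graph_iso_def using bij assms(3)
    by (intro exI[of _ "Suc \<circ> to_nat_on (verts F \<times> (UNIV :: nat set))"])
      (simp add: omega_copies_def H'_def)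
  moreover have "ereal 1 \<le> upper_density (verts H')"
    unfolding upper_density_def
  proof (rule le_Limsup)
    show "eventually (\<lambda>t. ereal 1 \<le> ereal (real (card (verts H' \<inter> {1..t})) / real t)) sequentially"
      using eventually_gt_at_top[of 0]
    proof eventually_elim
      case (elim t)
      have "{1..} \<inter> {1..t} = {1..t}" by auto
      then show ?case using elim by (simp add: H'_def)
    qed
  qed simp
  ultimately have "ereal 1 \<le> ramsey_density (omega_copies F)"
    unfolding ramsey_density_def by (intro Sup_upper) blast
  then show ?thesis by (simp add: one_ereal_def)
qed

lemma finite_indep_cards:
  "finite (verts F) \<Longrightarrow> finite {card S |S. S \<subseteq> verts F \<and> indep S (edges F)}"
  by (rule finite_subset[of _ "card ` Pow (verts F)"]) auto

lemma independence_number_attained: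
  assumes "finite (verts F)"
  obtains S where "S \<subseteq> verts F" "indep S (edges F)" "card S = independence_number F"
proof -
  let ?A = "{card S |S. S \<subseteq> verts F \<and> indep S (edges F)}"
  have "card {} \<in> ?A" by (auto intro!: exI[of _ "{}"])
  then have "Max ?A \<in> ?A" using finite_indep_cards[OF assms] by (intro Max_in) auto
  then show ?thesis using that unfolding independence_number_def by auto
qed

lemma independence_number_pos:
  assumes "finite (verts F)" "verts F \<noteq> {}"
  shows "0 < independence_number F"
proof -
  obtain v where v: "v \<in> verts F" using assms(2) by blast
  let ?A = "{card S |S. S \<subseteq> verts F \<and> indep S (edges F)}"
  have "card {v} \<in> ?A" using v by (intro CollectI exI[of _ "{v}"]) (simp add: indep_def)
  with finite_indep_cards[OF assms(1)] have "card {v} \<le> Max ?A" by (rule Max_ge)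
  then show ?thesis by (simp add: independence_number_def)
qed

theorem theorem2:
  fixes F :: "'a ugraph"
  assumes "simple_graph F" and "finite (verts F)" and "verts F \<noteq> {}"
  shows "ramsey_density (omega_copies F)
           \<ge> f_fun (ereal (real (card (verts F)) / real (independence_number F) - 1))"
proof -
  obtain S where S: "S \<subseteq> verts F" "indep S (edges F)" "card S = independence_number F"
    using independence_number_attained[OF assms(2)] .
  define q where "q = independence_number F"
  have q: "0 < q" unfolding q_def by (rule independence_number_pos[OF assms(2,3)])
  have "q \<le> card (verts F)" using S(1,3) assms(2) by (metis card_mono q_def)
  then obtain p where n: "card (verts F) = p + q" by (metis add.commute le_Suc_ex)
  have ratio: "real (card (verts F)) / real (independence_number F) - 1 = real p / real q"
    unfolding n q_def[symmetric] using q by (simp add: field_simps)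
  show ?thesis
  \<comment> \<open>For \<open>p = 0\<close> the whole vertex set is independent; the construction
    with cliques needs \<open>p > 0\<close>.\<close>
  proof (cases "p = 0")
    case True
    then have "S = verts F" using S n assms(2) by (simp add: card_subset_eq q_def)
    then have "e \<notin> edges F" if "e \<in> [verts F]\<^bsup>2\<^esup>" for e
      using that S(2) by (auto simp: indep_def elim!: nsets2_E)
    then have "edges F = {}" using assms(1) by (auto simp: simple_graph_def)
    then show ?thesis unfolding ratio using ramsey_density_edgeless[OF assms(2,3)] True
      by (simp add: f_fun_def)
  next
    case False
    then have p: "0 < p" by simp
    have lam: "0 < real p / real q" using p q by simp
    have ge: "ereal l \<le> ramsey_density (omega_copies F)" if l: "ereal l < f_fun (ereal (real p / real q))" for l
    proof -
      \<comment> \<open>\<open>omega_copies_dense\<close> needs a positive density. The value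
        \<open>1 / 3\<close> is positive and below \<open>1 / 2\<close>, so when it exceeds
        \<open>l\<close> the first alternative of \<open>dense_tilings\<close> applies.\<close>
      define l' where "l' = max l (1 / 3)"
      have "ereal l < 1" using l f_fun_le_1[OF lam] by (rule less_le_trans)
      then have l': "l' < 1" "0 < l'" "l \<le> l'" by (auto simp: l'_def)
      have l'': "l' < 1 / 2 \<or> ereal l' < f_fun (ereal (real p / real q))" using l by (auto simp: l'_def max_def)
      have "\<exists>H'. subgraph H' K_nat \<and> monochromatic_graph c H' \<and> graph_iso (omega_copies F) H' \<and>
          ereal l \<le> upper_density (verts H')" for c
      proof -
        obtain k where "\<And>T0. \<exists>T\<ge>T0. \<exists>WW. mono_tiling F c k WW \<and> l' * real T \<le> card (\<Union>WW \<inter> {1..T})"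
          using dense_tilings[OF assms(1,2) n S(1,2) S(3)[folded q_def] p q l'(1) l''] by blast
        from omega_copies_dense[OF assms(1,2) l'(2) this]
        obtain H' where "subgraph H' K_nat" "monochromatic_graph c H'" "graph_iso (omega_copies F) H'"
          "ereal l' \<le> upper_density (verts H')" by blast
        moreover have "ereal l \<le> ereal l'" using l'(3) by simp
        ultimately show ?thesis by (meson order_trans)
      qed
      then show ?thesis unfolding ramsey_density_def by (intro Sup_upper) blast
    qed
    show ?thesis unfolding ratio
    proof (rule dense_le)
      fix y assume y: "y < f_fun (ereal (real p / real q))"
      obtain l where l: "y < ereal l" "ereal l < f_fun (ereal (real p / real q))"
        using ereal_dense2[OF y] by blast
      show "y \<le> ramsey_density (omega_copies F)" using ge[OF l(2)] l(1) by simp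
    qed
  qed
qed

end
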